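(* If $G$ is a finite transitively commutative (TC) group with trivial center, and $C_G(a_1),\dots,C_G(a_k)$ are the centralizers that cover $G$, then $$B(2,G)\simeq\bigvee_{1\le i\le k}\left(\prod_{p\,\mid\,|C_G(a_i)|}BP\right),$$ where, in the factor indexed by the prime $p$, $P\in Syl_p(G)$ is a Sylow $p$-subgroup of $G$.
   Context: A group $G$ is transitively commutative (TC) if for all $g,h,k\in G-Z(G)$, $[g,h]=1=[h,k]$ implies $[g,k]=1$. For a finite TC group $G$, choose $a_1,\dots,a_k\in G-Z(G)$ such that $G=\bigcup_{1\le i\le k}C_G(a_i)$ and no smaller number of centralizers covers $G$; the subgroups $C_G(a_i)$ occurring do not depend on the choice of representatives. (For the trivial group, $k=0$ and the empty wedge is a point.) For a finite (discrete) group $G$, $B_*(2,G)$ is the simplicial set with $B_n(2,G)=Hom(\mathbb Z^n,G)\subset G^n$, the set of $n$-tuples of pairwise commuting elements, with faces $d_0(g_1,\dots,g_n)=(g_2,\dots,g_n)$, $d_i(g_1,\dots,g_n)=(g_1,\dots,g_ig_{i+1},\dots,g_n)$ for $0<i<n$, $d_n(g_1,\dots,g_n)=(g_1,\dots,g_{n-1})$, and degeneracies $s_j$ inserting $1$ after $g_j$. $B(2,G)$ is its geometric realization. $BP$ is the classifying space of $P$. *)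

theory Defs
  imports "HOL-Homology.Simplices" "HOL-Algebra.Sylow"
begin

section \<open>Group theory\<close>

definition commutator :: "('a, 'b) monoid_scheme \<Rightarrow> 'a \<Rightarrow> 'a \<Rightarrow> 'a" where
  "commutator G g h = g \<otimes>\<^bsub>G\<^esub> h \<otimes>\<^bsub>G\<^esub> inv\<^bsub>G\<^esub> g \<otimes>\<^bsub>G\<^esub> inv\<^bsub>G\<^esub> h"

definition center :: "('a, 'b) monoid_scheme \<Rightarrow> 'a set" where
  "center G = {z \<in> carrier G. \<forall>g \<in> carrier G. z \<otimes>\<^bsub>G\<^esub> g = g \<otimes>\<^bsub>G\<^esub> z}"

definition centralizer :: "('a, 'b) monoid_scheme \<Rightarrow> 'a \<Rightarrow> 'a set" where
  "centralizer G a = {g \<in> carrier G. g \<otimes>\<^bsub>G\<^esub> a = a \<otimes>\<^bsub>G\<^esub> g}"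

definition transitively_commutative :: "('a, 'b) monoid_scheme \<Rightarrow> bool" where
  "transitively_commutative G \<longleftrightarrow>
     (\<forall>g \<in> carrier G - center G. \<forall>h \<in> carrier G - center G. \<forall>k \<in> carrier G - center G.
        commutator G g h = \<one>\<^bsub>G\<^esub> \<and> \<one>\<^bsub>G\<^esub> = commutator G h k \<longrightarrow> commutator G g k = \<one>\<^bsub>G\<^esub>)"

definition centralizer_cover :: "('a, 'b) monoid_scheme \<Rightarrow> nat \<Rightarrow> (nat \<Rightarrow> 'a) \<Rightarrow> bool" where
  "centralizer_cover G k a \<longleftrightarrow>
     (\<forall>i \<in> {1..k}. a i \<in> carrier G - center G) \<and> carrier G = (\<Union>i \<in> {1..k}. centralizer G (a i))"

text \<open>
  The trivial group has no noncentral elements, so no family of centralizers of noncentral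
  elements covers it; by convention its minimal cover is the empty family.
\<close>

definition minimal_centralizer_cover ::
    "('a, 'b) monoid_scheme \<Rightarrow> nat \<Rightarrow> (nat \<Rightarrow> 'a) \<Rightarrow> bool" where
  "minimal_centralizer_cover G k a \<longleftrightarrow>
     carrier G = {\<one>\<^bsub>G\<^esub>} \<and> k = 0 \<or>
     centralizer_cover G k a \<and> (\<forall>m b. centralizer_cover G m b \<longrightarrow> k \<le> m)"

definition sylow_subgroups :: "nat \<Rightarrow> ('a, 'b) monoid_scheme \<Rightarrow> 'a set set" where
  "sylow_subgroups p G = {P. prime p \<and> subgroup P G \<and> card P = p ^ multiplicity p (order G)}"


section \<open>Quotient topologies and wedges\<close>

definition quotient_topology :: "'a topology \<Rightarrow> ('a \<Rightarrow> 'b) \<Rightarrow> 'b topology" where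
  "quotient_topology X f =
     topology (\<lambda>U. U \<subseteq> f ` topspace X \<and> openin X {x \<in> topspace X. f x \<in> U})"

lemma openin_quotient_topology:
  "openin (quotient_topology X f) U \<longleftrightarrow>
     U \<subseteq> f ` topspace X \<and> openin X {x \<in> topspace X. f x \<in> U}"
proof -
  have "istopology (\<lambda>U. U \<subseteq> f ` topspace X \<and> openin X {x \<in> topspace X. f x \<in> U})"
    unfolding istopology_def
  proof (intro conjI allI impI)
    fix S T
    assume S: "S \<subseteq> f ` topspace X \<and> openin X {x \<in> topspace X. f x \<in> S}"
      and T: "T \<subseteq> f ` topspace X \<and> openin X {x \<in> topspace X. f x \<in> T}"
    have "{x \<in> topspace X. f x \<in> S \<inter> T} =
        {x \<in> topspace X. f x \<in> S} \<inter> {x \<in> topspace X. f x \<in> T}" by auto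
    then show "openin X {x \<in> topspace X. f x \<in> S \<inter> T}" using S T by auto
    show "S \<inter> T \<subseteq> f ` topspace X" using S by auto
  next
    fix K
    assume K: "\<forall>S\<in>K. S \<subseteq> f ` topspace X \<and> openin X {x \<in> topspace X. f x \<in> S}"
    have "{x \<in> topspace X. f x \<in> \<Union>K} = (\<Union>S\<in>K. {x \<in> topspace X. f x \<in> S})" by auto
    then show "openin X {x \<in> topspace X. f x \<in> \<Union>K}" using K by auto
    show "\<Union>K \<subseteq> f ` topspace X" using K by auto
  qed
  then show ?thesis by (simp add: quotient_topology_def)
qed

text \<open>
  The wedge of the spaces \<open>X i\<close> (for \<open>i\<close> in \<open>I\<close>) at base points \<open>b i\<close>: the point \<open>None\<close> is the
  common base point, \<open>Some (i, x)\<close> is the point \<open>x\<close> of \<open>X i\<close> different from \<open>b i\<close>, and the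
  topology is the final one with respect to the inclusions \<open>wedge_in b i\<close>. The base point
  \<open>None\<close> is always present, so that the empty wedge is a point.
\<close>

definition wedge_in :: "('i \<Rightarrow> 'a) \<Rightarrow> 'i \<Rightarrow> 'a \<Rightarrow> ('i \<times> 'a) option" where
  "wedge_in b i x = (if x = b i then None else Some (i, x))"

definition wedge :: "'i set \<Rightarrow> ('i \<Rightarrow> 'a topology) \<Rightarrow> ('i \<Rightarrow> 'a) \<Rightarrow> ('i \<times> 'a) option topology" where
  "wedge I X b =
     topology (\<lambda>U. U \<subseteq> insert None (\<Union>i\<in>I. wedge_in b i ` topspace (X i)) \<and>
       (\<forall>i\<in>I. openin (X i) {x \<in> topspace (X i). wedge_in b i x \<in> U}))"

lemma openin_wedge:
  "openin (wedge I X b) U \<longleftrightarrow>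
     U \<subseteq> insert None (\<Union>i\<in>I. wedge_in b i ` topspace (X i)) \<and>
     (\<forall>i\<in>I. openin (X i) {x \<in> topspace (X i). wedge_in b i x \<in> U})"
proof -
  let ?W = "insert None (\<Union>i\<in>I. wedge_in b i ` topspace (X i))"
  let ?pre = "\<lambda>i U. {x \<in> topspace (X i). wedge_in b i x \<in> U}"
  have "istopology (\<lambda>U. U \<subseteq> ?W \<and> (\<forall>i\<in>I. openin (X i) (?pre i U)))"
    unfolding istopology_def
  proof (intro conjI allI impI ballI)
    fix S T i
    assume S: "S \<subseteq> ?W \<and> (\<forall>i\<in>I. openin (X i) (?pre i S))"
      and T: "T \<subseteq> ?W \<and> (\<forall>i\<in>I. openin (X i) (?pre i T))" and i: "i \<in> I"
    have "?pre i (S \<inter> T) = ?pre i S \<inter> ?pre i T" by auto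
    then show "openin (X i) (?pre i (S \<inter> T))" using S T i by auto
  next
    fix S T
    assume "S \<subseteq> ?W \<and> (\<forall>i\<in>I. openin (X i) (?pre i S))"
    then show "S \<inter> T \<subseteq> ?W" by auto
  next
    fix K i
    assume K: "\<forall>S\<in>K. S \<subseteq> ?W \<and> (\<forall>i\<in>I. openin (X i) (?pre i S))" and i: "i \<in> I"
    have "?pre i (\<Union>K) = (\<Union>S\<in>K. ?pre i S)" by auto
    then show "openin (X i) (?pre i (\<Union>K))" using K i by auto
  next
    fix K
    assume "\<forall>S\<in>K. S \<subseteq> ?W \<and> (\<forall>i\<in>I. openin (X i) (?pre i S))"
    then show "\<Union>K \<subseteq> ?W" by blast
  qed
  then show ?thesis by (simp add: wedge_def)
qed


section \<open>Geometric realization\<close>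

text \<open>
  Here \<open>face S n i\<close> is the face map $d_i$ from $n$-simplices to $(n-1)$-simplices
  ($0 \le i \le n$, $n \ge 1$) and \<open>degen S n j\<close> is the degeneracy $s_j$ from $n$-simplices to
  $(n+1)$-simplices ($0 \le j \le n$).
\<close>

record 'a simplicial_set =
  simplices :: "nat \<Rightarrow> 'a set"
  face :: "nat \<Rightarrow> nat \<Rightarrow> 'a \<Rightarrow> 'a"
  degen :: "nat \<Rightarrow> nat \<Rightarrow> 'a \<Rightarrow> 'a"

text \<open>
  The affine map collapsing the edge between vertices \<open>j\<close> and \<open>j + 1\<close>; the coface maps are
  the library's \<^const>\<open>simplical_face\<close>.
\<close>

definition simplex_collapse :: "nat \<Rightarrow> (nat \<Rightarrow> real) \<Rightarrow> nat \<Rightarrow> real" where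
  "simplex_collapse j t = (\<lambda>i. if i < j then t i else if i = j then t j + t (Suc j) else t (Suc i))"

inductive gluing ::
    "('a, 'b) simplicial_set_scheme \<Rightarrow> nat \<times> 'a \<times> (nat \<Rightarrow> real) \<Rightarrow> nat \<times> 'a \<times> (nat \<Rightarrow> real) \<Rightarrow> bool"
  for S where
  face: "\<lbrakk>x \<in> simplices S (Suc n); i \<le> Suc n; t \<in> standard_simplex n\<rbrakk> \<Longrightarrow>
    gluing S (n, face S (Suc n) i x, t) (Suc n, x, simplical_face i t)"
| degen: "\<lbrakk>x \<in> simplices S n; j \<le> n; t \<in> standard_simplex (Suc n)\<rbrakk> \<Longrightarrow>
    gluing S (Suc n, degen S n j x, t) (n, x, simplex_collapse j t)"

definition realization_class ::
    "('a, 'b) simplicial_set_scheme \<Rightarrow> nat \<times> 'a \<times> (nat \<Rightarrow> real) \<Rightarrow> (nat \<times> 'a \<times> (nat \<Rightarrow> real)) set" where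
  "realization_class S z = {w. equivclp (gluing S) z w}"

definition realization ::
    "('a, 'b) simplicial_set_scheme \<Rightarrow> (nat \<times> 'a \<times> (nat \<Rightarrow> real)) set topology" where
  "realization S =
     quotient_topology
       (sum_topology
          (\<lambda>n. prod_topology (discrete_topology (simplices S n))
                 (subtopology (powertop_real UNIV) (standard_simplex n))) UNIV)
       (realization_class S)"


section \<open>The spaces \<open>B(2,G)\<close> and \<open>BG\<close>\<close>

text \<open>An $n$-tuple $(g_1,\dots,g_n)$ is a list of length $n$, so $g_i$ is \<open>gs ! (i - 1)\<close>.\<close>

definition tuple_face :: "('a, 'b) monoid_scheme \<Rightarrow> nat \<Rightarrow> nat \<Rightarrow> 'a list \<Rightarrow> 'a list" where
  "tuple_face G n i gs =
     (if i = 0 then tl gs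
      else if i = n then butlast gs
      else take (i - 1) gs @ [gs ! (i - 1) \<otimes>\<^bsub>G\<^esub> gs ! i] @ drop (i + 1) gs)"

definition tuple_degen :: "('a, 'b) monoid_scheme \<Rightarrow> nat \<Rightarrow> nat \<Rightarrow> 'a list \<Rightarrow> 'a list" where
  "tuple_degen G n j gs = take j gs @ [\<one>\<^bsub>G\<^esub>] @ drop j gs"

definition commuting_tuples :: "('a, 'b) monoid_scheme \<Rightarrow> 'a list simplicial_set" where
  "commuting_tuples G =
     \<lparr>simplices = (\<lambda>n. {gs. length gs = n \<and> set gs \<subseteq> carrier G \<and>
                          (\<forall>g \<in> set gs. \<forall>h \<in> set gs. g \<otimes>\<^bsub>G\<^esub> h = h \<otimes>\<^bsub>G\<^esub> g)}),
      face = tuple_face G, degen = tuple_degen G\<rparr>"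

definition nerve :: "('a, 'b) monoid_scheme \<Rightarrow> 'a list simplicial_set" where
  "nerve G =
     \<lparr>simplices = (\<lambda>n. {gs. length gs = n \<and> set gs \<subseteq> carrier G}),
      face = tuple_face G, degen = tuple_degen G\<rparr>"

definition B2 :: "('a, 'b) monoid_scheme \<Rightarrow> (nat \<times> 'a list \<times> (nat \<Rightarrow> real)) set topology" where
  "B2 G = realization (commuting_tuples G)"

definition classifying_space ::
    "('a, 'b) monoid_scheme \<Rightarrow> (nat \<times> 'a list \<times> (nat \<Rightarrow> real)) set topology" where
  "classifying_space G = realization (nerve G)"

text \<open>The unique vertex of \<open>BG\<close>; the simplex $\Delta^0$ consists of the point $(1,0,0,\dots)$.\<close>

definition classifying_space_base ::
    "('a, 'b) monoid_scheme \<Rightarrow> (nat \<times> 'a list \<times> (nat \<Rightarrow> real)) set" where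
  "classifying_space_base G = realization_class (nerve G) (0, [], \<lambda>i. if i = 0 then 1 else 0)"

end

theory Submission
  imports
    Defs
    "HOL-Analysis.Urysohn"
    "HOL-Algebra.Multiplicative_Group"
    "HOL-Algebra.Group_Action"
    "HOL-Number_Theory.Cong"
begin

text \<open>
  Put a tuple \<open>(g\<^sub>1, \<dots>, g\<^sub>n)\<close> and a point of the
  \<open>n\<close>-simplex together by placing the label \<open>g\<^sub>i\<close> at the
  position \<open>t\<^sub>0 + \<dots> + t\<^bsub>i-1\<^esub>\<close> of the unit interval. A
  face map multiplies two labels that have arrived at the same position, or forgets a label that
  has arrived at \<open>0\<close> or \<open>1\<close>; a degeneracy inserts a label
  \<open>1\<close>. So the points of a realization are finitely supported functions from the
  open unit interval to the group
  (\<open>tuple_family.realization_homeomorphic_config_space\<close>): all of them for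
  \<open>BG\<close>, and those with commuting values for \<open>B(2,G)\<close>.

  In this model the theorem is visible on points. If \<open>G\<close> is transitively
  commutative with trivial center, the covering centralizers are abelian, two of them meet only
  in \<open>1\<close>, and a commuting tuple with an entry different from \<open>1\<close> lies
  in one of them (\<open>centerless_tc_group.minimal_cover_properties\<close>). A commuting
  configuration is therefore either empty or a configuration in exactly one centralizer, and
  this is the wedge. An abelian centralizer \<open>C\<close> is the direct product of its Sylow
  subgroups, so a configuration in \<open>C\<close> is a family of configurations, one in each
  Sylow subgroup. A Sylow subgroup of \<open>C\<close> is one of \<open>G\<close>: the Sylow
  subgroup of \<open>G\<close> around it has a nontrivial center, and transitivity of
  commutation through a central element pulls the whole group into \<open>C\<close>. Any other
  Sylow subgroup of \<open>G\<close> is conjugate to it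
  (\<open>centerless_tc_group.sylow_conjugate_into_centralizer\<close>).

  What remains is topology. For the wedge nothing happens, because both sides carry the final
  topology from the same simplices. For the product there is a gap between the product topology
  and the quotient topology on the realization of the product group, and the factors are not
  locally compact. It is closed by Milnor's argument for increasing unions of compact Hausdorff
  spaces (\<open>openin_product_if_coherent\<close>), applied to the configurations that can be
  written with \<open>n\<close> labels. To compare such configurations in the factors with
  configurations in the product one has to merge several sorted lists of positions. Over an
  abelian group this costs nothing if positions are not required to be sorted: the simplices can
  be replaced by cubes (\<open>comm_monoid.openin_config_space_iff_cubes\<close>).

  The homotopy equivalence that results is a homeomorphism.
\<close>

section \<open>Configurations of labelled points\<close>

definition list_prod :: "('a, 'b) monoid_scheme \<Rightarrow> 'a list \<Rightarrow> 'a" where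
  "list_prod G xs = foldr (\<otimes>\<^bsub>G\<^esub>) xs \<one>\<^bsub>G\<^esub>"

text \<open>
  A list of labels with positions as a function on the line. The value is \<open>1\<close>
  outside the open unit interval because the outer face maps forget the labels there; labels at
  a common position are multiplied in the order of the list.
\<close>

definition config :: "('a, 'b) monoid_scheme \<Rightarrow> ('a \<times> real) list \<Rightarrow> real \<Rightarrow> 'a" where
  "config G ps u =
     (if 0 < u \<and> u < 1 then list_prod G (map fst (filter (\<lambda>p. snd p = u) ps)) else \<one>\<^bsub>G\<^esub>)"

definition partial_sums :: "nat \<Rightarrow> (nat \<Rightarrow> real) \<Rightarrow> real list" where
  "partial_sums n t = map (\<lambda>i. sum t {..<Suc i}) [0..<n]"

definition simplex_config ::
    "('a, 'b) monoid_scheme \<Rightarrow> 'a list \<Rightarrow> (nat \<Rightarrow> real) \<Rightarrow> real \<Rightarrow> 'a" where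
  "simplex_config G gs t = config G (zip gs (partial_sums (length gs) t))"

context monoid
begin

lemma list_prod_closed [simp]: "set xs \<subseteq> carrier G \<Longrightarrow> list_prod G xs \<in> carrier G"
  by (induction xs) (auto simp: list_prod_def)

lemma list_prod_append:
  "\<lbrakk>set xs \<subseteq> carrier G; set ys \<subseteq> carrier G\<rbrakk>
    \<Longrightarrow> list_prod G (xs @ ys) = list_prod G xs \<otimes> list_prod G ys"
proof (induction xs)
  case Nil
  then show ?case using list_prod_closed[of ys] by (simp add: list_prod_def)
next
  case (Cons x xs)
  then have "list_prod G xs \<in> carrier G" "list_prod G ys \<in> carrier G" by auto
  with Cons show ?case by (simp add: list_prod_def m_assoc)
qed

lemma config_closed [simp]:
  assumes "fst ` set ps \<subseteq> carrier G"
  shows "config G ps u \<in> carrier G"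
proof -
  have "set (map fst (filter (\<lambda>p. snd p = u) ps)) \<subseteq> carrier G" using assms by auto
  then show ?thesis by (auto simp: config_def intro!: list_prod_closed)
qed

lemma config_append:
  assumes "fst ` set ps \<subseteq> carrier G" "fst ` set qs \<subseteq> carrier G"
  shows "config G (ps @ qs) u = config G ps u \<otimes> config G qs u"
proof -
  have "set (map fst (filter (\<lambda>p. snd p = u) ps)) \<subseteq> carrier G"
    "set (map fst (filter (\<lambda>p. snd p = u) qs)) \<subseteq> carrier G" using assms by auto
  then show ?thesis by (simp add: config_def list_prod_append)
qed

lemma config_single: "g \<in> carrier G \<Longrightarrow> config G [(g, x)] u = (if 0 < u \<and> u < 1 \<and> x = u then g else \<one>)"
  by (simp add: config_def list_prod_def)

lemma config_insert_trivial:
  assumes "fst ` set ps \<subseteq> carrier G" "fst ` set qs \<subseteq> carrier G" "g \<in> carrier G"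
    and "g = \<one> \<or> x \<le> 0 \<or> 1 \<le> x"
  shows "config G (ps @ [(g, x)] @ qs) = config G (ps @ qs)"
proof
  fix u
  show "config G (ps @ [(g, x)] @ qs) u = config G (ps @ qs) u"
    using assms config_append[of ps "[(g,x)] @ qs" u] config_append[of "[(g,x)]" qs u]
      config_append[of ps qs u] by (auto simp: config_single)
qed

lemma config_merge:
  assumes "fst ` set ps \<subseteq> carrier G" "fst ` set qs \<subseteq> carrier G" "g \<in> carrier G" "h \<in> carrier G"
  shows "config G (ps @ [(g, x), (h, x)] @ qs) = config G (ps @ [(g \<otimes> h, x)] @ qs)"
proof
  fix u
  have "config G [(g,x),(h,x)] u = config G [(g \<otimes> h, x)] u"
    using assms by (auto simp: config_def list_prod_def)
  then show "config G (ps @ [(g, x), (h, x)] @ qs) u = config G (ps @ [(g \<otimes> h, x)] @ qs) u"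
    using assms config_append[of ps "[(g,x),(h,x)] @ qs" u] config_append[of "[(g,x),(h,x)]" qs u]
      config_append[of ps "[(g \<otimes> h, x)] @ qs" u] config_append[of "[(g \<otimes> h, x)]" qs u]
    by auto
qed

end

lemma config_off_support:
  "u \<notin> snd ` set ps \<Longrightarrow> config G ps u = \<one>\<^bsub>G\<^esub>"
proof -
  assume "u \<notin> snd ` set ps"
  then have "filter (\<lambda>p. snd p = u) ps = []" by (auto simp: filter_empty_conv)
  then show ?thesis by (simp add: config_def list_prod_def)
qed

section \<open>Gluing preserves configurations\<close>

lemma length_partial_sums [simp]: "length (partial_sums n t) = n"
  by (simp add: partial_sums_def)

lemma nth_partial_sums [simp]: "i < n \<Longrightarrow> partial_sums n t ! i = sum t {..<Suc i}"
  by (simp add: partial_sums_def)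

text \<open>
  The coface map number \<open>i\<close> repeats the partial sum number \<open>i\<close>, so
  that two neighbouring labels, or a label and an end of the interval, come to the same
  position.
\<close>

lemma sum_simplical_face:
  "sum (simplical_face i t) {..<k} = sum t {..<(if k \<le> i then k else k - 1)}"
  for t :: "nat \<Rightarrow> real"
proof (induction k)
  case (Suc k)
  show ?case
  proof (cases "k \<le> i")
    case True
    with Suc show ?thesis by (cases "k = i") (auto simp: simplical_face_def)
  next
    case False
    then have "k = Suc (k - 1)" by simp
    then have "sum t {..<k} = sum t {..<k-1} + t (k-1)" by (metis sum.lessThan_Suc)
    with False Suc show ?thesis by (simp add: simplical_face_def)
  qed
qed simp

lemma sum_simplex_collapse:
  "sum (simplex_collapse j t) {..<k} = sum t {..<(if k \<le> j then k else Suc k)}"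
  by (induction k) (auto simp: simplex_collapse_def not_le less_Suc_eq algebra_simps)

lemma standard_simplex_alt:
  "t \<in> standard_simplex n \<longleftrightarrow> (\<forall>i. 0 \<le> t i) \<and> (\<forall>i>n. t i = 0) \<and> sum t {..<Suc n} = 1"
proof -
  have "t i \<le> 1" if "\<forall>i. 0 \<le> t i" "\<forall>i>n. t i = 0" "sum t {..<Suc n} = 1" for i
  proof (cases "i \<le> n")
    case True
    then have "t i \<le> sum t {..<Suc n}" using that by (intro member_le_sum) auto
    then show ?thesis using that by simp
  qed (use that in auto)
  then show ?thesis
    by (auto simp: standard_simplex_def simp flip: lessThan_Suc_atMost)
qed

lemma simplex_collapse_in_standard_simplex:
  assumes "t \<in> standard_simplex (Suc n)" "j \<le> n"
  shows "simplex_collapse j t \<in> standard_simplex n"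
proof -
  have "sum (simplex_collapse j t) {..<Suc n} = 1"
    using assms unfolding sum_simplex_collapse by (simp add: standard_simplex_alt)
  then show ?thesis using assms
    by (auto simp: standard_simplex_alt simplex_collapse_def)
qed

lemma vanishing_coordinate_imp_face:
  assumes "t \<in> standard_simplex (Suc n)" "i \<le> Suc n" "t i = 0"
  obtains t' where "t' \<in> standard_simplex n" "t = simplical_face i t'"
proof
  \<comment> \<open>A coordinate that vanishes is removed by merging it with a neighbour, with the following one
  or, for the last coordinate, with the preceding one.\<close>
  show "simplex_collapse (min i n) t \<in> standard_simplex n"
    using assms by (simp add: simplex_collapse_in_standard_simplex)
  have *: "t k = simplical_face i (simplex_collapse (min i n) t) k" for k
  proof (cases "i = Suc n")
    case True
    then show ?thesis
      using assms by (cases "k \<le> n")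
        (auto simp: simplical_face_def simplex_collapse_def min_def standard_simplex_alt not_le)
  next
    case False
    then show ?thesis using assms
      by (auto simp: simplical_face_def simplex_collapse_def min_def)
  qed
  then show "t = simplical_face i (simplex_collapse (min i n) t)" by blast
qed

context monoid
begin

text \<open>
  The coface map makes the labels that are to be multiplied, or to be dropped, coincide with
  each other or with an end of the interval.
\<close>

lemma simplex_config_face:
  assumes gs: "set gs \<subseteq> carrier G" "length gs = Suc n" and i: "i \<le> Suc n"
    and t: "t \<in> standard_simplex n"
  shows "simplex_config G gs (simplical_face i t) = simplex_config G (tuple_face G (Suc n) i gs) t"
proof -
  let ?d = "simplical_face i t"
  consider "i = 0" | "i = Suc n" | "0 < i" "i \<le> n" using i by linarith
  then show ?thesis
  proof cases
    case 1
    obtain g gs' where g: "gs = g # gs'" using gs by (cases gs) auto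
    have ps: "partial_sums (Suc n) ?d = 0 # partial_sums n t"
      by (rule nth_equalityI) (auto simp: 1 nth_Cons sum_simplical_face split: nat.split simp del: sum.lessThan_Suc)
    have "simplex_config G gs ?d = config G ([] @ [(g, 0)] @ zip gs' (partial_sums n t))"
      using g gs ps by (simp add: simplex_config_def)
    also have "\<dots> = config G ([] @ zip gs' (partial_sums n t))"
      by (rule config_insert_trivial) (use g gs in \<open>auto dest: set_zip_leftD\<close>)
    finally show ?thesis using g gs 1 by (simp add: simplex_config_def tuple_face_def)
  next
    case 2
    obtain g gs' where g: "gs = gs' @ [g]" using gs by (cases gs rule: rev_cases) auto
    have ps: "partial_sums (Suc n) ?d = partial_sums n t @ [1]"
      using t by (intro nth_equalityI)
        (auto simp: 2 nth_append sum_simplical_face standard_simplex_alt less_Suc_eq simp del: sum.lessThan_Suc)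
    have "simplex_config G gs ?d = config G (zip gs' (partial_sums n t) @ [(g, 1)] @ [])"
      using g gs ps by (simp add: simplex_config_def)
    also have "\<dots> = config G (zip gs' (partial_sums n t) @ [])"
      by (rule config_insert_trivial) (use g gs in \<open>auto dest: set_zip_leftD\<close>)
    finally show ?thesis using g gs 2 by (simp add: simplex_config_def tuple_face_def)
  next
    case 3
    obtain m where m: "i = Suc m" using 3 by (cases i) auto
    define xs ys where "xs = take m gs" and "ys = drop (Suc (Suc m)) gs"
    define x where "x = sum t {..<Suc m}"
    have len: "length xs = m" "length ys = n - Suc m" using gs 3 m by (auto simp: xs_def ys_def)
    have gseq: "gs = xs @ [gs ! m, gs ! Suc m] @ ys"
      using gs 3 m by (simp add: xs_def ys_def Cons_nth_drop_Suc)
    define as bs where "as = take m (partial_sums n t)" and "bs = drop (Suc m) (partial_sums n t)"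
    have lenab: "length as = m" "length bs = n - Suc m" using 3 m by (auto simp: as_def bs_def)
    have p1: "partial_sums n t = as @ [x] @ bs"
    proof -
      have "partial_sums n t = as @ [partial_sums n t ! m] @ bs"
        using 3 m id_take_nth_drop[of m "partial_sums n t"] by (simp add: as_def bs_def del: nth_partial_sums)
      then show ?thesis using 3 m nth_partial_sums[of m n t] by (simp add: x_def)
    qed
    have p2: "partial_sums (Suc n) ?d = as @ [x, x] @ bs"
    proof (rule nth_equalityI)
      show "length (partial_sums (Suc n) ?d) = length (as @ [x, x] @ bs)" using lenab 3 m by simp
      fix k assume "k < length (partial_sums (Suc n) ?d)"
      then have k: "k < Suc n" by simp
      consider "k < m" | "k = m" | "k = Suc m" | l where "k = Suc (Suc m) + l"
        by (metis add.commute le_Suc_ex not_less_eq less_antisym linorder_not_less)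
      then show "partial_sums (Suc n) ?d ! k = (as @ [x, x] @ bs) ! k"
      proof cases
        case 4
        then have "bs ! l = sum t {..<Suc (Suc m + l)}" using k by (simp add: bs_def)
        then show ?thesis using 4 k lenab by (simp add: nth_append m sum_simplical_face del: sum.lessThan_Suc)
      qed (use k lenab m 3 in \<open>auto simp: nth_append as_def x_def sum_simplical_face simp del: sum.lessThan_Suc\<close>)
    qed
    have c: "set xs \<subseteq> carrier G" "set ys \<subseteq> carrier G" "gs ! m \<in> carrier G" "gs ! Suc m \<in> carrier G"
      using gs 3 m by (auto simp: xs_def ys_def dest: in_set_takeD in_set_dropD)
    have "simplex_config G gs ?d = config G (zip gs (as @ [x, x] @ bs))"
      using gs p2 by (simp add: simplex_config_def)
    also have "zip gs (as @ [x, x] @ bs) = zip xs as @ [(gs ! m, x), (gs ! Suc m, x)] @ zip ys bs"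
      using len lenab by (subst gseq) simp
    also have "config G (zip xs as @ [(gs ! m, x), (gs ! Suc m, x)] @ zip ys bs)
        = config G (zip xs as @ [(gs ! m \<otimes> gs ! Suc m, x)] @ zip ys bs)"
      by (rule config_merge) (use c in \<open>auto dest: set_zip_leftD\<close>)
    also have "\<dots> = simplex_config G (xs @ [gs ! m \<otimes> gs ! Suc m] @ ys) t"
    proof -
      have "length (xs @ [gs ! m \<otimes> gs ! Suc m] @ ys) = n" using len 3 m by simp
      then show ?thesis using p1 len lenab by (simp add: simplex_config_def)
    qed
    also have "xs @ [gs ! m \<otimes> gs ! Suc m] @ ys = tuple_face G (Suc n) i gs"
      using 3 m by (simp add: tuple_face_def xs_def ys_def)
    finally show ?thesis .
  qed
qed

text \<open>
  Collapsing an edge removes one position from the list, and the degeneracy puts a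
  \<open>1\<close> there.
\<close>

lemma simplex_config_degen:
  assumes gs: "set gs \<subseteq> carrier G" and j: "j \<le> length gs"
  shows "simplex_config G (tuple_degen G j' j gs) t = simplex_config G gs (simplex_collapse j t)"
proof -
  define n where "n = length gs"
  define xs ys where "xs = take j gs" and "ys = drop j gs"
  define x where "x = sum t {..<Suc j}"
  have len: "length xs = j" "length ys = n - j" using j by (auto simp: xs_def ys_def n_def)
  define as bs where "as = take j (partial_sums n (simplex_collapse j t))"
    and "bs = drop j (partial_sums n (simplex_collapse j t))"
  have lenab: "length as = j" "length bs = n - j" using j by (auto simp: as_def bs_def n_def)
  have p1: "partial_sums n (simplex_collapse j t) = as @ bs" by (simp add: as_def bs_def)
  have p2: "partial_sums (Suc n) t = as @ [x] @ bs"
  proof (rule nth_equalityI)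
    show "length (partial_sums (Suc n) t) = length (as @ [x] @ bs)" using lenab j n_def by simp
    fix k assume "k < length (partial_sums (Suc n) t)"
    then have k: "k < Suc n" by simp
    consider "k < j" | "k = j" | l where "k = Suc j + l"
      by (metis add.commute le_Suc_ex less_antisym linorder_not_less)
    then show "partial_sums (Suc n) t ! k = (as @ [x] @ bs) ! k"
    proof cases
      case 3
      then have "bs ! l = sum t {..<Suc (Suc (j + l))}"
        using k by (simp add: bs_def sum_simplex_collapse del: sum.lessThan_Suc)
      then show ?thesis using 3 k lenab by (simp add: nth_append del: sum.lessThan_Suc)
    qed (use k lenab j n_def in \<open>auto simp: nth_append as_def x_def sum_simplex_collapse simp del: sum.lessThan_Suc\<close>)
  qed
  have c: "set xs \<subseteq> carrier G" "set ys \<subseteq> carrier G"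
    using gs by (auto simp: xs_def ys_def dest: in_set_takeD in_set_dropD)
  have "length (tuple_degen G j' j gs) = Suc n" using j by (simp add: tuple_degen_def n_def)
  then have "simplex_config G (tuple_degen G j' j gs) t = config G (zip xs as @ [(\<one>, x)] @ zip ys bs)"
    using len lenab p2 by (simp add: simplex_config_def tuple_degen_def flip: xs_def ys_def)
  also have "\<dots> = config G (zip xs as @ zip ys bs)"
    by (rule config_insert_trivial) (use c in \<open>auto dest: set_zip_leftD\<close>)
  also have "\<dots> = config G (zip (xs @ ys) (as @ bs))" using len lenab by simp
  also have "\<dots> = simplex_config G gs (simplex_collapse j t)"
    by (simp add: simplex_config_def xs_def ys_def flip: n_def p1)
  finally show ?thesis .
qed

end

section \<open>Reduced representatives\<close>

definition tuple_complex :: "('a, 'b) monoid_scheme \<Rightarrow> 'a list set \<Rightarrow> 'a list simplicial_set" where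
  "tuple_complex G T =
     \<lparr>simplices = (\<lambda>n. {gs \<in> T. length gs = n}), face = tuple_face G, degen = tuple_degen G\<rparr>"

text \<open>
  The closure properties that allow every point of the realization to be moved to a simplex
  without degeneracies and to an interior point of it.
\<close>

locale tuple_family = monoid G for G (structure) +
  fixes T :: "'a list set"
  assumes labels: "gs \<in> T \<Longrightarrow> set gs \<subseteq> carrier G"
    and faces: "\<lbrakk>gs \<in> T; length gs = Suc n; i \<le> Suc n\<rbrakk> \<Longrightarrow> tuple_face G (Suc n) i gs \<in> T"
    and drop_one: "xs @ [\<one>] @ ys \<in> T \<Longrightarrow> xs @ ys \<in> T"

lemma filter_zip_nth:
  assumes "distinct xs" "length gs = length xs" "i < length xs"
  shows "filter (\<lambda>p. snd p = xs ! i) (zip gs xs) = [(gs ! i, xs ! i)]"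
  using assms(2,1,3)
proof (induction gs xs arbitrary: i rule: list_induct2)
  case (Cons g gs x xs)
  show ?case
  proof (cases i)
    case 0
    have "filter (\<lambda>p. snd p = x) (zip gs xs) = []"
      using Cons.prems(1) by (auto simp: filter_empty_conv dest: set_zip_rightD)
    then show ?thesis using 0 by simp
  next
    case (Suc j)
    then have "x \<noteq> xs ! j" using Cons.prems by auto
    then show ?thesis using Suc Cons by auto
  qed
qed simp

text \<open>
  Interior points of nondegenerate simplices. For them the positions are distinct and the labels
  are the values of the configuration.
\<close>

definition reduced :: "('a, 'b) monoid_scheme \<Rightarrow> 'a list \<Rightarrow> (nat \<Rightarrow> real) \<Rightarrow> bool" where
  "reduced G gs t \<longleftrightarrow> t \<in> standard_simplex (length gs) \<and> (\<forall>i\<le>length gs. t i \<noteq> 0) \<and> \<one>\<^bsub>G\<^esub> \<notin> set gs"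

lemma partial_sums_reduced:
  assumes "reduced G gs t"
  shows "sorted_wrt (<) (partial_sums (length gs) t)"
    "set (partial_sums (length gs) t) \<subseteq> {0<..<1}"
proof -
  let ?n = "length gs"
  have t: "t \<in> standard_simplex ?n" and pos: "\<And>i. i \<le> ?n \<Longrightarrow> 0 < t i"
    using assms by (auto simp: reduced_def standard_simplex_alt less_le)
  have less: "sum t {..<i} < sum t {..<j}" if "i < j" "j \<le> Suc ?n" for i j
    by (rule sum_strict_mono2) (use that t pos in \<open>auto simp: standard_simplex_alt\<close>)
  show "sorted_wrt (<) (partial_sums ?n t)"
    by (auto simp: sorted_wrt_iff_nth_less less simp del: sum.lessThan_Suc)
  have "0 < sum t {..<Suc i}" "sum t {..<Suc i} < 1" if "i < ?n" for i
    using less[of 0 "Suc i"] less[of "Suc i" "Suc ?n"] that t by (auto simp: standard_simplex_alt)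
  then show "set (partial_sums ?n t) \<subseteq> {0<..<1}"
    by (auto simp: partial_sums_def simp del: sum.lessThan_Suc)
qed

context monoid
begin

lemma reduced_config_nth:
  assumes "reduced G gs t" "set gs \<subseteq> carrier G" "i < length gs"
  shows "simplex_config G gs t (partial_sums (length gs) t ! i) = gs ! i"
proof -
  let ?xs = "partial_sums (length gs) t"
  have "distinct ?xs" using partial_sums_reduced(1)[OF assms(1)] strict_sorted_iff by blast
  then have "filter (\<lambda>p. snd p = ?xs ! i) (zip gs ?xs) = [(gs ! i, ?xs ! i)]"
    using assms by (intro filter_zip_nth) auto
  moreover have "?xs ! i \<in> {0<..<1}"
    using partial_sums_reduced(2)[OF assms(1)] assms(3) nth_mem[of i ?xs] by (simp only: length_partial_sums subset_iff)
  moreover have "gs ! i \<in> carrier G" using assms by auto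
  ultimately show ?thesis by (simp add: simplex_config_def config_def list_prod_def del: nth_partial_sums)
qed

lemma reduced_support:
  assumes "reduced G gs t" "set gs \<subseteq> carrier G"
  shows "{u. simplex_config G gs t u \<noteq> \<one>} = set (partial_sums (length gs) t)"
proof (intro equalityI subsetI)
  fix u assume "u \<in> {u. simplex_config G gs t u \<noteq> \<one>}"
  then have "u \<in> snd ` set (zip gs (partial_sums (length gs) t))"
    using config_off_support unfolding simplex_config_def by fastforce
  then show "u \<in> set (partial_sums (length gs) t)" by (auto dest: set_zip_rightD)
next
  fix u assume "u \<in> set (partial_sums (length gs) t)"
  then obtain i where i: "i < length gs" "u = partial_sums (length gs) t ! i"
    by (metis in_set_conv_nth length_partial_sums)
  then have "simplex_config G gs t u = gs ! i" using reduced_config_nth[OF assms] by simp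
  moreover have "gs ! i \<noteq> \<one>" using assms(1) i(1) nth_mem unfolding reduced_def by metis
  ultimately show "u \<in> {u. simplex_config G gs t u \<noteq> \<one>}" by simp
qed

text \<open>
  The support of the configuration, in increasing order, is the list of positions, and the
  differences of the positions are the coordinates.
\<close>

lemma reduced_unique:
  assumes r: "reduced G gs t" "set gs \<subseteq> carrier G" and r': "reduced G gs' t'" "set gs' \<subseteq> carrier G"
    and eq: "simplex_config G gs t = simplex_config G gs' t'"
  shows "gs = gs' \<and> t = t'"
proof -
  let ?ps = "partial_sums (length gs) t" and ?ps' = "partial_sums (length gs') t'"
  have set_eq: "set ?ps = set ?ps'" using reduced_support[OF r] reduced_support[OF r'] eq by simp
  have ps: "?ps = ?ps'"
    using partial_sums_reduced(1)[OF r(1)] partial_sums_reduced(1)[OF r'(1)] set_eq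
    by (simp add: strict_sorted_equal)
  then have len: "length gs = length gs'" by (metis length_partial_sums)
  have "gs ! i = gs' ! i" if "i < length gs" for i
    using reduced_config_nth[OF r, of i] reduced_config_nth[OF r', of i] that len ps eq by metis
  then have "gs = gs'" using len by (simp add: nth_equalityI)
  have t: "t \<in> standard_simplex (length gs)" "t' \<in> standard_simplex (length gs)"
    using r(1) r'(1) len by (auto simp: reduced_def)
  have s: "sum t {..<i} = sum t' {..<i}" if "i \<le> Suc (length gs)" for i
  proof (cases i)
    case (Suc j)
    show ?thesis
    proof (cases "j = length gs")
      case True
      then show ?thesis using t Suc by (simp add: standard_simplex_alt)
    next
      case False
      then have "j < length gs" using Suc that by simp
      then show ?thesis using Suc ps len nth_partial_sums by metis
    qed
  qed simp
  have "t i = t' i" for i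
  proof (cases "i \<le> length gs")
    case True
    then show ?thesis using s[of i] s[of "Suc i"] by simp
  qed (use t in \<open>auto simp: standard_simplex_alt\<close>)
  then show ?thesis using \<open>gs = gs'\<close> by blast
qed

end

context tuple_family
begin

abbreviation "glued \<equiv> equivclp (gluing (tuple_complex G T))"

lemma gluing_simplex_config:
  assumes "gluing (tuple_complex G T) z w"
  shows "(\<lambda>(n, gs, t). simplex_config G gs t) z = (\<lambda>(n, gs, t). simplex_config G gs t) w"
  using assms
proof (cases rule: gluing.cases)
  case (face x n i t)
  then show ?thesis using simplex_config_face[of x n i t] labels
    by (simp add: tuple_complex_def)
next
  case (degen x n j t)
  then show ?thesis using simplex_config_degen[of x j n t] labels
    by (simp add: tuple_complex_def)
qed

lemma equivclp_simplex_config: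
  assumes "glued z w"
  shows "(\<lambda>(n, gs, t). simplex_config G gs t) z = (\<lambda>(n, gs, t). simplex_config G gs t) w"
  using assms
proof (induction rule: equivclp_induct)
  case (step y z)
  then show ?case using gluing_simplex_config by metis
qed simp

text \<open>
  As long as a coordinate vanishes or a label is \<open>1\<close>, a face or a degeneracy gives
  a representative with fewer labels.
\<close>

lemma reduce:
  assumes "gs \<in> T" "t \<in> standard_simplex (length gs)"
  obtains gs' t' where "gs' \<in> T" "reduced G gs' t'"
    "glued (length gs, gs, t) (length gs', gs', t')"
  using assms
proof (induction "length gs" arbitrary: gs t thesis)
  case 0
  then have "gs = []" by simp
  moreover have "reduced G [] t" using 0 by (auto simp: reduced_def standard_simplex_0)
  ultimately show ?case using 0(2)[of "[]" t] 0(3) by simp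
next
  case (Suc n)
  show ?case
  proof (cases "reduced G gs t")
    case True
    then show ?thesis using Suc.prems(1)[of gs t] Suc.prems(2) by simp
  next
    case False
    have "\<exists>gs1 t1. length gs1 = n \<and> gs1 \<in> T \<and> t1 \<in> standard_simplex n \<and>
            glued (length gs, gs, t) (n, gs1, t1)"
    proof (cases "\<exists>i\<le>Suc n. t i = 0")
      case True
      then obtain i where i: "i \<le> Suc n" "t i = 0" by blast
      obtain t' where t': "t' \<in> standard_simplex n" "t = simplical_face i t'"
        using vanishing_coordinate_imp_face[of t n i] Suc.prems Suc.hyps(2) i by metis
      have gs: "gs \<in> simplices (tuple_complex G T) (Suc n)"
        using Suc.prems Suc.hyps(2) by (simp add: tuple_complex_def)
      have "gluing (tuple_complex G T) (n, face (tuple_complex G T) (Suc n) i gs, t') (Suc n, gs, simplical_face i t')"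
        by (rule gluing.face[OF gs i(1) t'(1)])
      then have "glued (length gs, gs, t) (n, tuple_face G (Suc n) i gs, t')"
        using Suc.hyps(2) t'(2) by (simp add: tuple_complex_def r_into_equivclp equivclp_sym)
      moreover have "length (tuple_face G (Suc n) i gs) = n"
        using Suc.hyps(2) i by (auto simp: tuple_face_def)
      moreover have "tuple_face G (Suc n) i gs \<in> T" by (intro faces) (use Suc.prems Suc.hyps(2) i in auto)
      ultimately show ?thesis using t' by blast
    next
      case no0: False
      then have "\<one> \<in> set gs" using False Suc.prems Suc.hyps(2) by (auto simp: reduced_def)
      then obtain xs ys where xy: "gs = xs @ [\<one>] @ ys" by (metis append_Cons append_Nil split_list)
      define gs1 where "gs1 = xs @ ys"
      have gs1: "gs1 \<in> T" "length gs1 = n" using Suc.prems Suc.hyps(2) xy drop_one by (auto simp: gs1_def)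
      then have gs1s: "gs1 \<in> simplices (tuple_complex G T) n" by (simp add: tuple_complex_def)
      have le: "length xs \<le> n" using gs1 by (simp add: gs1_def)
      have tS: "t \<in> standard_simplex (Suc n)" using Suc.prems Suc.hyps(2) by simp
      have "gluing (tuple_complex G T) (Suc n, degen (tuple_complex G T) n (length xs) gs1, t)
          (n, gs1, simplex_collapse (length xs) t)"
        by (rule gluing.degen[OF gs1s le tS])
      moreover have "degen (tuple_complex G T) n (length xs) gs1 = gs"
        by (simp add: tuple_complex_def tuple_degen_def gs1_def xy)
      ultimately have "glued (length gs, gs, t) (n, gs1, simplex_collapse (length xs) t)"
        using Suc.hyps(2) by (simp add: r_into_equivclp)
      then show ?thesis using gs1 le tS simplex_collapse_in_standard_simplex by blast
    qed
    then obtain gs1 t1 where 1: "length gs1 = n" "gs1 \<in> T" "t1 \<in> standard_simplex n"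
        "glued (length gs, gs, t) (n, gs1, t1)" by blast
    show ?thesis
    proof (rule Suc.hyps(1))
      show "n = length gs1" "gs1 \<in> T" "t1 \<in> standard_simplex (length gs1)" using 1 by simp_all
    next
      fix gs' t'
      assume "gs' \<in> T" "reduced G gs' t'"
        "glued (length gs1, gs1, t1) (length gs', gs', t')"
      with 1 show thesis by (intro Suc.prems(1) equivclp_trans[OF 1(4)]) simp_all
    qed
  qed
qed

lemma simplex_config_eq_iff:
  assumes "gs \<in> T" "t \<in> standard_simplex (length gs)" "gs' \<in> T" "t' \<in> standard_simplex (length gs')"
  shows "simplex_config G gs t = simplex_config G gs' t' \<longleftrightarrow>
    realization_class (tuple_complex G T) (length gs, gs, t) = realization_class (tuple_complex G T) (length gs', gs', t')"
    (is "?L \<longleftrightarrow> ?R")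
proof
  assume ?L
  obtain hs s where h: "hs \<in> T" "reduced G hs s" "glued (length gs, gs, t) (length hs, hs, s)"
    using reduce[OF assms(1,2)] by blast
  obtain hs' s' where h': "hs' \<in> T" "reduced G hs' s'" "glued (length gs', gs', t') (length hs', hs', s')"
    using reduce[OF assms(3,4)] by blast
  have "simplex_config G hs s = simplex_config G hs' s'"
    using \<open>?L\<close> equivclp_simplex_config[OF h(3)] equivclp_simplex_config[OF h'(3)] by simp
  then have "hs = hs' \<and> s = s'" by (intro reduced_unique h h' labels)
  then have "glued (length gs, gs, t) (length gs', gs', t')"
    using equivclp_trans[OF h(3)] equivclp_sym[OF h'(3)] by simp
  then show ?R unfolding realization_class_def
    by (auto intro: equivclp_trans equivclp_sym)
next
  assume ?R
  then have "glued (length gs, gs, t) (length gs', gs', t')"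
    unfolding realization_class_def by (metis equivclp_refl mem_Collect_eq equivclp_sym)
  then show ?L using equivclp_simplex_config by fastforce
qed

end

section \<open>The realization as a space of configurations\<close>

text \<open>
  The space of which the realization is the quotient by the gluing.
\<close>

definition simplex_sum :: "('a, 'b) simplicial_set_scheme \<Rightarrow> (nat \<times> 'a \<times> (nat \<Rightarrow> real)) topology" where
  "simplex_sum S = sum_topology
     (\<lambda>n. prod_topology (discrete_topology (simplices S n))
            (subtopology (powertop_real UNIV) (standard_simplex n))) UNIV"

definition config_space :: "('a, 'b) monoid_scheme \<Rightarrow> 'a list set \<Rightarrow> (real \<Rightarrow> 'a) topology" where
  "config_space G T = quotient_topology (simplex_sum (tuple_complex G T)) (\<lambda>(n, gs, t). simplex_config G gs t)"

abbreviation configs :: "('a, 'b) monoid_scheme \<Rightarrow> (real \<Rightarrow> 'a) topology" where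
  "configs G \<equiv> config_space G (lists (carrier G))"

lemma topspace_quotient_topology: "topspace (quotient_topology X f) = f ` topspace X"
proof
  show "topspace (quotient_topology X f) \<subseteq> f ` topspace X"
    using openin_quotient_topology[of X f "topspace (quotient_topology X f)"] by simp
  have "{x \<in> topspace X. f x \<in> f ` topspace X} = topspace X" by auto
  then have "openin (quotient_topology X f) (f ` topspace X)"
    by (simp add: openin_quotient_topology)
  then show "f ` topspace X \<subseteq> topspace (quotient_topology X f)" by (rule openin_subset)
qed

lemma quotient_map_quotient_topology: "quotient_map X (quotient_topology X f) f"
  by (auto simp: quotient_map_def topspace_quotient_topology openin_quotient_topology)

text \<open>
  A quotient is determined by the fibres of the quotient map.
\<close>

lemma homeomorphic_quotient_topologies:
  assumes "\<And>x y. x \<in> topspace X \<Longrightarrow> y \<in> topspace X \<Longrightarrow> f x = f y \<longleftrightarrow> g x = g y"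
  obtains h where "homeomorphic_map (quotient_topology X f) (quotient_topology X g) h"
    "\<And>x. x \<in> topspace X \<Longrightarrow> h (f x) = g x"
proof -
  define h where "h c = g (SOME x. x \<in> topspace X \<and> f x = c)" for c
  have h: "h (f x) = g x" if "x \<in> topspace X" for x
  proof -
    have "(SOME y. y \<in> topspace X \<and> f y = f x) \<in> topspace X \<and> f (SOME y. y \<in> topspace X \<and> f y = f x) = f x"
      using that by (intro someI[where P = "\<lambda>y. y \<in> topspace X \<and> f y = f x"]) simp
    then show ?thesis unfolding h_def using assms that by metis
  qed
  have "quotient_map X (quotient_topology X g) (h \<circ> f)"
    by (rule quotient_map_eq[OF quotient_map_quotient_topology]) (simp add: h)
  then have "quotient_map (quotient_topology X f) (quotient_topology X g) h"
    using quotient_map_compose_eq[OF quotient_map_quotient_topology[of X f]] by metis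
  moreover have "inj_on h (topspace (quotient_topology X f))"
    using assms by (auto simp: inj_on_def topspace_quotient_topology h)
  ultimately have "homeomorphic_map (quotient_topology X f) (quotient_topology X g) h"
    by (simp add: homeomorphic_map_def)
  then show thesis using h by (rule that)
qed

lemma openin_prod_discrete:
  "openin (prod_topology (discrete_topology A) Y) V \<longleftrightarrow>
    V \<subseteq> A \<times> topspace Y \<and> (\<forall>a\<in>A. openin Y {y. (a, y) \<in> V})" (is "?L \<longleftrightarrow> ?R")
proof
  assume L: ?L
  have "openin Y {y. (a, y) \<in> V}" if "a \<in> A" for a
  proof -
    have "continuous_map Y (prod_topology (discrete_topology A) Y) (\<lambda>y. (a, y))"
      using that by (intro continuous_map_pairedI) auto
    from openin_continuous_map_preimage[OF this L] have "openin Y {y \<in> topspace Y. (a, y) \<in> V}" .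
    moreover have "{y \<in> topspace Y. (a, y) \<in> V} = {y. (a, y) \<in> V}"
      using openin_subset[OF L] by auto
    ultimately show ?thesis by simp
  qed
  then show ?R using openin_subset[OF L] by auto
next
  assume R: ?R
  show ?L unfolding openin_prod_topology_alt
  proof (intro allI impI)
    fix x y assume "(x, y) \<in> V"
    then show "\<exists>U W. openin (discrete_topology A) U \<and> openin Y W \<and> x \<in> U \<and> y \<in> W \<and> U \<times> W \<subseteq> V"
      using R by (intro exI[of _ "{x}"] exI[of _ "{y. (x, y) \<in> V}"]) auto
  qed
qed

lemma topspace_simplex_sum:
  "topspace (simplex_sum (tuple_complex G T)) = {(length gs, gs, t) |gs t. gs \<in> T \<and> t \<in> standard_simplex (length gs)}"
  by (auto simp: simplex_sum_def tuple_complex_def)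

lemma topspace_config_space:
  "topspace (config_space G T) = {simplex_config G gs t |gs t. gs \<in> T \<and> t \<in> standard_simplex (length gs)}"
  unfolding config_space_def topspace_quotient_topology topspace_simplex_sum by force

lemma openin_config_space:
  "openin (config_space G T) U \<longleftrightarrow> U \<subseteq> topspace (config_space G T) \<and>
     (\<forall>gs\<in>T. openin (subtopology (powertop_real UNIV) (standard_simplex (length gs)))
        {t \<in> standard_simplex (length gs). simplex_config G gs t \<in> U})"
proof -
  let ?V = "{z \<in> topspace (simplex_sum (tuple_complex G T)). (\<lambda>(n, gs, t). simplex_config G gs t) z \<in> U}"
  have 1: "{t. (gs, t) \<in> {x. (n, x) \<in> ?V}} = {t \<in> standard_simplex n. simplex_config G gs t \<in> U}"
    if "gs \<in> simplices (tuple_complex G T) n" for gs n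
  proof -
    have "gs \<in> T" "length gs = n" using that by (auto simp: tuple_complex_def)
    then show ?thesis by (auto simp: topspace_simplex_sum)
  qed
  have "openin (simplex_sum (tuple_complex G T)) ?V \<longleftrightarrow>
     (\<forall>n. \<forall>gs\<in>simplices (tuple_complex G T) n.
       openin (subtopology (powertop_real UNIV) (standard_simplex n)) {t. (gs, t) \<in> {x. (n, x) \<in> ?V}})"
    unfolding simplex_sum_def openin_sum_topology openin_prod_discrete by auto
  also have "\<dots> \<longleftrightarrow> (\<forall>n. \<forall>gs\<in>simplices (tuple_complex G T) n.
       openin (subtopology (powertop_real UNIV) (standard_simplex n)) {t \<in> standard_simplex n. simplex_config G gs t \<in> U})"
    by (simp only: 1 cong: ball_cong)
  also have "\<dots> \<longleftrightarrow> (\<forall>gs\<in>T. openin (subtopology (powertop_real UNIV) (standard_simplex (length gs)))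
        {t \<in> standard_simplex (length gs). simplex_config G gs t \<in> U})"
    by (auto simp: tuple_complex_def)
  finally show ?thesis
    unfolding config_space_def openin_quotient_topology topspace_quotient_topology by simp
qed

text \<open>
  Two points are glued if and only if they have the same configuration: gluing does not change
  it, and a reduced representative can be read off from it.
\<close>

theorem (in tuple_family) realization_homeomorphic_config_space:
  obtains h where "homeomorphic_map (realization (tuple_complex G T)) (config_space G T) h"
    "\<And>gs t. gs \<in> T \<Longrightarrow> t \<in> standard_simplex (length gs) \<Longrightarrow>
       h (realization_class (tuple_complex G T) (length gs, gs, t)) = simplex_config G gs t"
proof -
  let ?X = "simplex_sum (tuple_complex G T)"
  have *: "realization_class (tuple_complex G T) z = realization_class (tuple_complex G T) w \<longleftrightarrow>
      (\<lambda>(n, gs, t). simplex_config G gs t) z = (\<lambda>(n, gs, t). simplex_config G gs t) w"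
    if "z \<in> topspace ?X" "w \<in> topspace ?X" for z w
    using that simplex_config_eq_iff unfolding topspace_simplex_sum by auto
  show thesis
  proof (rule homeomorphic_quotient_topologies[where X = ?X, OF *], assumption, assumption)
    fix h
    assume h: "homeomorphic_map (quotient_topology ?X (realization_class (tuple_complex G T)))
        (quotient_topology ?X (\<lambda>(n, gs, t). simplex_config G gs t)) h"
      "\<And>z. z \<in> topspace ?X \<Longrightarrow>
        h (realization_class (tuple_complex G T) z) = (\<lambda>(n, gs, t). simplex_config G gs t) z"
    have "h (realization_class (tuple_complex G T) (length gs, gs, t)) = simplex_config G gs t"
      if "gs \<in> T" "t \<in> standard_simplex (length gs)" for gs t
      using h(2)[of "(length gs, gs, t)"] that by (auto simp: topspace_simplex_sum)
    then show thesis using that h(1) by (simp add: realization_def config_space_def simplex_sum_def)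
  qed
qed

section \<open>Unordered positions: labelled cubes\<close>

definition cube :: "(nat \<Rightarrow> real) set" where
  "cube = {s. \<forall>i. 0 \<le> s i \<and> s i \<le> 1}"

text \<open>
  Positions in arbitrary order. They are given by an infinite sequence of which only the first
  entries are used, so that one compact space \<open>cube\<close> serves for all numbers of
  labels.
\<close>

definition cube_config :: "('a, 'b) monoid_scheme \<Rightarrow> 'a list \<Rightarrow> (nat \<Rightarrow> real) \<Rightarrow> real \<Rightarrow> 'a" where
  "cube_config G gs s = config G (zip gs (map s [0..<length gs]))"

definition window_prod :: "('a, 'b) monoid_scheme \<Rightarrow> real \<Rightarrow> real \<Rightarrow> ('a \<times> real) list \<Rightarrow> 'a" where
  "window_prod G a b ps = list_prod G (map fst (filter (\<lambda>p. a < snd p \<and> snd p < b) ps))"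

text \<open>
  The inverse of taking partial sums: the coordinates of the point of the simplex with given
  positions.
\<close>

definition gaps :: "real list \<Rightarrow> nat \<Rightarrow> real" where
  "gaps xs i = (if i < length xs then xs ! i else if i = length xs then 1 else 0) -
     (if i = 0 then 0 else if i \<le> length xs then xs ! (i - 1) else 0)"

definition finite_configs :: "('a, 'b) monoid_scheme \<Rightarrow> (real \<Rightarrow> 'a) set" where
  "finite_configs G = {f. range f \<subseteq> carrier G \<and> finite {u. f u \<noteq> \<one>\<^bsub>G\<^esub>} \<and> {u. f u \<noteq> \<one>\<^bsub>G\<^esub>} \<subseteq> {0<..<1}}"

lemma sum_gaps: "k \<le> length xs \<Longrightarrow> sum (gaps xs) {..<k} = (if k = 0 then 0 else xs ! (k - 1))"
  by (induction k) (auto simp: gaps_def)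

lemma gaps_in_standard_simplex:
  assumes "sorted xs" "set xs \<subseteq> {0..1}"
  shows "gaps xs \<in> standard_simplex (length xs)"
proof -
  have "0 \<le> gaps xs i" for i
  proof -
    have 1: "0 \<le> xs ! j \<and> xs ! j \<le> 1" if "j < length xs" for j
      using subsetD[OF assms(2) nth_mem[OF that]] by simp
    have 2: "xs ! (i - 1) \<le> xs ! i" if "i < length xs" using assms(1) that by (simp add: sorted_nth_mono)
    show ?thesis using 1[of i] 1[of "i - 1"] 2 by (auto simp: gaps_def)
  qed
  moreover have "sum (gaps xs) {..<Suc (length xs)} = 1"
    using sum_gaps[of "length xs" xs] by (simp add: gaps_def)
  ultimately show ?thesis by (auto simp: standard_simplex_alt gaps_def)
qed

lemma partial_sums_gaps [simp]: "partial_sums (length xs) (gaps xs) = xs"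
  by (rule nth_equalityI) (simp_all add: sum_gaps del: sum.lessThan_Suc)

lemma simplex_config_gaps:
  "length gs = length xs \<Longrightarrow> simplex_config G gs (gaps xs) = config G (zip gs xs)"
  by (simp add: simplex_config_def)

lemma simplex_config_eq_cube_config:
  "simplex_config G gs t = cube_config G gs (\<lambda>i. sum t {..<Suc i})"
  by (simp add: simplex_config_def cube_config_def partial_sums_def)

text \<open>
  Listing the support in increasing order gives a representative.
\<close>

lemma (in monoid) topspace_config_space_lists:
  "topspace (configs G) = finite_configs G"
proof (intro equalityI subsetI)
  fix f assume "f \<in> topspace (configs G)"
  then obtain gs t where f: "f = simplex_config G gs t" "set gs \<subseteq> carrier G"
    by (auto simp: topspace_config_space)
  let ?ps = "zip gs (partial_sums (length gs) t)"
  have ps: "fst ` set ?ps \<subseteq> carrier G" using f(2) by (auto dest: set_zip_leftD)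
  have "{u. f u \<noteq> \<one>} \<subseteq> snd ` set ?ps" using config_off_support unfolding f(1) simplex_config_def by fastforce
  then have "finite {u. f u \<noteq> \<one>}" by (rule finite_subset) simp
  moreover have "range f \<subseteq> carrier G" using ps by (auto simp: f(1) simplex_config_def)
  moreover have "{u. f u \<noteq> \<one>} \<subseteq> {0<..<1}" by (auto simp: f(1) simplex_config_def config_def split: if_splits)
  ultimately show "f \<in> finite_configs G" by (simp add: finite_configs_def)
next
  fix f assume "f \<in> finite_configs G"
  then have f: "range f \<subseteq> carrier G" "finite {u. f u \<noteq> \<one>}" "{u. f u \<noteq> \<one>} \<subseteq> {0<..<1}"
    by (auto simp: finite_configs_def)
  define xs where "xs = sorted_list_of_set {u. f u \<noteq> \<one>}"
  have xs: "sorted xs" "distinct xs" "set xs = {u. f u \<noteq> \<one>}" using f(2) by (auto simp: xs_def)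
  have xs01: "set xs \<subseteq> {0..1}" using xs(3) f(3) by fastforce
  have "f u = config G (zip (map f xs) xs) u" for u
  proof (cases "u \<in> set xs")
    case True
    then obtain i where i: "i < length xs" "u = xs ! i" by (metis in_set_conv_nth)
    have "filter (\<lambda>p. snd p = u) (zip (map f xs) xs) = [(f u, u)]"
      using filter_zip_nth[of xs "map f xs" i] xs i by simp
    moreover have "0 < u \<and> u < 1" using True xs(3) f(3) by auto
    moreover have "f u \<in> carrier G" using f(1) by blast
    ultimately show ?thesis by (simp add: config_def list_prod_def)
  next
    case False
    then have "config G (zip (map f xs) xs) u = \<one>" by (intro config_off_support) (auto dest: set_zip_rightD)
    then show ?thesis using False xs(3) by simp
  qed
  then have "f = simplex_config G (map f xs) (gaps xs)" by (auto simp: simplex_config_gaps)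
  moreover have "gaps xs \<in> standard_simplex (length (map f xs))"
    using gaps_in_standard_simplex[OF xs(1) xs01] by simp
  moreover have "map f xs \<in> lists (carrier G)" using f(1) by (auto simp: image_subset_iff)
  ultimately show "f \<in> topspace (configs G)"
    unfolding topspace_config_space by blast
qed

lemma (in monoid) cube_config_in_finite_configs:
  assumes "set gs \<subseteq> carrier G"
  shows "cube_config G gs s \<in> finite_configs G"
proof -
  let ?ps = "zip gs (map s [0..<length gs])"
  have ps: "fst ` set ?ps \<subseteq> carrier G" using assms by (auto dest: set_zip_leftD)
  have "{u. config G ?ps u \<noteq> \<one>} \<subseteq> snd ` set ?ps" using config_off_support by fastforce
  then have "finite {u. config G ?ps u \<noteq> \<one>}" by (rule finite_subset) simp
  moreover have "range (config G ?ps) \<subseteq> carrier G" using config_closed[OF ps] by blast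
  moreover have "{u. config G ?ps u \<noteq> \<one>} \<subseteq> {0<..<1}" by (auto simp: config_def split: if_splits)
  ultimately show ?thesis by (simp add: finite_configs_def cube_config_def)
qed

lemma continuous_on_coordinate [continuous_intros]:
  fixes i :: 'i
  shows "continuous_on S (\<lambda>x. x i :: 'c::topological_space)"
    "continuous_on T (\<lambda>x. fst x i :: 'c)" "continuous_on T' (\<lambda>x. snd x i :: 'c)"
  by (rule continuous_on_product_then_coordinatewise, intro continuous_on_id continuous_on_fst continuous_on_snd)+

lemma compact_cube: "compact cube"
proof -
  have "compactin (powertop_real (UNIV :: nat set)) (UNIV \<rightarrow>\<^sub>E {0..1})" by (simp add: compactin_PiE)
  moreover have "UNIV \<rightarrow>\<^sub>E {0..1} = cube" by (auto simp: cube_def PiE_iff)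
  ultimately show ?thesis by (simp add: euclidean_product_topology compactin_euclidean_iff)
qed

lemma partial_sums_in_cube:
  assumes t: "t \<in> standard_simplex n"
  shows "(\<lambda>i. sum t {..<Suc i}) \<in> cube"
proof -
  have "sum t {..<Suc i} \<le> 1" for i
  proof -
    have "sum t {..<Suc i} \<le> sum t {..<Suc (max i n)}"
      using t by (intro sum_mono2) (auto simp: standard_simplex_alt)
    also have "\<dots> = sum t {..<Suc n}"
      using t by (intro sum.mono_neutral_right) (auto simp: standard_simplex_alt)
    finally show ?thesis using t by (simp add: standard_simplex_alt)
  qed
  then show ?thesis using t by (auto simp: cube_def standard_simplex_alt intro!: sum_nonneg simp del: sum.lessThan_Suc)
qed

lemma closed_cube: "closed cube"
  by (rule compact_imp_closed[OF compact_cube])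

lemma closed_standard_simplex: "closed (standard_simplex n)"
  using closedin_standard_simplex[of n] by (simp add: euclidean_product_topology)

lemma openin_subset_iff_closed_complement:
  fixes S :: "'a::topological_space set"
  assumes "closed S"
  shows "openin (top_of_set S) {x \<in> S. P x} \<longleftrightarrow> closed {x \<in> S. \<not> P x}"
proof -
  have "S - {x \<in> S. P x} = {x \<in> S. \<not> P x}" by auto
  then have "openin (top_of_set S) {x \<in> S. P x} \<longleftrightarrow> closedin (top_of_set S) {x \<in> S. \<not> P x}"
    by (simp add: openin_closedin_eq)
  also have "\<dots> \<longleftrightarrow> closed {x \<in> S. \<not> P x}"
    using assms closedin_closed_eq by auto
  finally show ?thesis .
qed

lemma continuous_on_gaps_map:
  "continuous_on S (\<lambda>s :: nat \<Rightarrow> real. gaps (map s js))"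
proof (rule continuous_on_coordinatewise_then_product)
  fix i
  have c: "continuous_on S (\<lambda>s :: nat \<Rightarrow> real. if b then s k else c)" for b k c
    by (cases b) (auto intro!: continuous_intros)
  have eq: "gaps (map s js) i = (if i < length js then s (js ! i) else if i = length js then 1 else 0) -
     (if i \<noteq> 0 \<and> i \<le> length js then s (js ! (i - 1)) else 0)" for s :: "nat \<Rightarrow> real"
    by (auto simp: gaps_def)
  show "continuous_on S (\<lambda>s. gaps (map s js) i)" unfolding eq by (intro continuous_on_diff c)
qed

lemma closed_sorted_map: "closed {s :: nat \<Rightarrow> real. sorted (map s js)}"
proof -
  have "{s :: nat \<Rightarrow> real. sorted (map s js)} =
      (\<Inter>j\<in>{..<length js}. \<Inter>i\<in>{..<j}. {s. s (js ! i) \<le> s (js ! j)})"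
    by (auto simp: sorted_wrt_iff_nth_less)
  then show ?thesis by (auto intro!: closed_INT closed_Collect_le continuous_intros)
qed

context comm_monoid
begin

lemma list_prod_mset:
  "\<lbrakk>mset xs = mset ys; set xs \<subseteq> carrier G\<rbrakk> \<Longrightarrow> list_prod G xs = list_prod G ys"
proof (induction xs arbitrary: ys)
  case (Cons x xs)
  then have "x \<in> set ys" by (metis list.set_intros(1) set_mset_mset)
  then obtain ys1 ys2 where ys: "ys = ys1 @ x # ys2" by (metis split_list)
  have eq: "mset xs = mset (ys1 @ ys2)" using Cons.prems(1) ys by simp
  then have c: "set (ys1 @ ys2) \<subseteq> carrier G" using Cons.prems(2) by (metis insert_subset list.simps(15) set_mset_mset)
  have l: "list_prod G ys1 \<in> carrier G" "list_prod G ys2 \<in> carrier G" "x \<in> carrier G"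
    using c Cons.prems(2) by auto
  have "list_prod G (x # xs) = x \<otimes> list_prod G (ys1 @ ys2)"
    using Cons.IH[OF eq] Cons.prems(2) by (simp add: list_prod_def)
  also have "\<dots> = x \<otimes> (list_prod G ys1 \<otimes> list_prod G ys2)" using c by (simp add: list_prod_append)
  also have "\<dots> = list_prod G ys1 \<otimes> (x \<otimes> list_prod G ys2)" using l by (simp add: m_lcomm)
  also have "\<dots> = list_prod G ys"
    using c l(3) ys list_prod_append[of ys1 "x # ys2"] by (simp add: list_prod_def)
  finally show ?case .
qed simp

lemma config_mset:
  assumes "mset ps = mset qs" "fst ` set ps \<subseteq> carrier G"
  shows "config G ps = config G qs"
proof
  fix u
  have "mset (map fst (filter (\<lambda>p. snd p = u) ps)) = mset (map fst (filter (\<lambda>p. snd p = u) qs))"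
    using assms(1) by simp
  then have "list_prod G (map fst (filter (\<lambda>p. snd p = u) ps)) = list_prod G (map fst (filter (\<lambda>p. snd p = u) qs))"
    by (rule list_prod_mset) (use assms(2) in auto)
  then show "config G ps u = config G qs u" by (simp add: config_def)
qed

lemma cube_config_permute:
  assumes gs: "set gs \<subseteq> carrier G" and js: "mset js = mset [0..<length gs]"
  shows "cube_config G gs s = config G (zip (map ((!) gs) js) (map s js))"
proof -
  let ?h = "\<lambda>i. (gs ! i, s i)"
  have "zip gs (map s [0..<length gs]) = map ?h [0..<length gs]"
    by (rule nth_equalityI) auto
  moreover have "zip (map ((!) gs) js) (map s js) = map ?h js" by (rule nth_equalityI) auto
  moreover have "mset (map ?h [0..<length gs]) = mset (map ?h js)" using js by (metis mset_map)
  then have "config G (map ?h [0..<length gs]) = config G (map ?h js)"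
    by (rule config_mset) (use gs in auto)
  ultimately show ?thesis by (simp add: cube_config_def)
qed

text \<open>
  A simplex is the part of a cube where the positions are sorted, which gives one direction.
  Conversely a cube is a finite union of closed pieces, one for each order of the positions; on
  each piece the labels can be permuted, because they commute, and the configuration comes from
  a continuous map to a simplex.
\<close>

theorem openin_config_space_iff_cubes:
  "openin (configs G) U \<longleftrightarrow> U \<subseteq> finite_configs G \<and>
     (\<forall>gs\<in>lists (carrier G). openin (top_of_set cube) {s \<in> cube. cube_config G gs s \<in> U})"
  (is "?L \<longleftrightarrow> ?R")
proof
  assume L: ?L
  have "closed {s \<in> cube. cube_config G gs s \<notin> U}" if gs: "gs \<in> lists (carrier G)" for gs
  proof -
    let ?m = "length gs"
    \<comment> \<open>The possible orders of the positions.\<close>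
    define J where "J = {js. mset js = mset [0..<?m]}"
    have J: "set js = {..<?m}" "length js = ?m" if "js \<in> J" for js
    proof -
      have eq: "mset js = mset [0..<?m]" using that by (simp only: J_def mem_Collect_eq)
      show "set js = {..<?m}" using mset_eq_setD[OF eq] by (simp only: set_upt lessThan_atLeast0)
      show "length js = ?m" using mset_eq_length[OF eq] by simp
    qed
    then have "J \<subseteq> {js. set js \<subseteq> {..<?m} \<and> length js = ?m}" by auto
    then have finJ: "finite J" by (rule finite_subset) (simp add: finite_lists_length_eq)
    define piece where "piece js = {s \<in> cube. sorted (map s js)} \<inter>
      (\<lambda>s. gaps (map s js)) -` {t \<in> standard_simplex ?m. simplex_config G (map ((!) gs) js) t \<notin> U}" for js
    have "closed (piece js)" if js: "js \<in> J" for js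
    proof -
      have len: "length js = ?m" and sub: "set js = {..<?m}"
        using J[OF js] by simp_all
      have all: "openin (top_of_set (standard_simplex (length hs))) {t \<in> standard_simplex (length hs). simplex_config G hs t \<in> U}"
        if "hs \<in> lists (carrier G)" for hs
        using L that unfolding openin_config_space by (simp add: euclidean_product_topology)
      have "map ((!) gs) js \<in> lists (carrier G)" using gs sub by auto
      then have "openin (top_of_set (standard_simplex ?m)) {t \<in> standard_simplex ?m. simplex_config G (map ((!) gs) js) t \<in> U}"
        using all[of "map ((!) gs) js"] len by simp
      then have "closed {t \<in> standard_simplex ?m. simplex_config G (map ((!) gs) js) t \<notin> U}"
        using openin_subset_iff_closed_complement[OF closed_standard_simplex] by simp
      moreover have "closed {s \<in> cube. sorted (map s js)}"
        using closed_Int[OF closed_cube closed_sorted_map[of js]] by (simp add: Int_def)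
      ultimately show ?thesis unfolding piece_def
        using continuous_closed_preimage[OF continuous_on_gaps_map] by blast
    qed
    then have "closed (\<Union>js\<in>J. piece js)" using finJ by (intro closed_UN) auto
    moreover have "{s \<in> cube. cube_config G gs s \<notin> U} = (\<Union>js\<in>J. piece js)"
    proof -
      have key: "cube_config G gs s = simplex_config G (map ((!) gs) js) (gaps (map s js))" if "js \<in> J" for s js
      proof -
        have "mset js = mset [0..<?m]" using that by (simp only: J_def mem_Collect_eq)
        then have "cube_config G gs s = config G (zip (map ((!) gs) js) (map s js))"
          using gs by (intro cube_config_permute) auto
        also have "\<dots> = simplex_config G (map ((!) gs) js) (gaps (map s js))"
          by (rule simplex_config_gaps[symmetric]) simp
        finally show ?thesis .
      qed
      have srt: "\<exists>js\<in>J. sorted (map s js)" for s :: "nat \<Rightarrow> real"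
        by (rule bexI[of _ "sort_key s [0..<?m]"]) (auto simp: J_def)
      have std: "gaps (map s js) \<in> standard_simplex ?m" if "s \<in> cube" "js \<in> J" "sorted (map s js)" for s js
      proof -
        have "length (map s js) = ?m" using J that by simp
        moreover have "set (map s js) \<subseteq> {0..1}" using that by (auto simp: cube_def)
        ultimately show ?thesis using gaps_in_standard_simplex[OF that(3)] by metis
      qed
      show ?thesis
      proof (intro equalityI subsetI)
        fix s assume "s \<in> {s \<in> cube. cube_config G gs s \<notin> U}"
        moreover obtain js where js: "js \<in> J" "sorted (map s js)" using srt by blast
        ultimately have "s \<in> piece js" using std[of s js] key[OF js(1), of s] by (simp add: piece_def)
        then show "s \<in> (\<Union>js\<in>J. piece js)" using js by blast
      next
        fix s assume "s \<in> (\<Union>js\<in>J. piece js)"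
        then obtain js where js: "js \<in> J" "s \<in> piece js" by blast
        then show "s \<in> {s \<in> cube. cube_config G gs s \<notin> U}"
          using key[OF js(1), of s] by (simp add: piece_def)
      qed
    qed
    ultimately show ?thesis by simp
  qed
  moreover have "U \<subseteq> finite_configs G" using openin_subset[OF L] topspace_config_space_lists by simp
  ultimately show ?R by (simp add: openin_subset_iff_closed_complement[OF closed_cube])
next
  assume R: ?R
  have "openin (top_of_set (standard_simplex (length gs))) {t \<in> standard_simplex (length gs). simplex_config G gs t \<in> U}"
    if gs: "gs \<in> lists (carrier G)" for gs
  proof -
    let ?n = "length gs" and ?s = "\<lambda>t i. sum t {..<Suc i} :: real"
    have in_cube: "?s t \<in> cube" if "t \<in> standard_simplex ?n" for t
      by (rule partial_sums_in_cube[OF that])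
    have "continuous_on (standard_simplex ?n) ?s"
      by (intro continuous_on_coordinatewise_then_product continuous_intros)
    moreover have "?s \<in> standard_simplex ?n \<rightarrow> cube" using in_cube by blast
    moreover have "openin (top_of_set cube) {s \<in> cube. cube_config G gs s \<in> U}" using R gs by blast
    ultimately have "openin (top_of_set (standard_simplex ?n))
        (standard_simplex ?n \<inter> ?s -` {s \<in> cube. cube_config G gs s \<in> U})"
      by (rule continuous_openin_preimage)
    moreover have "standard_simplex ?n \<inter> ?s -` {s \<in> cube. cube_config G gs s \<in> U}
      = {t \<in> standard_simplex ?n. simplex_config G gs t \<in> U}"
      using in_cube unfolding simplex_config_eq_cube_config by blast
    ultimately show ?thesis by simp
  qed
  then show ?L using R unfolding openin_config_space topspace_config_space_lists
    by (simp add: euclidean_product_topology)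
qed

text \<open>
  Because the labels commute, their product over an open window depends only on the
  configuration. Unlike a single value it does not change when labels move a little without
  crossing the ends of the window.
\<close>

lemma window_product:
  assumes "finite U" "U \<subseteq> {a<..<b}" "0 \<le> a" "b \<le> 1"
    and "fst ` set ps \<subseteq> carrier G" "snd ` set ps \<inter> {a<..<b} \<subseteq> U"
  shows "window_prod G a b ps = finprod G (config G ps) U"
  using assms(5,6)
proof (induction ps)
  case Nil
  then show ?case by (simp add: window_prod_def list_prod_def config_def finprod_one_eqI)
next
  case (Cons p ps)
  obtain g x where p: "p = (g, x)" by force
  have g: "g \<in> carrier G" and ps: "fst ` set ps \<subseteq> carrier G" using Cons.prems p by auto
  have U01: "0 < u \<and> u < 1" if "u \<in> U" for u using assms(2-4) that by fastforce
  have "finprod G (config G (p # ps)) U = finprod G (\<lambda>u. config G [p] u \<otimes> config G ps u) U"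
    by (rule finprod_cong') (use config_append[of "[p]" ps] g p ps in auto)
  also have "\<dots> = finprod G (config G [p]) U \<otimes> finprod G (config G ps) U"
    by (rule finprod_multf) (use g p ps in auto)
  also have "finprod G (config G ps) U = window_prod G a b ps"
  proof -
    have "snd ` set ps \<inter> {a<..<b} \<subseteq> U" using Cons.prems(2) by fastforce
    then show ?thesis using Cons.IH[OF ps] by simp
  qed
  also have "finprod G (config G [p]) U = (if a < x \<and> x < b then g else \<one>)"
  proof -
    have "finprod G (config G [p]) U = (\<Otimes>u\<in>U. if x = u then g else \<one>)"
      by (rule finprod_cong') (use g p U01 in \<open>auto simp: config_single\<close>)
    also have "\<dots> = (if a < x \<and> x < b then g else \<one>)"
    proof (cases "x \<in> U")
      case True
      then show ?thesis using finprod_singleton[of x U "\<lambda>_. g"] assms(1,2) g by auto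
    next
      case False
      then have "\<not> (a < x \<and> x < b)" using Cons.prems p by auto
      moreover have "(\<Otimes>u\<in>U. if x = u then g else \<one>) = \<one>" using False by (intro finprod_one_eqI) auto
      ultimately show ?thesis by auto
    qed
    finally show ?thesis .
  qed
  finally have eq: "finprod G (config G (p # ps)) U = (if a < x \<and> x < b then g else \<one>) \<otimes>
      window_prod G a b ps" .
  have "window_prod G a b ps \<in> carrier G"
    unfolding window_prod_def by (rule list_prod_closed) (use ps in auto)
  then show ?case
    using p g eq by (auto simp: window_prod_def list_prod_def)
qed

lemma window_product_cong:
  assumes "config G ps = config G qs" "0 \<le> a" "b \<le> 1"
    and "fst ` set ps \<subseteq> carrier G" "fst ` set qs \<subseteq> carrier G"
  shows "window_prod G a b ps =
    window_prod G a b qs"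
proof -
  let ?U = "(snd ` set ps \<union> snd ` set qs) \<inter> {a<..<b}"
  have "window_prod G a b ps = finprod G (config G ps) ?U"
    by (rule window_product) (use assms in auto)
  also have "\<dots> = window_prod G a b qs"
    unfolding assms(1) by (rule window_product[symmetric]) (use assms in auto)
  finally show ?thesis .
qed

end

lemma cube_config_window:
  fixes s s' :: "nat \<Rightarrow> real"
  assumes w: "0 < w" "w < 1"
    and near: "\<And>i. i < length gs \<Longrightarrow> s i = w \<longleftrightarrow> a < s' i \<and> s' i < b"
  shows "window_prod G a b (zip gs (map s' [0..<length gs])) = cube_config G gs s w"
proof -
  have z: "zip gs (map r [0..<length gs]) = map (\<lambda>i. (gs ! i, r i)) [0..<length gs]" for r :: "nat \<Rightarrow> real"
    by (rule nth_equalityI) auto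
  have "filter (\<lambda>i. a < s' i \<and> s' i < b) [0..<length gs] = filter (\<lambda>i. s i = w) [0..<length gs]"
    by (rule filter_cong) (use near in auto)
  then show ?thesis using w by (simp add: window_prod_def cube_config_def config_def z filter_map o_def)
qed

context comm_monoid
begin

text \<open>
  If two configurations differ at \<open>w\<close>, take a window around \<open>w\<close> that
  meets no other position of either. The products over it differ, and they stay the same under
  small changes of the positions. This closedness makes the spaces of configurations Hausdorff.
\<close>

lemma closed_cube_config_relation:
  assumes gs: "set gs \<subseteq> carrier G" and hs: "set hs \<subseteq> carrier G"
  shows "closed {(s, r). cube_config G gs s = cube_config G hs r}"
proof -
  let ?N = "{(s, r). cube_config G gs s \<noteq> cube_config G hs r}"
  have "\<exists>T. open T \<and> z \<in> T \<and> T \<subseteq> ?N" if "z \<in> ?N" for z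
  proof -
    obtain s r w where z: "z = (s, r)" and neq: "cube_config G gs s w \<noteq> cube_config G hs r w"
      using \<open>z \<in> ?N\<close> by (auto simp: fun_eq_iff)
    have w: "0 < w" "w < 1" using neq by (auto simp: cube_config_def config_def split: if_splits)
    define D where "D = {w, 1 - w} \<union> (\<lambda>i. \<bar>s i - w\<bar>) ` {i. i < length gs \<and> s i \<noteq> w}
        \<union> (\<lambda>i. \<bar>r i - w\<bar>) ` {i. i < length hs \<and> r i \<noteq> w}"
    have D: "finite D" "D \<noteq> {}" "\<And>x. x \<in> D \<Longrightarrow> 0 < x" using w by (auto simp: D_def)
    \<comment> \<open>Half of the distance from \<open>w\<close> to the ends of the interval and to the positions other than \<open>w\<close>.
    Positions that move by less than \<open>d\<close> stay inside or outside the window of radius \<open>d\<close>.\<close>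
    define d where "d = Min D / 2"
    have d: "0 < d" using D by (simp add: d_def)
    have dD: "2 * d \<le> x" if "x \<in> D" for x using D that by (simp add: d_def)
    let ?O = "(\<Inter>i<length gs. {x. \<bar>fst x i - s i\<bar> < d}) \<inter> (\<Inter>i<length hs. {x. \<bar>snd x i - r i\<bar> < d})"
    have "open ?O" by (intro open_Int open_INT ballI open_Collect_less continuous_intros) auto
    moreover have "z \<in> ?O" using z d by simp
    moreover have "?O \<subseteq> ?N"
    proof
      fix y assume y: "y \<in> ?O"
      obtain s' r' where yy: "y = (s', r')" by force
      have 1: "s i = w \<longleftrightarrow> w - d < s' i \<and> s' i < w + d" if i: "i < length gs" for i
      proof -
        have "\<bar>s' i - s i\<bar> < d" using y yy i by auto
        moreover have "2 * d \<le> \<bar>s i - w\<bar>" if "s i \<noteq> w" by (rule dD) (use i that in \<open>auto simp: D_def\<close>)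
        ultimately show ?thesis by (cases "s i = w") auto
      qed
      have 2: "r i = w \<longleftrightarrow> w - d < r' i \<and> r' i < w + d" if i: "i < length hs" for i
      proof -
        have "\<bar>r' i - r i\<bar> < d" using y yy i by auto
        moreover have "2 * d \<le> \<bar>r i - w\<bar>" if "r i \<noteq> w" by (rule dD) (use i that in \<open>auto simp: D_def\<close>)
        ultimately show ?thesis by (cases "r i = w") auto
      qed
      have "cube_config G gs s' \<noteq> cube_config G hs r'"
      proof
        assume "cube_config G gs s' = cube_config G hs r'"
        then have "window_prod G (w - d) (w + d) (zip gs (map s' [0..<length gs])) =
          window_prod G (w - d) (w + d) (zip hs (map r' [0..<length hs]))"
          unfolding cube_config_def
          by (rule window_product_cong) (use dD[of w] dD[of "1 - w"] d gs hs in \<open>auto simp: D_def dest: set_zip_leftD\<close>)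
        then have "cube_config G gs s w = cube_config G hs r w"
          by (simp only: cube_config_window[where s = s, OF w 1] cube_config_window[where s = r, OF w 2])
        then show False using neq by contradiction
      qed
      then show "y \<in> ?N" using yy by simp
    qed
    ultimately show "\<exists>T. open T \<and> z \<in> T \<and> T \<subseteq> ?N" by blast
  qed
  then have "open ?N" by (subst open_subopen) blast
  moreover have "?N = - {(s, r). cube_config G gs s = cube_config G hs r}" by auto
  ultimately show ?thesis by (simp add: closed_def)
qed

text \<open>
  The set is the projection of a closed part of the relation along a compact cube.
\<close>

lemma closed_cube_config_preimage:
  assumes gs: "set gs \<subseteq> carrier G" and hs: "set hs \<subseteq> carrier G" and C: "closed C" "C \<subseteq> cube"
  shows "closed {s \<in> cube. cube_config G gs s \<in> cube_config G hs ` C}"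
proof -
  let ?R = "{(s, r). cube_config G gs s = cube_config G hs r} \<inter> cube \<times> C"
  have "compact C" using C compact_cube by (metis compact_Int_closed inf.absorb_iff2)
  then have "compact (cube \<times> C)" using compact_cube by (simp add: compact_Times)
  then have "compact ?R"
    using closed_cube_config_relation[OF gs hs] by (simp add: closed_Int_compact)
  then have "closed (fst ` ?R)" by (intro compact_imp_closed compact_continuous_image continuous_intros)
  moreover have "fst ` ?R = {s \<in> cube. cube_config G gs s \<in> cube_config G hs ` C}" by force
  ultimately show ?thesis by (simp only:)
qed

end

section \<open>The filtration by the number of labels\<close>

definition config_stage :: "('a, 'b) monoid_scheme \<Rightarrow> nat \<Rightarrow> (real \<Rightarrow> 'a) set" where
  "config_stage G n = {cube_config G gs s |gs s. set gs \<subseteq> carrier G \<and> length gs = n \<and> s \<in> cube}"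

locale finite_comm_monoid = comm_monoid +
  assumes finite_carrier: "finite (carrier G)"
begin

definition labelled_cubes :: "nat \<Rightarrow> ('a list \<times> (nat \<Rightarrow> real)) topology" where
  "labelled_cubes n = prod_topology (discrete_topology {gs. set gs \<subseteq> carrier G \<and> length gs = n}) (top_of_set cube)"

abbreviation label_config :: "'a list \<times> (nat \<Rightarrow> real) \<Rightarrow> real \<Rightarrow> 'a" where
  "label_config \<equiv> (\<lambda>(gs, s). cube_config G gs s)"

lemma topspace_labelled_cubes:
  "topspace (labelled_cubes n) = {gs. set gs \<subseteq> carrier G \<and> length gs = n} \<times> cube"
  by (simp add: labelled_cubes_def)

lemma continuous_map_labelled_cubes:
  "continuous_map (labelled_cubes n) (configs G) label_config"
  unfolding continuous_map_def
proof (intro conjI allI impI)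
  show "label_config \<in> topspace (labelled_cubes n) \<rightarrow> topspace (configs G)"
    using cube_config_in_finite_configs by (auto simp: topspace_labelled_cubes topspace_config_space_lists)
  fix U assume "openin (configs G) U"
  then have U: "openin (top_of_set cube) {s \<in> cube. cube_config G gs s \<in> U}" if "set gs \<subseteq> carrier G" for gs
    using that unfolding openin_config_space_iff_cubes by auto
  have "{s. (gs, s) \<in> {x \<in> topspace (labelled_cubes n). label_config x \<in> U}} =
     {s \<in> cube. cube_config G gs s \<in> U}" if "set gs \<subseteq> carrier G" "length gs = n" for gs
    using that by (auto simp: topspace_labelled_cubes)
  then show "openin (labelled_cubes n) {x \<in> topspace (labelled_cubes n). label_config x \<in> U}"
    using U unfolding labelled_cubes_def openin_prod_discrete by auto
qed

lemma closedin_config_space_iff_cubes: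
  "closedin (configs G) C \<longleftrightarrow> C \<subseteq> finite_configs G \<and> (\<forall>gs\<in>lists (carrier G). closed {s \<in> cube. cube_config G gs s \<in> C})"
proof -
  have "{s \<in> cube. cube_config G gs s \<in> finite_configs G - C} = {s \<in> cube. \<not> cube_config G gs s \<in> C}"
    if "gs \<in> lists (carrier G)" for gs using cube_config_in_finite_configs[of gs] that by auto
  moreover have "openin (top_of_set cube) {s \<in> cube. \<not> cube_config G gs s \<in> C} \<longleftrightarrow> closed {s \<in> cube. cube_config G gs s \<in> C}" for gs
    using openin_subset_iff_closed_complement[OF closed_cube, of "\<lambda>s. \<not> cube_config G gs s \<in> C"] by simp
  ultimately show ?thesis
    unfolding closedin_def topspace_config_space_lists openin_config_space_iff_cubes by auto
qed

lemma finite_label_lists: "finite {gs. set gs \<subseteq> carrier G \<and> length gs = n}"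
  by (rule finite_lists_length_eq[OF finite_carrier])

text \<open>
  There are only finitely many lists of \<open>n\<close> labels, so the preimage of the image of
  a closed set is a finite union of closed sets.
\<close>

lemma closed_map_labelled_cubes:
  "closed_map (labelled_cubes n) (configs G) label_config"
  unfolding closed_map_def
proof (intro allI impI)
  fix C assume C: "closedin (labelled_cubes n) C"
  let ?I = "{gs. set gs \<subseteq> carrier G \<and> length gs = n}"
  have sub: "C \<subseteq> ?I \<times> cube" using closedin_subset[OF C] by (simp add: topspace_labelled_cubes)
  have Cgs: "closed {s. (hs, s) \<in> C}" if hs: "hs \<in> ?I" for hs
  proof -
    have "continuous_map (top_of_set cube) (labelled_cubes n) (\<lambda>s. (hs, s))"
      unfolding labelled_cubes_def using hs by (intro continuous_map_pairedI) auto
    from closedin_continuous_map_preimage[OF this C]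
    have "closedin (top_of_set cube) {s \<in> cube. (hs, s) \<in> C}" by simp
    moreover have "{s \<in> cube. (hs, s) \<in> C} = {s. (hs, s) \<in> C}" using sub by auto
    ultimately show ?thesis using closedin_closed_eq[OF closed_cube] by auto
  qed
  have "closed {s \<in> cube. cube_config G gs s \<in> label_config ` C}"
    if gs: "gs \<in> lists (carrier G)" for gs
  proof -
    have "C = (\<Union>hs\<in>?I. Pair hs ` {s. (hs, s) \<in> C})" using sub by auto
    then have "label_config ` C
        = label_config ` (\<Union>hs\<in>?I. Pair hs ` {s. (hs, s) \<in> C})" by (rule arg_cong)
    also have "\<dots> = (\<Union>hs\<in>?I. cube_config G hs ` {s. (hs, s) \<in> C})"
      by (simp only: image_UN image_image prod.case)
    finally have "{s \<in> cube. cube_config G gs s \<in> label_config ` C}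
      = (\<Union>hs\<in>?I. {s \<in> cube. cube_config G gs s \<in> cube_config G hs ` {s. (hs, s) \<in> C}})"
      by blast
    also have "closed \<dots>"
    proof (intro closed_UN finite_label_lists ballI)
      fix hs assume hs: "hs \<in> ?I"
      show "closed {s \<in> cube. cube_config G gs s \<in> cube_config G hs ` {s. (hs, s) \<in> C}}"
        by (rule closed_cube_config_preimage) (use gs hs Cgs[OF hs] sub in auto)
    qed
    finally show ?thesis .
  qed
  moreover have "label_config ` C \<subseteq> finite_configs G"
    using sub cube_config_in_finite_configs by auto
  ultimately show "closedin (configs G) (label_config ` C)"
    by (simp add: closedin_config_space_iff_cubes)
qed

lemma image_labelled_cubes: "label_config ` topspace (labelled_cubes n) = config_stage G n"
  by (auto simp: topspace_labelled_cubes config_stage_def) 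

lemma compact_labelled_cubes: "compact_space (labelled_cubes n)"
  unfolding labelled_cubes_def
  using compact_cube finite_label_lists by (simp add: compact_space_prod_topology compact_space_discrete_topology compact_space_subtopology compactin_euclidean_iff)

lemma Hausdorff_labelled_cubes: "Hausdorff_space (labelled_cubes n)"
  unfolding labelled_cubes_def
  by (simp add: Hausdorff_space_prod_topology Hausdorff_space_subtopology)

lemma compactin_config_stage: "compactin (configs G) (config_stage G n)"
  using image_compactin[OF _ continuous_map_labelled_cubes[of n], of "topspace (labelled_cubes n)"]
    compact_labelled_cubes[of n] by (simp add: image_labelled_cubes compact_space_def)

text \<open>
  A closed continuous image of a compact Hausdorff space is Hausdorff.
\<close>

lemma Hausdorff_config_stage: "Hausdorff_space (subtopology (configs G) (config_stage G n))"
proof -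
  let ?Y = "subtopology (configs G) (config_stage G n)"
  have sub: "config_stage G n \<subseteq> topspace (configs G)" using compactin_subset_topspace[OF compactin_config_stage] .
  have "normal_space (labelled_cubes n)"
    using compact_labelled_cubes Hausdorff_labelled_cubes compact_Hausdorff_or_regular_imp_normal_space by blast
  moreover have "continuous_map (labelled_cubes n) ?Y label_config"
    using continuous_map_labelled_cubes image_labelled_cubes
    by (intro continuous_map_into_subtopology) auto
  moreover have "closed_map (labelled_cubes n) ?Y label_config"
    using closed_map_labelled_cubes image_labelled_cubes
    by (intro closed_map_into_subtopology) auto
  moreover have "label_config ` topspace (labelled_cubes n) = topspace ?Y"
    using sub by (auto simp: image_labelled_cubes)
  ultimately show ?thesis
    using normal_Hausdorff_space_closed_continuous_map_image[OF _ Hausdorff_labelled_cubes] by metis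
qed

text \<open>
  A label \<open>1\<close> can be added anywhere.
\<close>

lemma config_stage_Suc: "config_stage G n \<subseteq> config_stage G (Suc n)"
proof
  fix f assume "f \<in> config_stage G n"
  then obtain gs s where f: "f = cube_config G gs s" "set gs \<subseteq> carrier G" "length gs = n" "s \<in> cube"
    by (auto simp: config_stage_def)
  have "cube_config G (gs @ [\<one>]) s = config G (zip gs (map s [0..<n]) @ [(\<one>, s n)] @ [])"
    using f(3) by (simp add: cube_config_def)
  also have "\<dots> = config G (zip gs (map s [0..<n]) @ [])"
    by (rule config_insert_trivial) (use f(2) in \<open>auto dest: set_zip_leftD\<close>)
  also have "\<dots> = f" using f by (simp add: cube_config_def)
  finally have "f = cube_config G (gs @ [\<one>]) s" by simp
  moreover have "set (gs @ [\<one>]) \<subseteq> carrier G" "length (gs @ [\<one>]) = Suc n" using f by auto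
  ultimately show "f \<in> config_stage G (Suc n)" using f(4) unfolding config_stage_def by blast
qed

lemma Union_config_stage: "topspace (configs G) = (\<Union>n. config_stage G n)"
proof
  show "topspace (configs G) \<subseteq> (\<Union>n. config_stage G n)"
  proof
    fix f assume "f \<in> topspace (configs G)"
    then obtain gs t where f: "f = simplex_config G gs t" "set gs \<subseteq> carrier G" "t \<in> standard_simplex (length gs)"
      by (auto simp: topspace_config_space)
    have "f = cube_config G gs (\<lambda>i. sum t {..<Suc i})" by (simp add: f(1) simplex_config_eq_cube_config)
    then show "f \<in> (\<Union>n. config_stage G n)"
      using f(2) partial_sums_in_cube[OF f(3)] unfolding config_stage_def by blast
  qed
  show "(\<Union>n. config_stage G n) \<subseteq> topspace (configs G)"
    using compactin_subset_topspace[OF compactin_config_stage] by blast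
qed

lemma openin_if_openin_stages:
  assumes U: "U \<subseteq> topspace (configs G)" and stages: "\<And>n. openin (subtopology (configs G) (config_stage G n)) (config_stage G n \<inter> U)"
  shows "openin (configs G) U"
  unfolding openin_config_space_iff_cubes
proof (intro conjI ballI)
  show "U \<subseteq> finite_configs G" using U topspace_config_space_lists by simp
  fix gs assume gs: "gs \<in> lists (carrier G)"
  obtain V where V: "openin (configs G) V" "config_stage G (length gs) \<inter> U = V \<inter> config_stage G (length gs)"
    using stages[of "length gs"] by (auto simp: openin_subtopology)
  have "cube_config G gs s \<in> config_stage G (length gs)" if "s \<in> cube" for s
    using gs that by (auto simp: config_stage_def)
  then have "{s \<in> cube. cube_config G gs s \<in> U} = {s \<in> cube. cube_config G gs s \<in> V}"
    using V(2) by blast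
  then show "openin (top_of_set cube) {s \<in> cube. cube_config G gs s \<in> U}"
    using V(1) gs by (simp add: openin_config_space_iff_cubes)
qed

end

section \<open>Products of spaces filtered by compact sets\<close>

text \<open>
  A tube lemma for closed boxes. Each point outside \<open>W\<close> has a coordinate at which
  it can be separated from the box by open sets, and by compactness finitely many of these
  separations suffice.
\<close>

lemma closed_box_neighbourhood:
  assumes cpt: "\<And>i. i \<in> I \<Longrightarrow> compact_space (L i)" and hd: "\<And>i. i \<in> I \<Longrightarrow> Hausdorff_space (L i)"
    and A: "\<And>i. i \<in> I \<Longrightarrow> closedin (L i) (A i)"
    and W: "openin (product_topology L I) W" and AW: "(\<Pi>\<^sub>E i\<in>I. A i) \<subseteq> W"
  obtains V N where "\<And>i. i \<in> I \<Longrightarrow> openin (L i) (V i)" "\<And>i. i \<in> I \<Longrightarrow> A i \<subseteq> V i"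
    "\<And>i. i \<in> I \<Longrightarrow> V i \<subseteq> N i" "\<And>i. i \<in> I \<Longrightarrow> closedin (L i) (N i)" "(\<Pi>\<^sub>E i\<in>I. N i) \<subseteq> W"
proof -
  let ?P = "product_topology L I"
  define C where "C = topspace ?P - W"
  have "compact_space ?P" using cpt by (simp add: compact_space_product_topology)
  then have C: "compactin ?P C"
    unfolding C_def using W by (intro closedin_compact_space closedin_diff closedin_topspace)
  have ex: "\<exists>i O1 O2. i \<in> I \<and> openin (L i) O1 \<and> openin (L i) O2 \<and> c i \<in> O1 \<and> A i \<subseteq> O2 \<and> disjnt O1 O2"
    if "c \<in> C" for c
  proof -
    have c: "c \<in> topspace ?P" "c \<notin> W" using that by (auto simp: C_def)
    then have "c \<notin> (\<Pi>\<^sub>E i\<in>I. A i)" using AW by auto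
    then obtain i where i: "i \<in> I" "c i \<notin> A i" using c(1) by (auto simp: topspace_product_topology PiE_iff)
    have ci: "c i \<in> topspace (L i)" using c(1) i by (auto simp: topspace_product_topology)
    have "compactin (L i) (A i)" using A[OF i(1)] cpt[OF i(1)] closedin_compact_space by blast
    moreover have "compactin (L i) {c i}" using ci by simp
    moreover have "disjnt {c i} (A i)" using i by simp
    ultimately obtain O1 O2 where "openin (L i) O1" "openin (L i) O2" "{c i} \<subseteq> O1" "A i \<subseteq> O2" "disjnt O1 O2"
      using hd[OF i(1)] unfolding Hausdorff_space_compact_sets by metis
    then show ?thesis using i by blast
  qed
  then have "\<forall>c\<in>C. \<exists>q. fst q \<in> I \<and> openin (L (fst q)) (fst (snd q)) \<and> openin (L (fst q)) (snd (snd q)) \<and>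
      c (fst q) \<in> fst (snd q) \<and> A (fst q) \<subseteq> snd (snd q) \<and> disjnt (fst (snd q)) (snd (snd q))"
    by (metis fst_conv snd_conv)
  then obtain q where q: "\<forall>c\<in>C. fst (q c) \<in> I \<and> openin (L (fst (q c))) (fst (snd (q c))) \<and>
      openin (L (fst (q c))) (snd (snd (q c))) \<and> c (fst (q c)) \<in> fst (snd (q c)) \<and>
      A (fst (q c)) \<subseteq> snd (snd (q c)) \<and> disjnt (fst (snd (q c))) (snd (snd (q c)))"
    by (rule bchoice[THEN exE]) blast
  define j O1 O2 where "j c = fst (q c)" and "O1 c = fst (snd (q c))" and "O2 c = snd (snd (q c))" for c
  have j: "\<And>c. c \<in> C \<Longrightarrow> j c \<in> I"
    and O: "\<And>c. c \<in> C \<Longrightarrow> openin (L (j c)) (O1 c)" "\<And>c. c \<in> C \<Longrightarrow> openin (L (j c)) (O2 c)"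
      "\<And>c. c \<in> C \<Longrightarrow> c (j c) \<in> O1 c" "\<And>c. c \<in> C \<Longrightarrow> A (j c) \<subseteq> O2 c" "\<And>c. c \<in> C \<Longrightarrow> disjnt (O1 c) (O2 c)"
    using q by (auto simp: j_def O1_def O2_def)
  define \<U> where "\<U> c = {x \<in> topspace ?P. x (j c) \<in> O1 c}" for c
  have op: "openin ?P (\<U> c)" if "c \<in> C" for c
    unfolding \<U>_def using that j O(1)
    by (intro openin_continuous_map_preimage[of _ "L (j c)"]) auto
  have "C \<subseteq> \<Union>(\<U> ` C)" using O(3) by (auto simp: \<U>_def C_def)
  then obtain F where F: "finite F" "F \<subseteq> C" "C \<subseteq> \<Union>(\<U> ` F)"
    using compactinD[OF C, of "\<U> ` C"] op by (metis (no_types, lifting) finite_subset_image imageE)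
  define V where "V i = \<Inter>(insert (topspace (L i)) (O2 ` {c \<in> F. j c = i}))" for i
  define N where "N i = \<Inter>(insert (topspace (L i)) ((\<lambda>c. topspace (L i) - O1 c) ` {c \<in> F. j c = i}))" for i
  show thesis
  proof
    fix i assume i: "i \<in> I"
    show "openin (L i) (V i)" unfolding V_def
    proof (rule openin_Inter)
      fix S assume "S \<in> insert (topspace (L i)) (O2 ` {c \<in> F. j c = i})"
      then show "openin (L i) S" using O(2) F(2) by auto
    qed (use F(1) in auto)
    show "A i \<subseteq> V i" unfolding V_def using O(4) F(2) closedin_subset[OF A[OF i]] by auto
    show "V i \<subseteq> N i" unfolding V_def N_def using O(5) F(2) by (fastforce simp: disjnt_iff)
    show "closedin (L i) (N i)" unfolding N_def
    proof (rule closedin_Inter)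
      fix S assume "S \<in> insert (topspace (L i)) ((\<lambda>c. topspace (L i) - O1 c) ` {c \<in> F. j c = i})"
      then show "closedin (L i) S" using O(1) F(2) by (auto intro!: closedin_diff)
    qed auto
  next
    show "(\<Pi>\<^sub>E i\<in>I. N i) \<subseteq> W"
    proof
      fix x assume x: "x \<in> (\<Pi>\<^sub>E i\<in>I. N i)"
      then have xt: "x \<in> topspace ?P" by (auto simp: topspace_product_topology N_def PiE_iff)
      show "x \<in> W"
      proof (rule ccontr)
        assume "x \<notin> W"
        then obtain c where c: "c \<in> F" "x \<in> \<U> c" using xt F(3) by (auto simp: C_def)
        then have "j c \<in> I" using j F(2) by auto
        then have "x (j c) \<in> N (j c)" using x by auto
        moreover have "N (j c) \<subseteq> topspace (L (j c)) - O1 c" using c(1) unfolding N_def by blast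
        ultimately show False using c(2) by (auto simp: \<U>_def)
      qed
    qed
  qed
qed

text \<open>
  Milnor's argument. Around a point of \<open>W\<close> one constructs compact boxes \<open>A 0,
  A 1, \<dots>\<close> inside \<open>W\<close>, the sides of \<open>A n\<close> lying in stage
  \<open>n0 + n\<close>, such that the sides of \<open>A (Suc n)\<close> are neighbourhoods of
  the sides of \<open>A n\<close> within the next stage. The unions of the sides are open in the
  factors, since this can be tested on the stages, and because the boxes increase, the product
  of the unions is the union of the boxes, which is contained in \<open>W\<close>.
\<close>

theorem openin_product_if_coherent:
  fixes X :: "'i \<Rightarrow> 'a topology" and K :: "'i \<Rightarrow> nat \<Rightarrow> 'a set"
  assumes I: "finite I"
    and mono: "\<And>i n. i \<in> I \<Longrightarrow> K i n \<subseteq> K i (Suc n)"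
    and cover: "\<And>i. i \<in> I \<Longrightarrow> topspace (X i) = (\<Union>n. K i n)"
    and cpt: "\<And>i n. i \<in> I \<Longrightarrow> compactin (X i) (K i n)"
    and hd: "\<And>i n. i \<in> I \<Longrightarrow> Hausdorff_space (subtopology (X i) (K i n))"
    and coh: "\<And>i U. i \<in> I \<Longrightarrow> U \<subseteq> topspace (X i) \<Longrightarrow>
        (\<And>n. openin (subtopology (X i) (K i n)) (K i n \<inter> U)) \<Longrightarrow> openin (X i) U"
    and W: "W \<subseteq> topspace (product_topology X I)"
    and Wn: "\<And>n. openin (product_topology (\<lambda>i. subtopology (X i) (K i n)) I) ((\<Pi>\<^sub>E i\<in>I. K i n) \<inter> W)"
  shows "openin (product_topology X I) W"
proof (subst openin_subopen, intro ballI)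
  fix x assume xW: "x \<in> W"
  have mono': "K i m \<subseteq> K i n" if "i \<in> I" "m \<le> n" for i m n
    using lift_Suc_mono_le[of "K i"] mono that by blast
  define L where "L n i = subtopology (X i) (K i n)" for n i
  have tL: "topspace (L n i) = K i n" if "i \<in> I" for n i
    using cover[OF that] by (auto simp: L_def)
  have cL: "compact_space (L n i)" if "i \<in> I" for n i
    unfolding L_def using cpt[OF that] compactin_subspace by blast
  have hL: "Hausdorff_space (L n i)" if "i \<in> I" for n i
    unfolding L_def using hd that by blast
  have xtop: "x \<in> extensional I" "\<And>i. i \<in> I \<Longrightarrow> x i \<in> topspace (X i)"
    using xW W by (auto simp: topspace_product_topology PiE_iff)
  then have "\<forall>i\<in>I. \<exists>n. x i \<in> K i n" using cover by auto
  then obtain f where f: "\<And>i. i \<in> I \<Longrightarrow> x i \<in> K i (f i)" by metis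
  \<comment> \<open>A stage that contains all coordinates of \<open>x\<close>; the \<open>0\<close> only matters for empty \<open>I\<close>.\<close>
  define n0 where "n0 = Max (insert 0 (f ` I))"
  have n0: "x i \<in> K i n0" if "i \<in> I" for i
  proof -
    have "f i \<le> n0" unfolding n0_def using I that by (intro Max_ge) auto
    then show ?thesis using f[OF that] mono'[OF that] by blast
  qed
  define good where "good n A \<longleftrightarrow> (\<forall>i\<in>I. closedin (L (n0 + n) i) (A i)) \<and> (\<Pi>\<^sub>E i\<in>I. A i) \<subseteq> W"
    for n and A :: "'i \<Rightarrow> 'a set"
  define step where "step n A B \<longleftrightarrow> (\<forall>i\<in>I. \<exists>V. openin (L (n0 + Suc n) i) V \<and> A i \<subseteq> V \<and> V \<subseteq> B i)"
    for n and A B :: "'i \<Rightarrow> 'a set"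
  have closed_mono: "closedin (L (Suc m) i) S" if "i \<in> I" "closedin (L m i) S" for i m S
  proof -
    have "compactin (L m i) S" using that cL closedin_compact_space by blast
    then have "compactin (X i) S" "S \<subseteq> K i m" by (auto simp: L_def compactin_subtopology)
    then have "compactin (L (Suc m) i) S" using mono[OF that(1)] by (auto simp: L_def compactin_subtopology)
    then show ?thesis using hL[OF that(1)] compactin_imp_closedin by blast
  qed
  have "\<exists>A. (\<forall>n. good n (A n)) \<and> (\<forall>n. step n (A n) (A (Suc n))) \<and> A 0 = (\<lambda>i. {x i})"
  proof -
    have "\<exists>A. \<forall>n. (good n (A n) \<and> (n = 0 \<longrightarrow> A n = (\<lambda>i. {x i}))) \<and> step n (A n) (A (Suc n))"
    \<comment> \<open>The box is enlarged step by step, starting with the single point \<open>x\<close>.\<close>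
    proof (rule dependent_nat_choice)
      have "(\<Pi>\<^sub>E i\<in>I. {x i}) = {x}" using xtop by (simp add: PiE_singleton)
      moreover have "closedin (L n0 i) {x i}" if "i \<in> I" for i
        using closedin_Hausdorff_singleton[OF hL[OF that]] n0[OF that] tL[OF that] by simp
      ultimately show "\<exists>A. good 0 A \<and> ((0::nat) = 0 \<longrightarrow> A = (\<lambda>i. {x i}))" using xW by (auto simp: good_def)
    next
      fix A n assume "good n A \<and> (n = 0 \<longrightarrow> A = (\<lambda>i. {x i}))"
      then have g: "\<And>i. i \<in> I \<Longrightarrow> closedin (L (n0 + n) i) (A i)" "(\<Pi>\<^sub>E i\<in>I. A i) \<subseteq> W"
        by (auto simp: good_def)
      let ?L = "L (n0 + Suc n)"
      have cA: "closedin (?L i) (A i)" if "i \<in> I" for i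
        using closed_mono[OF that g(1)[OF that]] by simp
      have "A i \<subseteq> K i (n0 + Suc n)" if "i \<in> I" for i
        using closedin_subset[OF cA[OF that]] tL[OF that] by simp
      then have sub: "(\<Pi>\<^sub>E i\<in>I. A i) \<subseteq> (\<Pi>\<^sub>E i\<in>I. K i (n0 + Suc n)) \<inter> W"
        using g(2) by (auto simp: PiE_iff)
      have op: "openin (product_topology ?L I) ((\<Pi>\<^sub>E i\<in>I. K i (n0 + Suc n)) \<inter> W)"
        using Wn[of "n0 + Suc n"] unfolding L_def .
      obtain V N where "\<And>i. i \<in> I \<Longrightarrow> openin (?L i) (V i)" "\<And>i. i \<in> I \<Longrightarrow> A i \<subseteq> V i"
        "\<And>i. i \<in> I \<Longrightarrow> V i \<subseteq> N i" "\<And>i. i \<in> I \<Longrightarrow> closedin (?L i) (N i)"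
        "(\<Pi>\<^sub>E i\<in>I. N i) \<subseteq> (\<Pi>\<^sub>E i\<in>I. K i (n0 + Suc n)) \<inter> W"
        using closed_box_neighbourhood[of I ?L A, OF cL hL cA op sub] by metis
      then have "good (Suc n) N \<and> step n A N" unfolding good_def step_def by (metis add_Suc_right le_inf_iff)
      then show "\<exists>B. (good (Suc n) B \<and> (Suc n = 0 \<longrightarrow> B = (\<lambda>i. {x i}))) \<and> step n A B" by blast
    qed
    then show ?thesis by blast
  qed
  then obtain A where A: "\<And>n. good n (A n)" "\<And>n. step n (A n) (A (Suc n))" "A 0 = (\<lambda>i. {x i})" by blast
  have Asub: "A n i \<subseteq> K i (n0 + n)" if "i \<in> I" for n i
    using A(1) that closedin_subset tL by (metis good_def)
  have Amono1: "A n i \<subseteq> A (Suc n) i" if "i \<in> I" for n i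
    using A(2)[of n] that by (force simp: step_def)
  have Amono: "A m i \<subseteq> A n i" if "i \<in> I" "m \<le> n" for m n i
    using lift_Suc_mono_le[of "\<lambda>n. A n i"] Amono1[OF that(1)] that(2) by blast
  define V where "V i = (\<Union>n. A n i)" for i
  have "openin (X i) (V i)" if i: "i \<in> I" for i
  proof (rule coh[OF i])
    show "V i \<subseteq> topspace (X i)" using Asub[OF i] cover[OF i] by (auto simp: V_def)
    fix m
    show "openin (subtopology (X i) (K i m)) (K i m \<inter> V i)"
    proof (subst openin_subopen, intro ballI)
      fix y assume y: "y \<in> K i m \<inter> V i"
      then obtain k where k: "y \<in> A k i" by (auto simp: V_def)
      \<comment> \<open>The neighbourhood has to be taken within a stage that contains \<open>K i m\<close>.\<close>
      define n where "n = max k m"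
      have "y \<in> A n i" using k Amono[OF i, of k n] by (auto simp: n_def)
      obtain U where U: "openin (L (n0 + Suc n) i) U" "A n i \<subseteq> U" "U \<subseteq> A (Suc n) i"
        using A(2)[of n] i by (auto simp: step_def)
      obtain O' where O': "openin (X i) O'" "U = O' \<inter> K i (n0 + Suc n)"
        using U(1) by (auto simp: L_def openin_subtopology)
      have Km: "K i m \<subseteq> K i (n0 + Suc n)" using mono'[OF i] by (simp add: n_def)
      have "openin (subtopology (X i) (K i m)) (K i m \<inter> O')"
        using O'(1) openin_subtopology_Int2 by blast
      moreover have "y \<in> K i m \<inter> O'" using y U O' \<open>y \<in> A n i\<close> by auto
      moreover have "K i m \<inter> O' \<subseteq> K i m \<inter> V i" using Km O' U by (auto simp: V_def)
      ultimately show "\<exists>T. openin (subtopology (X i) (K i m)) T \<and> y \<in> T \<and> T \<subseteq> K i m \<inter> V i" by blast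
    qed
  qed
  then have "openin (product_topology X I) (\<Pi>\<^sub>E i\<in>I. V i)" using I by (simp add: openin_PiE_gen)
  moreover have "x \<in> (\<Pi>\<^sub>E i\<in>I. V i)"
    using xtop(1) A(3) by (auto simp: PiE_iff V_def) (metis singletonI)
  moreover have "(\<Pi>\<^sub>E i\<in>I. V i) \<subseteq> W"
  proof
    fix y assume y: "y \<in> (\<Pi>\<^sub>E i\<in>I. V i)"
    then have "\<forall>i\<in>I. \<exists>n. y i \<in> A n i" by (auto simp: V_def PiE_iff)
    then obtain f where f: "\<And>i. i \<in> I \<Longrightarrow> y i \<in> A (f i) i" by metis
    define n where "n = Max (insert 0 (f ` I))"
    have "y i \<in> A n i" if "i \<in> I" for i
    proof -
      have "f i \<le> n" unfolding n_def using I that by (intro Max_ge) auto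
      then show ?thesis using f[OF that] Amono[OF that] by blast
    qed
    then have "y \<in> (\<Pi>\<^sub>E i\<in>I. A n i)" using y by (auto simp: PiE_iff)
    then show "y \<in> W" using A(1)[of n] by (auto simp: good_def)
  qed
  ultimately show "\<exists>T. openin (product_topology X I) T \<and> x \<in> T \<and> T \<subseteq> W" by blast
qed

section \<open>Configurations in a direct product of abelian groups\<close>

lemma hom_config:
  assumes "monoid G" "h \<in> hom G H" "h \<one>\<^bsub>G\<^esub> = \<one>\<^bsub>H\<^esub>" "fst ` set ps \<subseteq> carrier G"
  shows "h (config G ps u) = config H (map (\<lambda>(g, x). (h g, x)) ps) u"
proof -
  interpret G: monoid G by fact
  have "h (list_prod G xs) = list_prod H (map h xs)" if "set xs \<subseteq> carrier G" for xs
    using that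
  proof (induction xs)
    case (Cons x xs)
    then have "list_prod G xs \<in> carrier G" by simp
    then have "h (x \<otimes>\<^bsub>G\<^esub> list_prod G xs) = h x \<otimes>\<^bsub>H\<^esub> h (list_prod G xs)"
      using Cons.prems assms(2) by (intro hom_mult) auto
    then show ?case using Cons by (simp add: list_prod_def)
  qed (simp add: list_prod_def assms(3))
  moreover have "set (map fst (filter (\<lambda>p. snd p = u) ps)) \<subseteq> carrier G" using assms(4) by auto
  moreover have "map h (map fst (filter (\<lambda>p. snd p = u) ps)) = map fst (filter (\<lambda>p. snd p = u) (map (\<lambda>(g, x). (h g, x)) ps))"
    by (induction ps) auto
  ultimately show ?thesis using assms(3) by (simp add: config_def del: map_map)
qed

lemma hom_cube_config:
  assumes "monoid G" "h \<in> hom G H" "h \<one>\<^bsub>G\<^esub> = \<one>\<^bsub>H\<^esub>" "set gs \<subseteq> carrier G"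
  shows "h (cube_config G gs s u) = cube_config H (map h gs) s u"
proof -
  have "map (\<lambda>(g, x). (h g, x)) (zip gs (map s [0..<length gs])) = zip (map h gs) (map s [0..<length gs])"
    by (rule nth_equalityI) auto
  moreover have "fst ` set (zip gs (map s [0..<length gs])) \<subseteq> carrier G"
    using assms(4) by (auto dest: set_zip_leftD)
  ultimately show ?thesis using hom_config[OF assms(1-3)] by (simp add: cube_config_def)
qed

lemma continuous_map_hom_config:
  assumes G: "comm_monoid G" and H: "comm_monoid H" and h: "h \<in> hom G H" "h \<one>\<^bsub>G\<^esub> = \<one>\<^bsub>H\<^esub>"
  shows "continuous_map (configs G) (configs H) (\<lambda>f. h \<circ> f)"
proof -
  interpret G: comm_monoid G by fact
  interpret H: comm_monoid H by fact
  have into: "h \<circ> f \<in> finite_configs H" if f: "f \<in> finite_configs G" for f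
  proof -
    have "{u. (h \<circ> f) u \<noteq> \<one>\<^bsub>H\<^esub>} \<subseteq> {u. f u \<noteq> \<one>\<^bsub>G\<^esub>}" using h(2) by auto
    moreover have "range (h \<circ> f) \<subseteq> carrier H" using f h(1) by (auto simp: finite_configs_def hom_def)
    ultimately show ?thesis using f unfolding finite_configs_def
      by (simp add: finite_subset) (meson finite_subset subset_trans)
  qed
  show ?thesis unfolding continuous_map_def
  proof (intro conjI allI impI)
    show "(\<lambda>f. h \<circ> f) \<in> topspace (configs G) \<rightarrow> topspace (configs H)"
      using into by (simp add: G.topspace_config_space_lists H.topspace_config_space_lists)
    fix U assume U: "openin (configs H) U"
    show "openin (configs G) {f \<in> topspace (configs G). h \<circ> f \<in> U}"
      unfolding G.openin_config_space_iff_cubes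
    proof (intro conjI ballI)
      show "{f \<in> topspace (configs G). h \<circ> f \<in> U} \<subseteq> finite_configs G"
        by (auto simp: G.topspace_config_space_lists)
      fix gs assume gs: "gs \<in> lists (carrier G)"
      have "map h gs \<in> lists (carrier H)" using gs h(1) by (auto simp: hom_def Pi_iff)
      then have "openin (top_of_set cube) {s \<in> cube. cube_config H (map h gs) s \<in> U}"
        using U unfolding H.openin_config_space_iff_cubes by blast
      moreover have "h \<circ> cube_config G gs s = cube_config H (map h gs) s" for s
        using gs h hom_cube_config[OF G.monoid_axioms h, of gs s] by (auto simp: fun_eq_iff)
      moreover have "cube_config G gs s \<in> finite_configs G" for s
        using gs by (intro G.cube_config_in_finite_configs) auto
      ultimately show "openin (top_of_set cube)
          {s \<in> cube. cube_config G gs s \<in> {f \<in> topspace (configs G). h \<circ> f \<in> U}}"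
        by (simp add: G.topspace_config_space_lists)
    qed
  qed
qed

lemma (in comm_monoid) config_concat:
  assumes "distinct il" "\<And>i. i \<in> set il \<Longrightarrow> fst ` set (f i) \<subseteq> carrier G"
  shows "config G (concat (map f il)) u = (\<Otimes>i\<in>set il. config G (f i) u)"
  using assms
proof (induction il)
  case Nil
  then show ?case by (simp add: config_def list_prod_def)
next
  case (Cons i il)
  have "config G (concat (map f (i # il))) u = config G (f i) u \<otimes> config G (concat (map f il)) u"
    using Cons.prems(2) by (simp, intro config_append) auto
  also have "\<dots> = config G (f i) u \<otimes> (\<Otimes>i\<in>set il. config G (f i) u)" using Cons by simp
  also have "\<dots> = (\<Otimes>i\<in>set (i # il). config G (f i) u)"
    using Cons.prems by (simp add: Pi_def)
  finally show ?case .
qed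

text \<open>
  A direct product of abelian groups in terms of its inclusions and projections. The factors are
  groups of their own, which leaves room for the conjugations between Sylow subgroups.
\<close>

locale abelian_decomposition = comm_group G for G :: "('a, 'b) monoid_scheme" (structure) +
  fixes I :: "'i set" and B :: "'i \<Rightarrow> ('c, 'd) monoid_scheme"
    and \<iota> :: "'i \<Rightarrow> 'c \<Rightarrow> 'a" and \<rho> :: "'i \<Rightarrow> 'a \<Rightarrow> 'c"
  assumes finite_index: "finite I"
    and factor_group: "i \<in> I \<Longrightarrow> comm_group (B i)"
    and finite_factor: "i \<in> I \<Longrightarrow> finite (carrier (B i))"
    and \<iota>_hom: "i \<in> I \<Longrightarrow> \<iota> i \<in> hom (B i) G"
    and \<rho>_hom: "i \<in> I \<Longrightarrow> \<rho> i \<in> hom G (B i)"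
    and \<rho>_\<iota>: "\<lbrakk>i \<in> I; x \<in> carrier (B i)\<rbrakk> \<Longrightarrow> \<rho> i (\<iota> i x) = x"
    and \<rho>_\<iota>_other: "\<lbrakk>i \<in> I; j \<in> I; i \<noteq> j; x \<in> carrier (B i)\<rbrakk> \<Longrightarrow> \<rho> j (\<iota> i x) = \<one>\<^bsub>B j\<^esub>"
    and sum_\<iota>_\<rho>: "y \<in> carrier G \<Longrightarrow> (\<Otimes>i\<in>I. \<iota> i (\<rho> i y)) = y"
begin

lemma factor_monoid: "i \<in> I \<Longrightarrow> comm_monoid (B i)"
  using factor_group comm_group.axioms(1) by blast

lemma factor_stage: "i \<in> I \<Longrightarrow> finite_comm_monoid (B i)"
  by (simp add: finite_comm_monoid_def finite_comm_monoid_axioms_def factor_monoid finite_factor)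

lemma \<iota>_one: "i \<in> I \<Longrightarrow> \<iota> i \<one>\<^bsub>B i\<^esub> = \<one>"
  using \<iota>_hom factor_group by (intro hom_one) (auto simp: comm_group_def)

lemma \<rho>_one: "i \<in> I \<Longrightarrow> \<rho> i \<one> = \<one>\<^bsub>B i\<^esub>"
  using \<rho>_hom factor_group by (intro hom_one) (auto simp: comm_group_def)

lemma \<iota>_closed: "\<lbrakk>i \<in> I; x \<in> carrier (B i)\<rbrakk> \<Longrightarrow> \<iota> i x \<in> carrier G"
  using \<iota>_hom by (auto simp: hom_def)

lemma \<rho>_closed: "\<lbrakk>i \<in> I; x \<in> carrier G\<rbrakk> \<Longrightarrow> \<rho> i x \<in> carrier (B i)"
  using \<rho>_hom by (auto simp: hom_def)

lemma \<rho>_finprod: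
  assumes j: "j \<in> I" and x: "\<And>i. i \<in> I \<Longrightarrow> x i \<in> carrier (B i)"
  shows "\<rho> j (\<Otimes>i\<in>I. \<iota> i (x i)) = x j"
proof -
  interpret Bj: comm_group "B j" using factor_group j by blast
  have "\<rho> j (\<Otimes>i\<in>F. \<iota> i (x i)) = (if j \<in> F then x j else \<one>\<^bsub>B j\<^esub>)" if "F \<subseteq> I" for F
    using finite_subset[OF that finite_index] that
  proof (induction F rule: finite_induct)
    case empty
    then show ?case using \<rho>_one j by simp
  next
    case (insert i F)
    have c: "(\<lambda>i. \<iota> i (x i)) \<in> F \<rightarrow> carrier G" "\<iota> i (x i) \<in> carrier G"
      using insert.prems x \<iota>_closed by auto
    have "\<rho> j (\<Otimes>i\<in>insert i F. \<iota> i (x i)) = \<rho> j (\<iota> i (x i) \<otimes> (\<Otimes>i\<in>F. \<iota> i (x i)))"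
      using insert.hyps c by simp
    also have "\<dots> = \<rho> j (\<iota> i (x i)) \<otimes>\<^bsub>B j\<^esub> \<rho> j (\<Otimes>i\<in>F. \<iota> i (x i))"
      by (rule hom_mult[OF \<rho>_hom[OF j]]) (use c in auto)
    also have "\<dots> = (if j \<in> insert i F then x j else \<one>\<^bsub>B j\<^esub>)"
    proof (cases "j = i")
      case True
      then have "i = j" by simp
      then show ?thesis using insert \<rho>_\<iota>[OF j x[OF j]] x[OF j] by simp
    next
      case False
      then have "\<rho> j (\<iota> i (x i)) = \<one>\<^bsub>B j\<^esub>" using \<rho>_\<iota>_other[of i j "x i"] insert.prems j x by simp
      then show ?thesis using False insert x[OF j] by simp
    qed
    finally show ?case .
  qed
  from this[of I] j show ?thesis by simp
qed

definition split_config :: "(real \<Rightarrow> 'a) \<Rightarrow> 'i \<Rightarrow> real \<Rightarrow> 'c" where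
  "split_config f = (\<lambda>i\<in>I. \<rho> i \<circ> f)"

definition merge_configs :: "('i \<Rightarrow> real \<Rightarrow> 'c) \<Rightarrow> real \<Rightarrow> 'a" where
  "merge_configs F = (\<lambda>u. \<Otimes>i\<in>I. \<iota> i (F i u))"

abbreviation "factor_configs \<equiv> product_topology (\<lambda>i. configs (B i)) I"

lemma continuous_map_split_config: "continuous_map (configs G) factor_configs split_config"
proof -
  have "continuous_map (configs G) (configs (B i)) (\<lambda>f. \<rho> i \<circ> f)" if "i \<in> I" for i
    using continuous_map_hom_config[OF comm_monoid_axioms factor_monoid[OF that] \<rho>_hom[OF that] \<rho>_one[OF that]] .
  then show ?thesis unfolding split_config_def by (auto simp: continuous_map_componentwise)
qed

lemma topspace_factor_configs: "topspace factor_configs = (\<Pi>\<^sub>E i\<in>I. finite_configs (B i))"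
proof -
  have "topspace (configs (B i)) = finite_configs (B i)" if "i \<in> I" for i
    using factor_monoid[OF that] comm_monoid.axioms(1) monoid.topspace_config_space_lists by blast
  then show ?thesis by (auto simp: topspace_product_topology PiE_iff)
qed

lemma merge_configs_in_finite_configs:
  assumes F: "F \<in> (\<Pi>\<^sub>E i\<in>I. finite_configs (B i))"
  shows "merge_configs F \<in> finite_configs G"
proof -
  have Fi: "range (F i) \<subseteq> carrier (B i)" "finite {u. F i u \<noteq> \<one>\<^bsub>B i\<^esub>}" "{u. F i u \<noteq> \<one>\<^bsub>B i\<^esub>} \<subseteq> {0<..<1}"
    if "i \<in> I" for i using F that by (auto simp: finite_configs_def PiE_iff)
  have "range (merge_configs F) \<subseteq> carrier G"
    using Fi(1) \<iota>_closed unfolding merge_configs_def by (auto intro!: finprod_closed)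
  moreover have "{u. merge_configs F u \<noteq> \<one>} \<subseteq> (\<Union>i\<in>I. {u. F i u \<noteq> \<one>\<^bsub>B i\<^esub>})"
    unfolding merge_configs_def using \<iota>_one by (auto intro!: finprod_one_eqI) 
  moreover have "finite (\<Union>i\<in>I. {u. F i u \<noteq> \<one>\<^bsub>B i\<^esub>})" using finite_index Fi(2) by blast
  moreover have "(\<Union>i\<in>I. {u. F i u \<noteq> \<one>\<^bsub>B i\<^esub>}) \<subseteq> {0<..<1}" using Fi(3) by blast
  ultimately show ?thesis unfolding finite_configs_def
    by (simp add: finite_subset)
qed

lemma merge_split_config:
  assumes "f \<in> finite_configs G"
  shows "merge_configs (split_config f) = f"
proof
  fix u
  have fu: "f u \<in> carrier G" using assms by (auto simp: finite_configs_def)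
  have "merge_configs (split_config f) u = (\<Otimes>i\<in>I. \<iota> i (\<rho> i (f u)))"
    unfolding merge_configs_def split_config_def
    by (rule finprod_cong') (use fu \<iota>_closed \<rho>_closed in auto)
  then show "merge_configs (split_config f) u = f u" using sum_\<iota>_\<rho> fu by simp
qed

lemma split_merge_configs:
  assumes F: "F \<in> (\<Pi>\<^sub>E i\<in>I. finite_configs (B i))"
  shows "split_config (merge_configs F) = F"
proof (rule extensionalityI[of _ I])
  show "F \<in> extensional I" using F by (simp add: PiE_iff)
  fix j assume j: "j \<in> I"
  have "\<rho> j (merge_configs F u) = F j u" for u
    unfolding merge_configs_def by (rule \<rho>_finprod[OF j]) (use F in \<open>auto simp: finite_configs_def PiE_iff image_subset_iff\<close>)
  then show "split_config (merge_configs F) j = F j" using j by (simp add: split_config_def fun_eq_iff)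
qed (simp add: split_config_def)

definition factor_cubes :: "('i \<Rightarrow> nat \<Rightarrow> real) topology" where
  "factor_cubes = product_topology (\<lambda>_. top_of_set cube) I"

definition factor_config :: "('i \<Rightarrow> 'c list) \<Rightarrow> ('i \<Rightarrow> nat \<Rightarrow> real) \<Rightarrow> 'i \<Rightarrow> real \<Rightarrow> 'c" where
  "factor_config \<gamma> s = (\<lambda>i\<in>I. cube_config (B i) (\<gamma> i) (s i))"

text \<open>
  Writing the labelled points of all factors one after the other presents the merged
  configuration by a single cube, in which the positions are in no particular order.
\<close>

lemma openin_merge_preimage_cubes:
  assumes U: "openin (configs G) U"
    and \<gamma>: "\<And>i. i \<in> I \<Longrightarrow> set (\<gamma> i) \<subseteq> carrier (B i) \<and> length (\<gamma> i) = n"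
  shows "openin factor_cubes {s \<in> topspace factor_cubes. merge_configs (factor_config \<gamma> s) \<in> U}"
proof -
  obtain il where il: "set il = I" "distinct il" using finite_distinct_list[OF finite_index] by blast
  \<comment> \<open>The pairs of a factor and a label in it, in the order in which they are written down;
  \<open>flat s\<close> is the corresponding sequence of positions.\<close>
  define idx where "idx = List.product il [0..<n]"
  define gs where "gs = map (\<lambda>(i, k). \<iota> i (\<gamma> i ! k)) idx"
  define flat where "flat s j = (if j < length idx then s (fst (idx ! j)) (snd (idx ! j)) else 0)"
    for s :: "'i \<Rightarrow> nat \<Rightarrow> real" and j
  have idx: "fst (idx ! j) \<in> I" "snd (idx ! j) < n" if "j < length idx" for j
    using nth_mem[OF that] il by (auto simp: idx_def)
  have gsc: "set gs \<subseteq> carrier G"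
  proof
    fix g assume "g \<in> set gs"
    then obtain i k where ik: "i \<in> I" "k < n" "g = \<iota> i (\<gamma> i ! k)" by (auto simp: gs_def idx_def il)
    then have "\<gamma> i ! k \<in> carrier (B i)" using \<gamma>[OF ik(1)] nth_mem by fastforce
    then show "g \<in> carrier G" using ik \<iota>_closed by simp
  qed
  have flat: "merge_configs (factor_config \<gamma> s) = cube_config G gs (flat s)" for s
  proof
    fix u
    let ?f = "\<lambda>i. map (\<lambda>k. (\<iota> i (\<gamma> i ! k), s i k)) [0..<n]"
    have "zip gs (map (flat s) [0..<length gs]) = map (\<lambda>(i, k). (\<iota> i (\<gamma> i ! k), s i k)) idx"
      by (rule nth_equalityI) (auto simp: gs_def flat_def split: prod.split)
    also have "\<dots> = concat (map ?f il)"
      by (simp add: idx_def product_concat_map map_concat o_def)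
    finally have "cube_config G gs (flat s) u = config G (concat (map ?f il)) u"
      by (simp add: cube_config_def)
    also have "\<dots> = (\<Otimes>i\<in>set il. config G (?f i) u)"
    proof (rule config_concat[OF il(2)])
      fix i assume "i \<in> set il"
      then have i: "i \<in> I" using il by simp
      have "\<gamma> i ! k \<in> carrier (B i)" if "k < n" for k using \<gamma>[OF i] nth_mem[of k "\<gamma> i"] that by auto
      then show "fst ` set (?f i) \<subseteq> carrier G" using \<iota>_closed[OF i] by auto
    qed
    also have "\<dots> = (\<Otimes>i\<in>I. \<iota> i (factor_config \<gamma> s i u))"
    proof (rule finprod_cong')
      fix i assume i: "i \<in> I"
      interpret Bi: comm_monoid "B i" by (rule factor_monoid[OF i])
      have c: "set (\<gamma> i) \<subseteq> carrier (B i)" "length (\<gamma> i) = n" using \<gamma>[OF i] by auto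
      have "\<iota> i (cube_config (B i) (\<gamma> i) (s i) u) = cube_config G (map (\<iota> i) (\<gamma> i)) (s i) u"
        by (rule hom_cube_config[OF Bi.monoid_axioms \<iota>_hom[OF i] \<iota>_one[OF i] c(1)])
      also have "\<dots> = config G (?f i) u"
      proof -
        have "zip (map (\<iota> i) (\<gamma> i)) (map (s i) [0..<length (map (\<iota> i) (\<gamma> i))]) = ?f i"
          by (rule nth_equalityI) (use c in auto)
        then show ?thesis by (simp add: cube_config_def)
      qed
      finally show "config G (?f i) u = \<iota> i (factor_config \<gamma> s i u)"
        using i by (simp add: factor_config_def)
    next
      show "(\<lambda>i. \<iota> i (factor_config \<gamma> s i u)) \<in> I \<rightarrow> carrier G"
      proof
        fix i assume i: "i \<in> I"
        interpret Bi: comm_monoid "B i" by (rule factor_monoid[OF i])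
        have "cube_config (B i) (\<gamma> i) (s i) u \<in> carrier (B i)"
          using \<gamma>[OF i] unfolding cube_config_def by (intro Bi.config_closed) (auto dest: set_zip_leftD)
        then show "\<iota> i (factor_config \<gamma> s i u) \<in> carrier G"
          using i \<iota>_closed by (simp add: factor_config_def)
      qed
    qed (simp add: il)
    finally show "merge_configs (factor_config \<gamma> s) u = cube_config G gs (flat s) u"
      by (simp add: merge_configs_def)
  qed
  have cont: "continuous_map factor_cubes (top_of_set cube) flat"
  proof (rule continuous_map_into_subtopology)
    have "continuous_map factor_cubes euclideanreal (\<lambda>s. flat s j)" for j
    proof (cases "j < length idx")
      case True
      have "continuous_map factor_cubes (top_of_set cube) (\<lambda>s. s (fst (idx ! j)))"
        unfolding factor_cubes_def by (rule continuous_map_product_projection) (use idx True in simp)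
      moreover have "continuous_map (top_of_set cube) euclideanreal (\<lambda>x. x (snd (idx ! j)))"
        by (simp add: continuous_on_coordinate)
      ultimately have "continuous_map factor_cubes euclideanreal ((\<lambda>x. x (snd (idx ! j))) \<circ> (\<lambda>s. s (fst (idx ! j))))"
        by (rule continuous_map_compose)
      then show ?thesis using True by (simp add: flat_def o_def)
    qed (simp add: flat_def)
    then have "continuous_map factor_cubes (powertop_real UNIV) flat"
      by (simp add: continuous_map_componentwise_UNIV)
    then show "continuous_map factor_cubes euclidean flat" by (simp add: euclidean_product_topology)
    have "s i \<in> cube" if "s \<in> topspace factor_cubes" "i \<in> I" for s i
      using that by (auto simp: factor_cubes_def)
    then show "flat \<in> topspace factor_cubes \<rightarrow> cube"
      using idx by (fastforce simp: flat_def cube_def)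
  qed
  have "openin (top_of_set cube) {t \<in> cube. cube_config G gs t \<in> U}"
    using U gsc unfolding openin_config_space_iff_cubes by auto
  from openin_continuous_map_preimage[OF cont this]
  have "openin factor_cubes {s \<in> topspace factor_cubes. flat s \<in> cube \<and> cube_config G gs (flat s) \<in> U}" by simp
  moreover have "flat s \<in> cube" if "s \<in> topspace factor_cubes" for s
    using continuous_map_image_subset_topspace[OF cont] that by auto
  ultimately show ?thesis by (simp add: flat cong: conj_cong)
qed

text \<open>
  By \<open>openin_product_if_coherent\<close> it is enough to look at products of stages. Such
  a product is a finite union of continuous images of compact products of cubes, so that a
  subset is closed as soon as its preimages in these are closed.
\<close>

lemma continuous_map_merge_configs: "continuous_map factor_configs (configs G) merge_configs"
  unfolding continuous_map_def
proof (intro conjI allI impI)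
  show "merge_configs \<in> topspace factor_configs \<rightarrow> topspace (configs G)"
    using merge_configs_in_finite_configs
    by (simp add: topspace_factor_configs topspace_config_space_lists del: topspace_product_topology)
  fix U assume U: "openin (configs G) U"
  let ?W = "{F \<in> topspace factor_configs. merge_configs F \<in> U}"
  show "openin factor_configs ?W"
  proof (rule openin_product_if_coherent[where K = "\<lambda>i. config_stage (B i)"])
    show "finite I" by (rule finite_index)
    show "?W \<subseteq> topspace factor_configs" by blast
  next
    fix i assume i: "i \<in> I"
    interpret Bi: finite_comm_monoid "B i" by (rule factor_stage[OF i])
    show "topspace (configs (B i)) = (\<Union>n. config_stage (B i) n)"
      by (rule Bi.Union_config_stage)
    fix n
    show "config_stage (B i) n \<subseteq> config_stage (B i) (Suc n)" by (rule Bi.config_stage_Suc)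
    show "compactin (configs (B i)) (config_stage (B i) n)" by (rule Bi.compactin_config_stage)
    show "Hausdorff_space (subtopology (configs (B i)) (config_stage (B i) n))"
      by (rule Bi.Hausdorff_config_stage)
  next
    fix i V
    assume i: "i \<in> I" and V: "V \<subseteq> topspace (configs (B i))"
      "\<And>n. openin (subtopology (configs (B i)) (config_stage (B i) n)) (config_stage (B i) n \<inter> V)"
    interpret Bi: finite_comm_monoid "B i" by (rule factor_stage[OF i])
    show "openin (configs (B i)) V" by (rule Bi.openin_if_openin_stages[OF V])
  next
    fix n
    let ?K = "\<Pi>\<^sub>E i\<in>I. config_stage (B i) n"
    let ?P = "product_topology (\<lambda>i. subtopology (configs (B i)) (config_stage (B i) n)) I"
    let ?bad = "\<lambda>\<gamma>. {s \<in> topspace factor_cubes. merge_configs (factor_config \<gamma> s) \<notin> U}"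
    define \<Gamma> where "\<Gamma> = (\<Pi>\<^sub>E i\<in>I. {gs. set gs \<subseteq> carrier (B i) \<and> length gs = n})"
    have fin: "finite \<Gamma>" unfolding \<Gamma>_def
      using finite_index finite_factor by (intro finite_PiE) (auto intro: finite_lists_length_eq)
    have stage_sub: "config_stage (B i) n \<subseteq> topspace (configs (B i))" if i: "i \<in> I" for i
    proof -
      interpret Bi: finite_comm_monoid "B i" by (rule factor_stage[OF i])
      show ?thesis using Bi.Union_config_stage by blast
    qed
    have topP: "topspace ?P = ?K" using stage_sub by (auto simp: topspace_product_topology PiE_iff)
    have hdP: "Hausdorff_space ?P"
    proof -
      have "Hausdorff_space (subtopology (configs (B i)) (config_stage (B i) n))" if i: "i \<in> I" for i
      proof -
        interpret Bi: finite_comm_monoid "B i" by (rule factor_stage[OF i])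
        show ?thesis by (rule Bi.Hausdorff_config_stage)
      qed
      then show ?thesis by (simp add: Hausdorff_space_product_topology)
    qed
    have cpt: "compact_space factor_cubes"
      using compact_cube by (simp add: factor_cubes_def compact_space_product_topology compact_space_subtopology compactin_euclidean_iff)
    have cont: "continuous_map factor_cubes ?P (factor_config \<gamma>)" if \<gamma>: "\<gamma> \<in> \<Gamma>" for \<gamma>
      unfolding factor_config_def continuous_map_componentwise
    proof (intro conjI ballI)
      fix i assume i: "i \<in> I"
      interpret Bi: finite_comm_monoid "B i" by (rule factor_stage[OF i])
      have g: "set (\<gamma> i) \<subseteq> carrier (B i)" "length (\<gamma> i) = n" using \<gamma> i by (auto simp: \<Gamma>_def)
      have "continuous_map factor_cubes (top_of_set cube) (\<lambda>s. s i)"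
        unfolding factor_cubes_def by (rule continuous_map_product_projection[OF i])
      then have "continuous_map factor_cubes (Bi.labelled_cubes n) (\<lambda>s. (\<gamma> i, s i))"
        unfolding Bi.labelled_cubes_def using g by (intro continuous_map_pairedI) auto
      from continuous_map_compose[OF this Bi.continuous_map_labelled_cubes]
      have "continuous_map factor_cubes (configs (B i)) (\<lambda>s. cube_config (B i) (\<gamma> i) (s i))"
        by (simp add: o_def)
      moreover have "(\<lambda>s. cube_config (B i) (\<gamma> i) (s i)) \<in> topspace factor_cubes \<rightarrow> config_stage (B i) n"
        using g i by (auto simp: config_stage_def factor_cubes_def)
      ultimately have "continuous_map factor_cubes (subtopology (configs (B i)) (config_stage (B i) n))
          (\<lambda>s. cube_config (B i) (\<gamma> i) (s i))" by (rule continuous_map_into_subtopology)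
      then show "continuous_map factor_cubes (subtopology (configs (B i)) (config_stage (B i) n))
          (\<lambda>s. (\<lambda>i\<in>I. cube_config (B i) (\<gamma> i) (s i)) i)" using i by simp
    qed auto
    have "closedin ?P (factor_config \<gamma> ` (?bad \<gamma>))"
      if \<gamma>: "\<gamma> \<in> \<Gamma>" for \<gamma>
    proof -
      have "openin factor_cubes {s \<in> topspace factor_cubes. merge_configs (factor_config \<gamma> s) \<in> U}"
        by (rule openin_merge_preimage_cubes[OF U]) (use \<gamma> in \<open>auto simp: \<Gamma>_def\<close>)
      then have "closedin factor_cubes (topspace factor_cubes - {s \<in> topspace factor_cubes. merge_configs (factor_config \<gamma> s) \<in> U})"
        by blast
      moreover have "topspace factor_cubes - {s \<in> topspace factor_cubes. merge_configs (factor_config \<gamma> s) \<in> U}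
         = (?bad \<gamma>)" by blast
      ultimately have "compactin factor_cubes (?bad \<gamma>)"
        using cpt closedin_compact_space by fastforce
      from image_compactin[OF this cont[OF \<gamma>]] show ?thesis using hdP compactin_imp_closedin by blast
    qed
    then have "closedin ?P (\<Union>\<gamma>\<in>\<Gamma>. factor_config \<gamma> ` (?bad \<gamma>))"
      using fin by (intro closedin_Union) auto
    moreover have "?K - ?W = (\<Union>\<gamma>\<in>\<Gamma>. factor_config \<gamma> ` (?bad \<gamma>))"
    proof (intro equalityI subsetI)
      fix F assume F: "F \<in> ?K - ?W"
      then have FK: "F \<in> ?K" by blast
      have "F \<in> topspace factor_configs"
        using FK stage_sub by (auto simp: topspace_product_topology PiE_iff)
      then have FU: "merge_configs F \<notin> U" using F by blast
      have "\<forall>i\<in>I. \<exists>gs s. F i = cube_config (B i) gs s \<and> set gs \<subseteq> carrier (B i) \<and> length gs = n \<and> s \<in> cube"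
        using FK by (auto simp: PiE_iff config_stage_def)
      then obtain gs s where gs: "\<And>i. i \<in> I \<Longrightarrow> F i = cube_config (B i) (gs i) (s i) \<and>
          set (gs i) \<subseteq> carrier (B i) \<and> length (gs i) = n \<and> s i \<in> cube" by metis
      define \<gamma> s' where "\<gamma> = restrict gs I" and "s' = restrict s I"
      have "\<gamma> \<in> \<Gamma>" using gs by (auto simp: \<gamma>_def \<Gamma>_def)
      moreover have "s' \<in> topspace factor_cubes" using gs by (auto simp: s'_def factor_cubes_def)
      moreover have "F = factor_config \<gamma> s'"
      proof (rule extensionalityI[of _ I])
        show "F \<in> extensional I" using FK by (simp add: PiE_iff)
      qed (use gs in \<open>auto simp: factor_config_def \<gamma>_def s'_def\<close>)
      ultimately show "F \<in> (\<Union>\<gamma>\<in>\<Gamma>. factor_config \<gamma> ` (?bad \<gamma>))"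
        using FU by blast
    next
      fix F assume "F \<in> (\<Union>\<gamma>\<in>\<Gamma>. factor_config \<gamma> ` (?bad \<gamma>))"
      then obtain \<gamma> s where g: "\<gamma> \<in> \<Gamma>" "s \<in> topspace factor_cubes" "F = factor_config \<gamma> s" "merge_configs F \<notin> U"
        by blast
      then have "F \<in> topspace ?P" using continuous_map_image_subset_topspace[OF cont[OF g(1)]] by blast
      then show "F \<in> ?K - ?W" using g(4) topP by simp
    qed
    ultimately have "closedin ?P (?K - ?W)" by (simp only:)
    then have "openin ?P (topspace ?P - (?K - ?W))" by (rule openin_diff[OF openin_topspace])
    then show "openin ?P (?K \<inter> ?W)" by (simp only: topP Diff_Diff_Int)
  qed
qed

theorem homeomorphic_map_merge_configs:
  "homeomorphic_map factor_configs (configs G) merge_configs"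
proof -
  have "homeomorphic_maps factor_configs (configs G) merge_configs split_config"
    unfolding homeomorphic_maps_def
    using continuous_map_merge_configs continuous_map_split_config merge_split_config split_merge_configs
    by (simp add: topspace_factor_configs topspace_config_space_lists del: topspace_product_topology)
  then show ?thesis using homeomorphic_map_maps by blast
qed

end

section \<open>Sylow subgroups\<close>

text \<open>
  An action given by its laws, without reference to the group of bijections.
\<close>

lemma group_actionI:
  assumes H: "group H"
    and closed: "\<And>h x. \<lbrakk>h \<in> carrier H; x \<in> E\<rbrakk> \<Longrightarrow> f h x \<in> E"
    and one: "\<And>x. x \<in> E \<Longrightarrow> f \<one>\<^bsub>H\<^esub> x = x"
    and mult: "\<And>h k x. \<lbrakk>h \<in> carrier H; k \<in> carrier H; x \<in> E\<rbrakk> \<Longrightarrow> f (h \<otimes>\<^bsub>H\<^esub> k) x = f h (f k x)"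
  shows "group_action H E (\<lambda>h. restrict (f h) E)"
proof -
  interpret H: group H by fact
  have bij: "restrict (f h) E \<in> Bij E" if h: "h \<in> carrier H" for h
  proof -
    have "bij_betw (f h) E E"
    proof (rule bij_betw_byWitness[where f' = "f (inv\<^bsub>H\<^esub> h)"])
      show "\<forall>x\<in>E. f (inv\<^bsub>H\<^esub> h) (f h x) = x"
        using mult[of "inv\<^bsub>H\<^esub> h" h] h one by simp
      show "\<forall>x\<in>E. f h (f (inv\<^bsub>H\<^esub> h) x) = x"
        using mult[of h "inv\<^bsub>H\<^esub> h"] h one by simp
    qed (use closed h in auto)
    then show ?thesis by (simp add: Bij_def)
  qed
  have "(\<lambda>h. restrict (f h) E) \<in> hom H (BijGroup E)"
  proof (rule homI)
    fix h k assume hk: "h \<in> carrier H" "k \<in> carrier H"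
    then show "restrict (f (h \<otimes>\<^bsub>H\<^esub> k)) E = restrict (f h) E \<otimes>\<^bsub>BijGroup E\<^esub> restrict (f k) E"
      using bij closed by (auto simp: BijGroup_def compose_def mult)
  qed (use bij in \<open>auto simp: BijGroup_def\<close>)
  then show ?thesis
    by (simp add: group_action_def group_hom_def group_hom_axioms_def group_BijGroup)
qed

text \<open>
  The moved points are the union of the orbits with more than one point, and the size of an
  orbit of a \<open>p\<close>-group is a power of \<open>p\<close>.
\<close>

lemma (in group_action) card_moved_points:
  assumes p: "prime p" and order: "Coset.order G = p ^ k" and E: "finite E"
  shows "p dvd card {x \<in> E. \<exists>g\<in>carrier G. \<phi> g x \<noteq> x}"
proof -
  \<comment> \<open>The moved points, counted orbit by orbit.\<close>
  let ?M = "{x \<in> E. \<exists>g\<in>carrier G. \<phi> g x \<noteq> x}"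
  have sub: "orbit G \<phi> x \<subseteq> E" if "x \<in> E" for x
    using that element_image by (auto simp: orbit_def)
  have "card ?M = (\<Sum>x\<in>E. if x \<in> ?M then 1 else 0)"
    using E by (simp add: sum.If_cases Int_def conj_commute)
  also have "\<dots> = (\<Sum>orb\<in>orbits G E \<phi>. \<Sum>x\<in>orb. if x \<in> ?M then 1 else 0)"
    by (rule disjoint_sum[OF E, symmetric])
  also have "p dvd \<dots>"
  proof (rule dvd_sum)
    fix orb assume "orb \<in> orbits G E \<phi>"
    then obtain x where x: "x \<in> E" "orb = orbit G \<phi> x" by (auto simp: orbits_def)
    have fin: "finite orb" using sub[OF x(1)] x(2) E finite_subset by blast
    have all: "orbit G \<phi> y = orb" if "y \<in> orb" for y
    proof -
      have "y \<in> E" using that x sub by blast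
      then have "y \<in> orbit G \<phi> y" "orbit G \<phi> y \<in> orbits G E \<phi>"
        using orbit_refl by (auto simp: orbits_def)
      moreover have "orb \<in> orbits G E \<phi>" using x by (auto simp: orbits_def)
      ultimately show ?thesis using disjoint_union[of "orbit G \<phi> y" orb] that by blast
    qed
    show "p dvd (\<Sum>x\<in>orb. if x \<in> ?M then 1 else 0)"
    proof (cases "\<exists>y\<in>orb. y \<notin> ?M")
      case True
      then obtain y where y: "y \<in> orb" "y \<notin> ?M" by blast
      then have "y \<in> E" using x sub by blast
      then have "orbit G \<phi> y = {y}" using y(2) orbit_refl[of y] by (auto simp: orbit_def)
      then have "orb = {y}" using all[OF y(1)] by simp
      then show ?thesis using y by auto
    next
      case False
      then have eq: "(\<Sum>x\<in>orb. if x \<in> ?M then 1 else 0) = card orb" by simp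
      have "card orb dvd p ^ k" using orbit_stabilizer_theorem[OF x(1)] x(2) order by (metis dvd_triv_left)
      then obtain j where j: "card orb = p ^ j" using p by (auto simp: divides_primepow_nat)
      have "j \<noteq> 0"
      proof
        assume "j = 0"
        then obtain y where y: "orb = {y}" using j card_1_singletonE by auto
        then have "y \<in> ?M" using False by blast
        then obtain g where g: "g \<in> carrier G" "\<phi> g y \<noteq> y" by blast
        have "\<phi> g y \<in> orbit G \<phi> y" using g by (auto simp: orbit_def)
        then show False using all[of y] y g by simp
      qed
      then show ?thesis using j eq by (simp add: dvd_power)
    qed
  qed
  finally show ?thesis .
qed

text \<open>
  Under conjugation the fixed points are the central elements. Their number is divisible by
  \<open>p\<close>, so \<open>1\<close> is not the only one.
\<close>

lemma (in group) nontrivial_center_prime_power: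
  assumes p: "prime p" and order: "Coset.order G = p ^ k" "k \<noteq> 0"
  obtains z where "z \<in> carrier G" "z \<noteq> \<one>" "\<And>g. g \<in> carrier G \<Longrightarrow> g \<otimes> z = z \<otimes> g"
proof -
  have "0 < card (carrier G)" using p order by (simp add: Coset.order_def prime_gt_0_nat)
  then have fin: "finite (carrier G)" by (rule card_ge_0_finite)
  let ?c = "\<lambda>g. \<lambda>h \<in> carrier G. g \<otimes> h \<otimes> inv g"
  interpret act: group_action G "carrier G" ?c by (rule action_by_conjugation)
  let ?M = "{x \<in> carrier G. \<exists>g\<in>carrier G. ?c g x \<noteq> x}"
  have "p dvd card ?M" using act.card_moved_points[OF p order(1) fin] .
  moreover have "p dvd card (carrier G)" using order by (simp add: Coset.order_def dvd_power)
  moreover have "card (carrier G - ?M) = card (carrier G) - card ?M"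
    by (rule card_Diff_subset) (use fin in auto)
  ultimately have "p dvd card (carrier G - ?M)" by (simp add: dvd_diff_nat)
  moreover have one: "\<one> \<in> carrier G - ?M" by auto
  moreover have "card (carrier G - ?M) \<noteq> 1" using calculation(1) p by (metis not_prime_unit)
  ultimately have "carrier G - ?M \<noteq> {\<one>}" by (metis is_singletonI is_singleton_altdef)
  then obtain z where z: "z \<in> carrier G - ?M" "z \<noteq> \<one>" using one by blast
  have "g \<otimes> z = z \<otimes> g" if "g \<in> carrier G" for g
    using z that by (auto simp: inv_solve_right')
  then show thesis using that z by blast
qed

text \<open>
  The number of cosets of \<open>P\<close> is prime to \<open>p\<close>, so \<open>S\<close>
  fixes one of them, and a representative of that coset conjugates \<open>S\<close> into
  \<open>P\<close>.
\<close>

lemma (in group) subgroup_prime_power_conjugate_into_sylow: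
  assumes fin: "finite (carrier G)" and p: "prime p"
    and S: "subgroup S G" "card S = p ^ j"
    and P: "subgroup P G" "card P = p ^ multiplicity p (Coset.order G)"
  obtains x where "x \<in> carrier G" "\<And>s. s \<in> S \<Longrightarrow> x \<otimes> s \<otimes> inv x \<in> P"
proof -
  interpret S: subgroup S G by fact
  interpret P: subgroup P G by fact
  interpret GS: group "G\<lparr>carrier := S\<rparr>" using S.subgroup_is_group is_group by blast
  let ?E = "rcosets P"
  have sub: "K \<subseteq> carrier G" if "K \<in> ?E" for K using that P.rcosets_carrier is_group by blast
  \<comment> \<open>Right cosets, so the action uses inverses.\<close>
  have act: "group_action (G\<lparr>carrier := S\<rparr>) ?E (\<lambda>h. restrict (\<lambda>K. K #> inv h) ?E)"
  proof (rule group_actionI)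
    show "group (G\<lparr>carrier := S\<rparr>)" by (rule GS.is_group)
  next
    fix h K assume h: "h \<in> carrier (G\<lparr>carrier := S\<rparr>)" "K \<in> ?E"
    then obtain x where x: "x \<in> carrier G" "K = P #> x" by (auto simp: RCOSETS_def)
    have "P #> x #> inv h = P #> (x \<otimes> inv h)" using h x by (intro coset_mult_assoc) (auto simp: P.subset)
    then show "K #> inv h \<in> ?E" using h x by (auto intro!: rcosetsI simp: P.subset)
  next
    fix K assume "K \<in> ?E"
    then show "K #> inv \<one>\<^bsub>G\<lparr>carrier := S\<rparr>\<^esub> = K" using sub by (simp add: coset_mult_one)
  next
    fix h k K assume h: "h \<in> carrier (G\<lparr>carrier := S\<rparr>)" "k \<in> carrier (G\<lparr>carrier := S\<rparr>)" "K \<in> ?E"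
    then show "K #> inv (h \<otimes>\<^bsub>G\<lparr>carrier := S\<rparr>\<^esub> k) = K #> inv k #> inv h"
      using sub[of K] by (simp add: coset_mult_assoc inv_mult_group)
  qed
  have finE: "finite ?E" using fin by (simp add: RCOSETS_def)
  have card: "card ?E * card P = Coset.order G" by (rule lagrange[OF P(1)])
  have nz: "Coset.order G \<noteq> 0" using fin by (simp add: order_gt_0_iff_finite)
  have "\<not> p dvd card ?E"
  proof
    assume "p dvd card ?E"
    then have "p ^ Suc (multiplicity p (Coset.order G)) dvd Coset.order G"
      using card P(2) by (metis mult_dvd_mono dvd_refl power_Suc)
    then have "Suc (multiplicity p (Coset.order G)) \<le> multiplicity p (Coset.order G)"
      using nz p not_prime_unit[of p] by (intro multiplicity_geI) auto
    then show False by simp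
  qed
  let ?\<phi> = "\<lambda>h. restrict (\<lambda>K. K #> inv h) ?E"
  let ?M = "{x \<in> ?E. \<exists>g\<in>carrier (G\<lparr>carrier := S\<rparr>). ?\<phi> g x \<noteq> x}"
  have "p dvd card ?M"
    using group_action.card_moved_points[OF act p _ finE, of j] S(2) by (simp add: Coset.order_def)
  then have "?M \<noteq> ?E" using \<open>\<not> p dvd card ?E\<close> by metis
  then obtain K where "K \<in> ?E" "K \<notin> ?M" by blast
  then have K: "K \<in> ?E" "\<And>s. s \<in> S \<Longrightarrow> K #> inv s = K" by auto
  then obtain x where x: "x \<in> carrier G" "K = P #> x" by (auto simp: RCOSETS_def)
  have "x \<otimes> s \<otimes> inv x \<in> P" if s: "s \<in> S" for s
  proof -
    have sG: "s \<in> carrier G" "inv s \<in> S" using s S.subset by auto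
    have "P #> x #> inv (inv s) = P #> x" using K(2)[of "inv s"] x sG by simp
    then have "P #> (x \<otimes> s) = P #> x" using sG x by (simp add: coset_mult_assoc P.subset)
    then have "x \<otimes> s \<in> P #> x" using rcos_self[of "x \<otimes> s" P] P(1) x sG by simp
    then obtain q where q: "q \<in> P" "x \<otimes> s = q \<otimes> x" by (auto simp: r_coset_def)
    then have "x \<otimes> s \<otimes> inv x = q" using x P.subset by (simp add: m_assoc subset_iff)
    then show ?thesis using q by simp
  qed
  then show thesis using that x by blast
qed

lemma (in comm_group) pow_index_mem_subgroup:
  assumes fin: "finite (carrier G)" and S: "subgroup S G" and x: "x \<in> carrier G" and n: "(Coset.order G div card S) dvd n"
  shows "x [^] n \<in> S"
proof -
  interpret N: normal S G using S by (simp add: normal_iff_subgroup)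
  interpret Q: group "G Mod S" by (rule N.factorgroup_is_group)
  interpret h: group_hom G "G Mod S" "\<lambda>a. S #> a"
    by unfold_locales (rule N.r_coset_hom_Mod)
  have "card (rcosets S) * card S = Coset.order G" by (rule lagrange[OF S])
  moreover have "card S \<noteq> 0" using fin S by (metis N.one_closed card_eq_0_iff empty_iff finite_subset N.subset)
  ultimately have "Coset.order (G Mod S) = Coset.order G div card S"
    unfolding Coset.order_def[of "G Mod S"] by (metis FactGroup_def nonzero_mult_div_cancel_right partial_object.select_convs(1))
  then obtain m where m: "n = Coset.order (G Mod S) * m" using n by auto
  have "S #> (x [^] n) = (S #> x) [^]\<^bsub>G Mod S\<^esub> n" using h.hom_nat_pow[OF x] .
  also have "\<dots> = \<one>\<^bsub>G Mod S\<^esub>"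
    unfolding m using Q.pow_order_eq_1[OF h.hom_closed[OF x]] Q.nat_pow_pow[OF h.hom_closed[OF x]]
    by (metis Q.nat_pow_one)
  also have "\<dots> = S" by (simp add: FactGroup_def)
  finally show ?thesis using coset_join1[of S "x [^] n"] S x by (simp add: N.subset)
qed

lemma (in group) pow_card_subgroup:
  assumes "subgroup S G" "finite S" "x \<in> S" "card S dvd n"
  shows "x [^] n = \<one>"
proof -
  interpret GS: group "G\<lparr>carrier := S\<rparr>" using assms subgroup.subgroup_is_group is_group by blast
  have "x [^]\<^bsub>G\<lparr>carrier := S\<rparr>\<^esub> card S = \<one>" using GS.pow_order_eq_1[of x] assms by (simp add: Coset.order_def)
  then have "x [^] card S = \<one>" by (simp only: nat_pow_consistent[of x "card S" S])
  moreover have "x \<in> carrier G" using assms subgroup.subset by blast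
  ultimately show ?thesis using assms(4) by (metis dvd_def nat_pow_pow nat_pow_one)
qed

lemma (in group) pow_cong_order:
  assumes "finite (carrier G)" "x \<in> carrier G" "[m = n] (mod Coset.order G)"
  shows "x [^] m = x [^] n"
proof -
  have "x [^] k = x [^] (k mod Coset.order G)" for k
  proof -
    have "x [^] k = x [^] (Coset.order G * (k div Coset.order G) + k mod Coset.order G)" by simp
    also have "\<dots> = x [^] (Coset.order G * (k div Coset.order G)) \<otimes> x [^] (k mod Coset.order G)"
      using assms(2) by (simp add: nat_pow_mult)
    also have "x [^] (Coset.order G * (k div Coset.order G)) = \<one>"
      using assms by (simp add: pow_order_eq_1 flip: nat_pow_pow)
    finally show ?thesis using assms(2) by simp
  qed
  then show ?thesis using assms(3) unfolding cong_def by metis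
qed

text \<open>
  Idempotents of the ring of integers modulo \<open>n\<close>: the exponent \<open>e p\<close>
  is \<open>1\<close> modulo the \<open>p\<close>-part of \<open>n\<close> and \<open>0\<close>
  modulo the other parts.
\<close>

lemma order_decomposition_exponents:
  fixes n :: nat
  assumes n: "n \<noteq> 0"
  obtains e where "\<And>p. p \<in> prime_factors n \<Longrightarrow> n div p ^ multiplicity p n dvd e p"
    "\<And>p. p \<in> prime_factors n \<Longrightarrow> [e p = 1] (mod p ^ multiplicity p n)"
    "[(\<Sum>p\<in>prime_factors n. e p) = 1] (mod n)"
proof -
  have "\<exists>e. n div p ^ multiplicity p n dvd e \<and> [e = 1] (mod p ^ multiplicity p n)"
    if p: "p \<in> prime_factors n" for p
  proof -
    have "p \<noteq> 1" using in_prime_factors_imp_prime[OF p] by auto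
    then have "\<not> p dvd n div p ^ multiplicity p n"
      using n by (intro multiplicity_decompose) auto
    then have "coprime (n div p ^ multiplicity p n) (p ^ multiplicity p n)"
      using p by (simp add: coprime_commute prime_imp_coprime in_prime_factors_iff)
    then obtain y where "[n div p ^ multiplicity p n * y = 1] (mod p ^ multiplicity p n)"
      using cong_solve_coprime_nat One_nat_def by metis
    then show ?thesis by (metis dvd_triv_left)
  qed
  then obtain e where e: "\<And>p. p \<in> prime_factors n \<Longrightarrow> n div p ^ multiplicity p n dvd e p"
    "\<And>p. p \<in> prime_factors n \<Longrightarrow> [e p = 1] (mod p ^ multiplicity p n)" by metis
  have "[(\<Sum>p\<in>prime_factors n. e p) = 1] (mod q ^ multiplicity q n)" if q: "q \<in> prime_factors n" for q
  proof -
    have "q ^ multiplicity q n dvd e p" if p: "p \<in> prime_factors n - {q}" for p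
    proof -
      have "coprime (q ^ multiplicity q n) (p ^ multiplicity p n)"
        using p q by (auto simp: primes_coprime in_prime_factors_iff)
      moreover have "q ^ multiplicity q n dvd p ^ multiplicity p n * (n div p ^ multiplicity p n)"
        by (simp add: multiplicity_dvd)
      ultimately have "q ^ multiplicity q n dvd n div p ^ multiplicity p n"
        by (simp add: coprime_dvd_mult_right_iff)
      then show ?thesis using e(1)[of p] p dvd_trans by blast
    qed
    then have "[(\<Sum>p\<in>prime_factors n - {q}. e p) = 0] (mod q ^ multiplicity q n)"
      unfolding cong_0_iff by (intro dvd_sum)
    then have "[e q + (\<Sum>p\<in>prime_factors n - {q}. e p) = 1 + 0] (mod q ^ multiplicity q n)"
      using e(2)[OF q] by (intro cong_add)
    then show ?thesis using q by (simp add: sum.remove[of _ q])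
  qed
  then have "[(\<Sum>p\<in>prime_factors n. e p) = 1] (mod (\<Prod>q\<in>prime_factors n. q ^ multiplicity q n))"
    by (intro coprime_cong_prod_nat) (auto simp: primes_coprime in_prime_factors_iff)
  then have "[(\<Sum>p\<in>prime_factors n. e p) = 1] (mod n)"
    using n by (simp flip: prime_factorization_nat)
  then show thesis using that e by blast
qed

text \<open>
  In an abelian group powers are endomorphisms, and raising to the idempotent exponents \<open>e
  p\<close> gives the projections onto the Sylow subgroups.
\<close>

lemma (in comm_group) sylow_projections:
  assumes fin: "finite (carrier G)"
    and S: "\<And>p. p \<in> prime_factors (Coset.order G) \<Longrightarrow> subgroup (S p) G"
    and card: "\<And>p. p \<in> prime_factors (Coset.order G) \<Longrightarrow> card (S p) = p ^ multiplicity p (Coset.order G)"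
  obtains \<pi> where "\<And>p. p \<in> prime_factors (Coset.order G) \<Longrightarrow> \<pi> p \<in> hom G (G\<lparr>carrier := S p\<rparr>)"
    "\<And>p x. p \<in> prime_factors (Coset.order G) \<Longrightarrow> x \<in> S p \<Longrightarrow> \<pi> p x = x"
    "\<And>p q x. p \<in> prime_factors (Coset.order G) \<Longrightarrow> q \<in> prime_factors (Coset.order G) \<Longrightarrow> p \<noteq> q \<Longrightarrow> x \<in> S q \<Longrightarrow> \<pi> p x = \<one>"
    "\<And>x. x \<in> carrier G \<Longrightarrow> (\<Otimes>p\<in>prime_factors (Coset.order G). \<pi> p x) = x"
proof -
  let ?n = "Coset.order G"
  have n: "?n \<noteq> 0" using fin by (metis order_gt_0_iff_finite less_numeral_extra(3))
  obtain e where e: "\<And>p. p \<in> prime_factors ?n \<Longrightarrow> ?n div p ^ multiplicity p ?n dvd e p"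
    "\<And>p. p \<in> prime_factors ?n \<Longrightarrow> [e p = 1] (mod p ^ multiplicity p ?n)"
    "[(\<Sum>p\<in>prime_factors ?n. e p) = 1] (mod ?n)"
    using order_decomposition_exponents[OF n] by metis
  have Sc: "x \<in> carrier G" if "p \<in> prime_factors ?n" "x \<in> S p" for p x
    using S that subgroup.subset by blast
  have finS: "finite (S p)" if "p \<in> prime_factors ?n" for p
    using S[OF that] fin by (meson finite_subset subgroup.subset)
  show thesis
  proof
    fix p assume p: "p \<in> prime_factors ?n"
    show "(\<lambda>x. x [^] e p) \<in> hom G (G\<lparr>carrier := S p\<rparr>)"
    proof (rule homI)
      fix x assume "x \<in> carrier G"
      then show "x [^] e p \<in> carrier (G\<lparr>carrier := S p\<rparr>)"
        using pow_index_mem_subgroup[OF fin S[OF p]] card[OF p] e(1)[OF p] by simp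
    qed (simp add: nat_pow_distrib)
  next
    fix p x assume p: "p \<in> prime_factors ?n" "x \<in> S p"
    interpret GS: group "G\<lparr>carrier := S p\<rparr>" using S[OF p(1)] subgroup.subgroup_is_group is_group by blast
    have "x [^]\<^bsub>G\<lparr>carrier := S p\<rparr>\<^esub> e p = x [^]\<^bsub>G\<lparr>carrier := S p\<rparr>\<^esub> (1::nat)"
      by (rule GS.pow_cong_order) (use p finS card e(2) in \<open>auto simp: Coset.order_def\<close>)
    then have "x [^] e p = x [^] (1::nat)" by (simp only: nat_pow_consistent[symmetric])
    then show "x [^] e p = x" using Sc[OF p] by simp
  next
    fix p q x assume pq: "p \<in> prime_factors ?n" "q \<in> prime_factors ?n" "p \<noteq> q" "x \<in> S q"
    have "coprime (q ^ multiplicity q ?n) (p ^ multiplicity p ?n)"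
      using pq by (auto simp: primes_coprime in_prime_factors_iff)
    moreover have "q ^ multiplicity q ?n dvd p ^ multiplicity p ?n * (?n div p ^ multiplicity p ?n)"
      by (simp add: multiplicity_dvd)
    ultimately have "q ^ multiplicity q ?n dvd ?n div p ^ multiplicity p ?n"
      by (simp add: coprime_dvd_mult_right_iff)
    then have "card (S q) dvd e p" using card[OF pq(2)] e(1)[OF pq(1)] dvd_trans by metis
    then show "x [^] e p = \<one>" by (intro pow_card_subgroup[OF S[OF pq(2)] finS[OF pq(2)] pq(4)])
  next
    fix x assume x: "x \<in> carrier G"
    have "finite F \<Longrightarrow> (\<Otimes>p\<in>F. x [^] e p) = x [^] (\<Sum>p\<in>F. e p)" for F
      by (induction F rule: finite_induct) (use x in \<open>auto simp: nat_pow_mult\<close>)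
    then have "(\<Otimes>p\<in>prime_factors ?n. x [^] e p) = x [^] (\<Sum>p\<in>prime_factors ?n. e p)" by simp
    also have "\<dots> = x [^] (1::nat)" by (rule pow_cong_order[OF fin x e(3)])
    finally show "(\<Otimes>p\<in>prime_factors ?n. x [^] e p) = x" using x by simp
  qed
qed

section \<open>Centerless transitively commutative groups\<close>

lemma (in group) inv_cancel_left:
  assumes "x \<in> carrier G" "y \<in> carrier G"
  shows "x \<otimes> (inv x \<otimes> y) = y" "inv x \<otimes> (x \<otimes> y) = y"
  using assms by (simp_all flip: m_assoc)

locale centerless_tc_group = group G for G (structure) +
  assumes finite_carrier: "finite (carrier G)"
    and tc: "transitively_commutative G"
    and centerless: "center G = {\<one>}"
begin

lemma commutator_eq_one_iff:
  assumes "g \<in> carrier G" "h \<in> carrier G"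
  shows "commutator G g h = \<one> \<longleftrightarrow> g \<otimes> h = h \<otimes> g"
proof -
  have "commutator G g h = (g \<otimes> h) \<otimes> inv (h \<otimes> g)"
    using assms by (simp add: commutator_def inv_mult_group m_assoc)
  moreover have "(g \<otimes> h) \<otimes> inv (h \<otimes> g) = \<one> \<longleftrightarrow> g \<otimes> h = h \<otimes> g"
    using assms by (metis inv_equality inv_inv inv_closed m_closed r_inv)
  ultimately show ?thesis by simp
qed

text \<open>
  With a trivial center every element other than \<open>1\<close> is noncentral, so commutation
  is transitive through all of them.
\<close>

lemma commute_trans:
  assumes "x \<in> carrier G" "y \<in> carrier G" "z \<in> carrier G" "y \<noteq> \<one>"
    and "x \<otimes> y = y \<otimes> x" "y \<otimes> z = z \<otimes> y"
  shows "x \<otimes> z = z \<otimes> x"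
proof (cases "x = \<one> \<or> z = \<one>")
  case False
  then have "x \<in> carrier G - center G" "y \<in> carrier G - center G" "z \<in> carrier G - center G"
    using assms centerless by auto
  then show ?thesis
    using tc assms unfolding transitively_commutative_def by (metis commutator_eq_one_iff)
qed (use assms in auto)

lemma subgroup_centralizer:
  assumes "a \<in> carrier G"
  shows "subgroup (centralizer G a) G"
proof (rule subgroupI)
  show "centralizer G a \<noteq> {}" using assms by (auto simp: centralizer_def)
next
  fix g assume "g \<in> centralizer G a"
  then have g: "g \<in> carrier G" "g \<otimes> a = a \<otimes> g" by (auto simp: centralizer_def)
  have "inv g \<otimes> a = inv g \<otimes> (a \<otimes> g) \<otimes> inv g" using g(1) assms by (simp add: m_assoc)
  also have "\<dots> = inv g \<otimes> (g \<otimes> a) \<otimes> inv g" using g by simp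
  also have "\<dots> = a \<otimes> inv g" using g(1) assms by (simp flip: m_assoc)
  finally show "inv g \<in> centralizer G a" using g(1) by (simp add: centralizer_def)
next
  fix g h assume "g \<in> centralizer G a" "h \<in> centralizer G a"
  then show "g \<otimes> h \<in> centralizer G a" using assms
    by (auto simp: centralizer_def) (metis m_assoc)
qed (auto simp: centralizer_def)

lemma centralizer_commute:
  assumes "a \<in> carrier G" "a \<noteq> \<one>" "x \<in> centralizer G a" "y \<in> centralizer G a"
  shows "x \<otimes> y = y \<otimes> x"
  using assms commute_trans[of x a y] by (simp add: centralizer_def)

lemma comm_group_centralizer:
  assumes "a \<in> carrier G" "a \<noteq> \<one>"
  shows "comm_group (G\<lparr>carrier := centralizer G a\<rparr>)"
proof -
  interpret C: group "G\<lparr>carrier := centralizer G a\<rparr>"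
    using subgroup_centralizer[OF assms(1)] subgroup.subgroup_is_group is_group by blast
  show ?thesis by (rule C.group_comm_groupI) (use centralizer_commute[OF assms] in auto)
qed

lemma centralizer_eq:
  assumes "a \<in> carrier G" "a \<noteq> \<one>" "x \<in> centralizer G a" "x \<noteq> \<one>"
  shows "centralizer G x = centralizer G a"
proof -
  have x: "x \<in> carrier G" "x \<otimes> a = a \<otimes> x" using assms(3) by (auto simp: centralizer_def)
  have "g \<otimes> x = x \<otimes> g \<longleftrightarrow> g \<otimes> a = a \<otimes> g" if "g \<in> carrier G" for g
    using commute_trans[of g x a] commute_trans[of g a x] that x assms by metis
  then show ?thesis by (auto simp: centralizer_def)
qed

text \<open>
  Let \<open>S\<close> be a Sylow subgroup of the centralizer, moved into \<open>P\<close> by a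
  conjugation. An element \<open>z \<noteq> 1\<close> of the center of \<open>P\<close> commutes
  with all of \<open>P\<close> and with the image of some \<open>s \<noteq> 1\<close> in
  \<open>S\<close>; so all of \<open>P\<close> commutes with that image. Undoing the conjugation
  puts \<open>P\<close> into the centralizer of \<open>s\<close>, which is that of
  \<open>a\<close>. In particular \<open>P\<close> has the order of \<open>S\<close>.
\<close>

lemma sylow_conjugate_into_centralizer:
  assumes a: "a \<in> carrier G" "a \<noteq> \<one>" and p: "p \<in> prime_factors (card (centralizer G a))"
    and P: "P \<in> sylow_subgroups p G"
  obtains x where "x \<in> carrier G" "\<And>g. g \<in> P \<Longrightarrow> inv x \<otimes> g \<otimes> x \<in> centralizer G a"
    "card P = p ^ multiplicity p (card (centralizer G a))"
proof -
  let ?C = "centralizer G a"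
  have C: "subgroup ?C G" by (rule subgroup_centralizer[OF a(1)])
  interpret C: group "G\<lparr>carrier := ?C\<rparr>" using C subgroup.subgroup_is_group is_group by blast
  have prime: "prime p" and Pg: "subgroup P G" and cardP: "card P = p ^ multiplicity p (Coset.order G)"
    using P by (auto simp: sylow_subgroups_def)
  have finC: "finite ?C" using finite_carrier by (rule rev_finite_subset) (auto simp: centralizer_def)
  have dvdC: "card ?C dvd Coset.order G" using lagrange[OF C] by (metis dvd_triv_right)
  have nz: "Coset.order G \<noteq> 0" using finite_carrier by (metis order_gt_0_iff_finite less_numeral_extra(3))
  have nzC: "card ?C \<noteq> 0" using p by (cases "card ?C = 0") auto
  let ?m = "multiplicity p (card ?C)"
  have m: "?m \<noteq> 0" using p by (auto simp: prime_factors_multiplicity)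
  have mle: "?m \<le> multiplicity p (Coset.order G)" using dvdC nz by (rule dvd_imp_multiplicity_le)
  have "\<exists>S. subgroup S (G\<lparr>carrier := ?C\<rparr>) \<and> card S = p ^ ?m"
    by (rule sylow_thm[OF prime C.is_group, where m = "card ?C div p ^ ?m"])
      (use finC in \<open>auto simp: Coset.order_def multiplicity_dvd\<close>)
  then obtain S where S: "subgroup S (G\<lparr>carrier := ?C\<rparr>)" "card S = p ^ ?m" by blast
  have SG: "subgroup S G" using incl_subgroup[OF C S(1)] .
  have SC: "S \<subseteq> ?C" using subgroup.subset[OF S(1)] by simp
  obtain x where x: "x \<in> carrier G" "\<And>s. s \<in> S \<Longrightarrow> x \<otimes> s \<otimes> inv x \<in> P"
    using subgroup_prime_power_conjugate_into_sylow[OF finite_carrier prime SG S(2) Pg cardP] by metis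
  interpret P: subgroup P G by (rule Pg)
  interpret GP: group "G\<lparr>carrier := P\<rparr>" using P.subgroup_is_group is_group by blast
  have "Coset.order (G\<lparr>carrier := P\<rparr>) = p ^ multiplicity p (Coset.order G)" using cardP by (simp add: Coset.order_def)
  moreover have "multiplicity p (Coset.order G) \<noteq> 0" using m mle by simp
  ultimately obtain z where z: "z \<in> P" "z \<noteq> \<one>" "\<And>g. g \<in> P \<Longrightarrow> g \<otimes> z = z \<otimes> g"
    using GP.nontrivial_center_prime_power[OF prime] by auto
  have "card S \<noteq> 1" using S(2) m prime_gt_1_nat[OF prime] by simp
  moreover have "\<one> \<in> S" using subgroup.one_closed[OF SG] .
  ultimately obtain s where s: "s \<in> S" "s \<noteq> \<one>"
    by (metis is_singletonI' is_singleton_altdef empty_iff)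
  have sG: "s \<in> carrier G" using s SG subgroup.subset by blast
  let ?t = "x \<otimes> s \<otimes> inv x"
  have t: "?t \<in> P" "?t \<noteq> \<one>" using x s sG by (auto simp: inv_solve_right')
  have "inv x \<otimes> g \<otimes> x \<in> ?C" if g: "g \<in> P" for g
  proof -
    have gG: "g \<in> carrier G" "z \<in> carrier G" "?t \<in> carrier G" using g z t by auto
    have "g \<otimes> ?t = ?t \<otimes> g"
      using commute_trans[of g z ?t] gG z g t by metis
    then have "inv x \<otimes> (g \<otimes> ?t) \<otimes> x = inv x \<otimes> (?t \<otimes> g) \<otimes> x" by simp
    moreover have "inv x \<otimes> (g \<otimes> ?t) \<otimes> x = (inv x \<otimes> g \<otimes> x) \<otimes> s"
      using gG x sG by (simp add: m_assoc)
    moreover have "inv x \<otimes> (?t \<otimes> g) \<otimes> x = s \<otimes> (inv x \<otimes> g \<otimes> x)"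
      using gG x sG by (simp add: m_assoc inv_cancel_left)
    ultimately have "(inv x \<otimes> g \<otimes> x) \<otimes> s = s \<otimes> (inv x \<otimes> g \<otimes> x)" by simp
    then have "inv x \<otimes> g \<otimes> x \<in> centralizer G s" using gG x by (simp add: centralizer_def)
    then show ?thesis using centralizer_eq[OF a, of s] s SC by blast
  qed
  moreover have "card P = p ^ ?m"
  proof -
    let ?c = "\<lambda>g. inv x \<otimes> g \<otimes> x"
    have inj: "inj_on ?c P" using x by (auto intro!: inj_onI simp: m_assoc)
    have "subgroup (?c ` P) (G\<lparr>carrier := ?C\<rparr>)"
    proof (rule C.subgroupI)
      show "?c ` P \<subseteq> carrier (G\<lparr>carrier := ?C\<rparr>)" using calculation by auto
      show "?c ` P \<noteq> {}" using P.one_closed by blast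
    next
      fix h assume "h \<in> ?c ` P"
      then obtain g where g: "g \<in> P" "h = ?c g" by blast
      have "inv\<^bsub>G\<lparr>carrier := ?C\<rparr>\<^esub> h = inv h"
        using calculation g by (intro m_inv_consistent[OF C]) auto
      also have "\<dots> = ?c (inv g)" using g x by (simp add: inv_mult_group m_assoc)
      finally show "inv\<^bsub>G\<lparr>carrier := ?C\<rparr>\<^esub> h \<in> ?c ` P" using g by blast
    next
      fix h h' assume "h \<in> ?c ` P" "h' \<in> ?c ` P"
      then obtain g g' where g: "g \<in> P" "h = ?c g" "g' \<in> P" "h' = ?c g'" by blast
      have "h \<otimes> h' = ?c (g \<otimes> g')" using g x by (simp add: m_assoc inv_cancel_left)
      moreover have "g \<otimes> g' \<in> P" using g by simp
      ultimately show "h \<otimes>\<^bsub>G\<lparr>carrier := ?C\<rparr>\<^esub> h' \<in> ?c ` P" by simp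
    qed
    from C.lagrange[OF this] have "card (?c ` P) dvd Coset.order (G\<lparr>carrier := ?C\<rparr>)"
      by (metis dvd_triv_right)
    then have "card (?c ` P) dvd card ?C" by (simp add: Coset.order_def)
    then have "p ^ multiplicity p (Coset.order G) dvd card ?C" using card_image[OF inj] cardP by simp
    then have "multiplicity p (Coset.order G) \<le> ?m"
      using nzC prime not_prime_unit[of p] by (intro multiplicity_geI) auto
    then show ?thesis using mle cardP by simp
  qed
  ultimately show thesis using that x by blast
qed

end

section \<open>Wedges\<close>

lemma topspace_wedge: "topspace (wedge I X b) = insert None (\<Union>i\<in>I. wedge_in b i ` topspace (X i))"
proof
  show "topspace (wedge I X b) \<subseteq> insert None (\<Union>i\<in>I. wedge_in b i ` topspace (X i))"
    using openin_wedge[of I X b "topspace (wedge I X b)"] by simp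
  have "openin (wedge I X b) (insert None (\<Union>i\<in>I. wedge_in b i ` topspace (X i)))"
    unfolding openin_wedge
  proof (intro conjI ballI)
    fix i assume "i \<in> I"
    then have "{x \<in> topspace (X i). wedge_in b i x \<in> insert None (\<Union>i\<in>I. wedge_in b i ` topspace (X i))} = topspace (X i)"
      by auto
    then show "openin (X i) {x \<in> topspace (X i). wedge_in b i x \<in> insert None (\<Union>i\<in>I. wedge_in b i ` topspace (X i))}"
      by simp
  qed simp
  then show "insert None (\<Union>i\<in>I. wedge_in b i ` topspace (X i)) \<subseteq> topspace (wedge I X b)"
    by (rule openin_subset)
qed

text \<open>
  A union of spaces that meet only in a common point, with the final topology from the
  inclusions, is their wedge. The maps \<open>f i\<close> identify the summands with the pieces.
\<close>

theorem wedge_homeomorphic_space: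
  fixes Z :: "'z topology" and Y :: "'i \<Rightarrow> 'y topology"
  assumes base: "\<And>i. i \<in> I \<Longrightarrow> f i (b i) = z"
    and z: "z \<in> topspace Z"
    and inj: "\<And>i. i \<in> I \<Longrightarrow> inj_on (f i) (insert (b i) (topspace (Y i)))"
    and disj: "\<And>i j. \<lbrakk>i \<in> I; j \<in> I; i \<noteq> j\<rbrakk> \<Longrightarrow> f i ` topspace (Y i) \<inter> f j ` topspace (Y j) \<subseteq> {z}"
    and cover: "topspace Z = insert z (\<Union>i\<in>I. f i ` topspace (Y i))"
    and coherent: "\<And>U. U \<subseteq> topspace Z \<Longrightarrow>
      openin Z U \<longleftrightarrow> (\<forall>i\<in>I. openin (Y i) {y \<in> topspace (Y i). f i y \<in> U})"
  shows "wedge I Y b homeomorphic_space Z"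
proof -
  define h where "h w = (case w of None \<Rightarrow> z | Some (i, y) \<Rightarrow> f i y)" for w
  have h_in: "h (wedge_in b i y) = f i y" if "i \<in> I" for i y
    using base[OF that] by (simp add: h_def wedge_in_def)
  have hN: "h None = z" by (simp add: h_def)
  have inj_h: "inj_on h (topspace (wedge I Y b))"
  proof (rule inj_onI)
    have neq: "f i y \<noteq> z" if "i \<in> I" "y \<in> topspace (Y i)" "y \<noteq> b i" for i y
      using inj[OF that(1)] base[OF that(1)] that by (metis inj_onD insertCI)
    fix v w assume "v \<in> topspace (wedge I Y b)" "w \<in> topspace (wedge I Y b)" and eq: "h v = h w"
    then have v: "v = None \<or> (\<exists>i y. i \<in> I \<and> y \<in> topspace (Y i) \<and> y \<noteq> b i \<and> v = Some (i, y))"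
      and w: "w = None \<or> (\<exists>i y. i \<in> I \<and> y \<in> topspace (Y i) \<and> y \<noteq> b i \<and> w = Some (i, y))"
      by (auto simp: topspace_wedge wedge_in_def)
    show "v = w"
    proof (cases "v = None \<or> w = None")
      case True
      then show ?thesis using v w eq neq unfolding h_def by (auto; metis)
    next
      case False
      then obtain i y j y' where ij: "i \<in> I" "y \<in> topspace (Y i)" "y \<noteq> b i" "v = Some (i, y)"
        "j \<in> I" "y' \<in> topspace (Y j)" "y' \<noteq> b j" "w = Some (j, y')" using v w by blast
      have e: "f i y = f j y'" using eq ij by (simp add: h_def)
      have "i = j"
      proof (rule ccontr)
        assume "i \<noteq> j"
        then have "f i y \<in> {z}" using disj[of i j] ij e by blast
        then show False using neq ij by blast
      qed
      then show ?thesis using e ij inj[of i] by (auto dest: inj_onD)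
    qed
  qed
  have image: "h ` topspace (wedge I Y b) = topspace Z"
  proof -
    have "h ` topspace (wedge I Y b) = insert z (\<Union>i\<in>I. (\<lambda>y. h (wedge_in b i y)) ` topspace (Y i))"
      by (simp add: topspace_wedge hN image_UN image_image)
    also have "\<dots> = insert z (\<Union>i\<in>I. f i ` topspace (Y i))" using h_in by simp
    finally show ?thesis using cover by simp
  qed
  have "quotient_map (wedge I Y b) Z h"
    unfolding quotient_map_def
  proof (intro conjI allI impI image)
    fix U assume U: "U \<subseteq> topspace Z"
    let ?V = "{w \<in> topspace (wedge I Y b). h w \<in> U}"
    have "{y \<in> topspace (Y i). wedge_in b i y \<in> ?V} = {y \<in> topspace (Y i). f i y \<in> U}" if "i \<in> I" for i
      using that h_in[OF that] by (auto simp: topspace_wedge)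
    then have "openin (wedge I Y b) ?V \<longleftrightarrow> (\<forall>i\<in>I. openin (Y i) {y \<in> topspace (Y i). f i y \<in> U})"
      unfolding openin_wedge by (auto simp: topspace_wedge)
    then show "openin (wedge I Y b) ?V \<longleftrightarrow> openin Z U" using coherent[OF U] by simp
  qed
  then have "homeomorphic_map (wedge I Y b) Z h" using inj_h by (simp add: homeomorphic_map_def)
  then show ?thesis by (rule homeomorphic_map_imp_homeomorphic_space)
qed

section \<open>The decomposition of B(2,G)\<close>

definition commuting_lists :: "('a, 'b) monoid_scheme \<Rightarrow> 'a list set" where
  "commuting_lists G = {gs \<in> lists (carrier G). \<forall>g\<in>set gs. \<forall>h\<in>set gs. g \<otimes>\<^bsub>G\<^esub> h = h \<otimes>\<^bsub>G\<^esub> g}"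

lemma nerve_eq_tuple_complex: "nerve G = tuple_complex G (lists (carrier G))"
  by (auto simp: nerve_def tuple_complex_def fun_eq_iff in_lists_conv_set)

lemma commuting_tuples_eq_tuple_complex: "commuting_tuples G = tuple_complex G (commuting_lists G)"
  by (auto simp: commuting_tuples_def tuple_complex_def commuting_lists_def fun_eq_iff in_lists_conv_set)

lemma set_tuple_face:
  assumes "length gs = Suc n" "i \<le> Suc n"
  shows "set (tuple_face G (Suc n) i gs) \<subseteq> set gs \<union> {g \<otimes>\<^bsub>G\<^esub> h |g h. g \<in> set gs \<and> h \<in> set gs}"
proof -
  consider "i = 0" | "i = Suc n" | "0 < i" "i \<le> n" using assms(2) by linarith
  then show ?thesis
  proof cases
    case 3
    then have "gs ! (i - 1) \<in> set gs" "gs ! i \<in> set gs" using assms by auto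
    then show ?thesis using 3 by (auto simp: tuple_face_def dest: in_set_takeD in_set_dropD)
  next
    case 1
    then show ?thesis using assms(1) by (cases gs) (auto simp: tuple_face_def)
  qed (auto simp: tuple_face_def dest: in_set_butlastD)
qed

lemma (in monoid) tuple_family_lists: "tuple_family G (lists (carrier G))"
proof unfold_locales
  fix gs n i assume "gs \<in> lists (carrier G)" "length gs = Suc n" "i \<le> Suc n"
  then show "tuple_face G (Suc n) i gs \<in> lists (carrier G)"
    using set_tuple_face[of gs n i G] by fastforce
qed auto

lemma (in monoid) tuple_family_commuting_lists: "tuple_family G (commuting_lists G)"
proof unfold_locales
  fix gs n i assume gs: "gs \<in> commuting_lists G" and n: "length gs = Suc n" "i \<le> Suc n"
  define M where "M = set gs \<union> {g \<otimes> h |g h. g \<in> set gs \<and> h \<in> set gs}"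
  have c: "g \<in> carrier G" if "g \<in> set gs" for g using gs that by (auto simp: commuting_lists_def)
  have comm: "g \<otimes> h = h \<otimes> g" if "g \<in> set gs" "h \<in> set gs" for g h
    using gs that by (auto simp: commuting_lists_def)
  have comm1: "x \<otimes> h = h \<otimes> x" if "x \<in> M" "h \<in> set gs" for x h
  proof -
    have "g \<otimes> g' \<otimes> h = h \<otimes> (g \<otimes> g')" if "g \<in> set gs" "g' \<in> set gs" for g g'
      using that \<open>h \<in> set gs\<close> c comm by (metis m_assoc)
    then show ?thesis using that comm by (auto simp: M_def)
  qed
  have cM: "x \<in> carrier G" if "x \<in> M" for x using that c by (auto simp: M_def)
  have "x \<otimes> y = y \<otimes> x" if "x \<in> M" "y \<in> M" for x y
  proof -
    have "x \<otimes> (g \<otimes> g') = g \<otimes> g' \<otimes> x" if "g \<in> set gs" "g' \<in> set gs" for g g'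
      using that \<open>x \<in> M\<close> c cM comm1 by (metis m_assoc)
    moreover have "y \<in> set gs \<or> (\<exists>g g'. y = g \<otimes> g' \<and> g \<in> set gs \<and> g' \<in> set gs)"
      using that(2) by (auto simp: M_def)
    ultimately show ?thesis using comm1[OF that(1)] by blast
  qed
  moreover have "set (tuple_face G (Suc n) i gs) \<subseteq> M" using set_tuple_face[OF n] by (simp add: M_def)
  ultimately show "tuple_face G (Suc n) i gs \<in> commuting_lists G"
    using cM by (auto simp: commuting_lists_def subset_iff)
qed (auto simp: commuting_lists_def)

lemma config_carrier_update [simp]: "config (G\<lparr>carrier := H\<rparr>) = config G"
  by (simp add: config_def list_prod_def fun_eq_iff)

lemma simplex_config_carrier_update [simp]: "simplex_config (G\<lparr>carrier := H\<rparr>) = simplex_config G"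
  by (simp add: simplex_config_def fun_eq_iff)

lemma simplex_config_Nil: "simplex_config G [] t = (\<lambda>u. \<one>\<^bsub>G\<^esub>)"
  by (simp add: simplex_config_def config_def list_prod_def fun_eq_iff)

lemma (in monoid) simplex_config_trivial:
  assumes "set gs \<subseteq> {\<one>}"
  shows "simplex_config G gs t = (\<lambda>u. \<one>)"
proof
  fix u
  have "list_prod G xs = \<one>" if "set xs \<subseteq> {\<one>}" for xs
    using that by (induction xs) (auto simp: list_prod_def)
  moreover have "set (map fst (filter (\<lambda>p. snd p = u) (zip gs (partial_sums (length gs) t)))) \<subseteq> {\<one>}"
    using assms by (auto dest: set_zip_leftD)
  ultimately show "simplex_config G gs t u = \<one>" by (simp add: simplex_config_def config_def)
qed

lemma (in monoid) classifying_space_homeomorphic_configs: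
  obtains h where "homeomorphic_map (classifying_space G) (configs G) h"
    "classifying_space_base G \<in> topspace (classifying_space G)"
    "h (classifying_space_base G) = (\<lambda>u. \<one>)"
proof -
  interpret tuple_family G "lists (carrier G)" by (rule tuple_family_lists)
  obtain h where h: "homeomorphic_map (realization (tuple_complex G (lists (carrier G)))) (configs G) h"
    "\<And>gs t. gs \<in> lists (carrier G) \<Longrightarrow> t \<in> standard_simplex (length gs) \<Longrightarrow>
       h (realization_class (tuple_complex G (lists (carrier G))) (length gs, gs, t)) = simplex_config G gs t"
    using realization_homeomorphic_config_space by metis
  have pt: "(\<lambda>i::nat. if i = 0 then 1 else 0 :: real) \<in> standard_simplex (length ([] :: 'a list))" by simp
  have "h (classifying_space_base G) = (\<lambda>u. \<one>)"
    using h(2)[OF _ pt] by (simp add: classifying_space_base_def nerve_eq_tuple_complex simplex_config_Nil)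
  moreover have "(0, [], \<lambda>i. if i = 0 then 1 else 0) \<in> topspace (simplex_sum (tuple_complex G (lists (carrier G))))"
    using pt unfolding topspace_simplex_sum by force
  then have "classifying_space_base G \<in> topspace (classifying_space G)"
    by (simp add: classifying_space_base_def classifying_space_def nerve_eq_tuple_complex realization_def
        topspace_quotient_topology flip: simplex_sum_def)
  ultimately show thesis using that h(1) by (simp add: classifying_space_def nerve_eq_tuple_complex)
qed

lemma continuous_map_product_map:
  assumes "\<And>i. i \<in> I \<Longrightarrow> continuous_map (X i) (Y i) (f i)"
  shows "continuous_map (product_topology X I) (product_topology Y I) (\<lambda>x. \<lambda>i\<in>I. f i (x i))"
  unfolding continuous_map_componentwise
proof (intro conjI ballI)
  fix i assume i: "i \<in> I"
  have "continuous_map (product_topology X I) (X i) (\<lambda>x. x i)"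
    by (rule continuous_map_product_projection[OF i])
  then have "continuous_map (product_topology X I) (Y i) (f i \<circ> (\<lambda>x. x i))"
    using assms[OF i] by (rule continuous_map_compose)
  then show "continuous_map (product_topology X I) (Y i) (\<lambda>x. (\<lambda>i\<in>I. f i (x i)) i)"
    using i by (simp add: o_def)
qed auto

context abelian_decomposition
begin

text \<open>
  Besides the homeomorphism this records where the base point goes, as needed for wedges.
\<close>

theorem product_classifying_spaces_homeomorphic_configs:
  obtains f where
    "homeomorphic_map (product_topology (\<lambda>i. classifying_space (B i)) I) (configs G) f"
    "(\<lambda>i\<in>I. classifying_space_base (B i)) \<in> topspace (product_topology (\<lambda>i. classifying_space (B i)) I)"
    "f (\<lambda>i\<in>I. classifying_space_base (B i)) = (\<lambda>u. \<one>)"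
proof -
  have "\<exists>h. homeomorphic_map (classifying_space (B i)) (configs (B i)) h \<and>
      classifying_space_base (B i) \<in> topspace (classifying_space (B i)) \<and>
      h (classifying_space_base (B i)) = (\<lambda>u. \<one>\<^bsub>B i\<^esub>)" if i: "i \<in> I" for i
  proof -
    interpret Bi: comm_monoid "B i" by (rule factor_monoid[OF i])
    show ?thesis using Bi.classifying_space_homeomorphic_configs by metis
  qed
  then obtain h where h: "\<And>i. i \<in> I \<Longrightarrow> homeomorphic_map (classifying_space (B i)) (configs (B i)) (h i)"
    "\<And>i. i \<in> I \<Longrightarrow> classifying_space_base (B i) \<in> topspace (classifying_space (B i))"
    "\<And>i. i \<in> I \<Longrightarrow> h i (classifying_space_base (B i)) = (\<lambda>u. \<one>\<^bsub>B i\<^esub>)" by metis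
  let ?Y = "product_topology (\<lambda>i. classifying_space (B i)) I"
  let ?b = "\<lambda>i\<in>I. classifying_space_base (B i)"
  obtain k where k: "\<And>i. i \<in> I \<Longrightarrow> homeomorphic_maps (classifying_space (B i)) (configs (B i)) (h i) (k i)"
    using h(1) unfolding homeomorphic_map_maps by metis
  define H where "H y = (\<lambda>i\<in>I. h i (y i))" for y
  define K where "K y = (\<lambda>i\<in>I. k i (y i))" for y
  have kh: "k i (h i y) = y" if "i \<in> I" "y \<in> topspace (classifying_space (B i))" for i y
    using k[OF that(1)] that(2) by (auto simp: homeomorphic_maps_def)
  have hk: "h i (k i y) = y" if "i \<in> I" "y \<in> topspace (configs (B i))" for i y
    using k[OF that(1)] that(2) by (auto simp: homeomorphic_maps_def)
  have "homeomorphic_maps ?Y factor_configs H K"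
    unfolding homeomorphic_maps_def
  proof (intro conjI ballI)
    show "continuous_map ?Y factor_configs H" "continuous_map factor_configs ?Y K"
      unfolding H_def K_def by (rule continuous_map_product_map; use k in \<open>auto simp: homeomorphic_maps_def\<close>)+
    show "K (H y) = y" if "y \<in> topspace ?Y" for y
      by (rule extensionalityI[of _ I]) (use that kh in \<open>auto simp: H_def K_def PiE_iff\<close>)
    show "H (K y) = y" if "y \<in> topspace factor_configs" for y
      by (rule extensionalityI[of _ I]) (use that hk in \<open>auto simp: H_def K_def PiE_iff\<close>)
  qed
  then have "homeomorphic_map ?Y factor_configs H" using homeomorphic_map_maps by blast
  then have "homeomorphic_map ?Y (configs G) (merge_configs \<circ> H)"
    using homeomorphic_map_merge_configs by (rule homeomorphic_map_compose)
  moreover have "?b \<in> topspace ?Y" using h(2) by auto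
  moreover have "(merge_configs \<circ> H) ?b = (\<lambda>u. \<one>)"
  proof
    fix u
    have "(\<Otimes>i\<in>I. \<iota> i (H ?b i u)) = \<one>"
      by (rule finprod_one_eqI) (simp add: H_def h(3) \<iota>_one)
    then show "(merge_configs \<circ> H) ?b u = \<one>" by (simp add: merge_configs_def)
  qed
  ultimately show thesis using that by blast
qed

end

context centerless_tc_group
begin

text \<open>
  The factor with index \<open>p\<close> is the given Sylow subgroup \<open>P p\<close> of
  \<open>G\<close>, which is included by a conjugation that moves it into the centralizer.
\<close>

lemma abelian_decomposition_centralizer:
  assumes a: "a \<in> carrier G" "a \<noteq> \<one>"
    and P: "\<And>p. p \<in> prime_factors (card (centralizer G a)) \<Longrightarrow> P p \<in> sylow_subgroups p G"
  obtains \<iota> \<rho> where "abelian_decomposition (G\<lparr>carrier := centralizer G a\<rparr>)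
    (prime_factors (card (centralizer G a))) (\<lambda>p. G\<lparr>carrier := P p\<rparr>) \<iota> \<rho>"
proof -
  let ?C = "centralizer G a" and ?I = "prime_factors (card (centralizer G a))"
  let ?A = "G\<lparr>carrier := centralizer G a\<rparr>"
  interpret A: comm_group ?A by (rule comm_group_centralizer[OF a])
  have "\<exists>x. x \<in> carrier G \<and> (\<forall>g\<in>P p. inv x \<otimes> g \<otimes> x \<in> ?C) \<and> card (P p) = p ^ multiplicity p (card ?C)"
    if "p \<in> ?I" for p using sylow_conjugate_into_centralizer[OF a that P[OF that]] by metis
  then obtain x where x: "\<And>p. p \<in> ?I \<Longrightarrow> x p \<in> carrier G"
    "\<And>p g. p \<in> ?I \<Longrightarrow> g \<in> P p \<Longrightarrow> inv (x p) \<otimes> g \<otimes> x p \<in> ?C"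
    "\<And>p. p \<in> ?I \<Longrightarrow> card (P p) = p ^ multiplicity p (card ?C)" by metis
  have Psub: "subgroup (P p) G" if "p \<in> ?I" for p using P[OF that] by (simp add: sylow_subgroups_def)
  have PG: "g \<in> carrier G" if "p \<in> ?I" "g \<in> P p" for p g using Psub that subgroup.subset by blast
  have CG: "?C \<subseteq> carrier G" by (auto simp: centralizer_def)
  have finC: "finite ?C" using CG finite_carrier finite_subset by blast
  define \<iota> where "\<iota> p g = inv (x p) \<otimes> g \<otimes> x p" for p g
  have \<iota>_mult: "\<iota> p (g \<otimes> h) = \<iota> p g \<otimes> \<iota> p h" if "p \<in> ?I" "g \<in> carrier G" "h \<in> carrier G" for p g h
  proof -
    show ?thesis using that x(1)[OF that(1)] by (simp add: \<iota>_def m_assoc inv_cancel_left)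
  qed
  have unconj: "x p \<otimes> \<iota> p g \<otimes> inv (x p) = g" if "p \<in> ?I" "g \<in> carrier G" for p g
  proof -
    show ?thesis using that x(1)[OF that(1)] by (simp add: \<iota>_def m_assoc inv_cancel_left)
  qed
  have \<iota>_hom: "\<iota> p \<in> hom (G\<lparr>carrier := P p\<rparr>) ?A" if "p \<in> ?I" for p
    by (rule homI) (use x(2) that \<iota>_mult PG in \<open>auto simp: \<iota>_def[symmetric]\<close>)
  have Pgroup: "group (G\<lparr>carrier := P p\<rparr>)" if "p \<in> ?I" for p
    using Psub[OF that] subgroup.subgroup_is_group is_group by blast
  define S where "S p = \<iota> p ` P p" for p
  have inj: "inj_on (\<iota> p) (P p)" if "p \<in> ?I" for p
    using unconj[OF that] PG[OF that] by (metis inj_onI)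
  have S: "subgroup (S p) ?A" "card (S p) = p ^ multiplicity p (Coset.order ?A)" if "p \<in> ?I" for p
  proof -
    interpret h: group_hom "G\<lparr>carrier := P p\<rparr>" ?A "\<iota> p"
      using Pgroup[OF that] \<iota>_hom[OF that] A.is_group by (simp add: group_hom_def group_hom_axioms_def)
    show "subgroup (S p) ?A" using h.img_is_subgroup by (simp add: S_def)
    show "card (S p) = p ^ multiplicity p (Coset.order ?A)"
      using card_image[OF inj[OF that]] x(3)[OF that] by (simp add: S_def Coset.order_def)
  qed
  have orderA: "Coset.order ?A = card ?C" by (simp add: Coset.order_def)
  obtain \<pi> where \<pi>: "\<And>p. p \<in> ?I \<Longrightarrow> \<pi> p \<in> hom ?A (?A\<lparr>carrier := S p\<rparr>)"
    "\<And>p y. p \<in> ?I \<Longrightarrow> y \<in> S p \<Longrightarrow> \<pi> p y = y"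
    "\<And>p q y. p \<in> ?I \<Longrightarrow> q \<in> ?I \<Longrightarrow> p \<noteq> q \<Longrightarrow> y \<in> S q \<Longrightarrow> \<pi> p y = \<one>"
    "\<And>y. y \<in> ?C \<Longrightarrow> (\<Otimes>\<^bsub>?A\<^esub>p\<in>?I. \<pi> p y) = y"
    using A.sylow_projections[of S] S finC by (auto simp: orderA)
  have \<pi>S: "\<pi> p y \<in> S p" if "p \<in> ?I" "y \<in> ?C" for p y using \<pi>(1)[OF that(1)] that(2) by (auto simp: hom_def)
  have SG: "y \<in> carrier G" if "p \<in> ?I" "y \<in> S p" for p y
    using S(1)[OF that(1)] that(2) CG subgroup.subset by fastforce
  have \<pi>G: "\<pi> p y \<in> carrier G" if "p \<in> ?I" "y \<in> ?C" for p y using SG \<pi>S that by blast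
  define \<rho> where "\<rho> p y = x p \<otimes> \<pi> p y \<otimes> inv (x p)" for p y
  have \<rho>P: "\<rho> p y \<in> P p \<and> \<iota> p (\<rho> p y) = \<pi> p y" if "p \<in> ?I" "y \<in> ?C" for p y
  proof -
    have "\<pi> p y \<in> S p" by (rule \<pi>S[OF that])
    then obtain g where g: "g \<in> P p" "\<pi> p y = \<iota> p g" by (auto simp: S_def)
    then have "\<rho> p y = g" using unconj[OF that(1) PG[OF that(1) g(1)]] by (simp add: \<rho>_def)
    then show ?thesis using g by simp
  qed
  have "abelian_decomposition ?A ?I (\<lambda>p. G\<lparr>carrier := P p\<rparr>) \<iota> \<rho>"
  proof (intro abelian_decomposition.intro abelian_decomposition_axioms.intro)
    show "comm_group ?A" by (rule comm_group_centralizer[OF a])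
    show "finite ?I" by simp
  next
    fix p assume p: "p \<in> ?I"
    interpret Pp: group "G\<lparr>carrier := P p\<rparr>" by (rule Pgroup[OF p])
    show "comm_group (G\<lparr>carrier := P p\<rparr>)"
    proof (rule Pp.group_comm_groupI)
      fix g h assume gh: "g \<in> carrier (G\<lparr>carrier := P p\<rparr>)" "h \<in> carrier (G\<lparr>carrier := P p\<rparr>)"
      then have c: "g \<in> carrier G" "h \<in> carrier G" using PG[OF p] by auto
      have "\<iota> p g \<otimes> \<iota> p h = \<iota> p h \<otimes> \<iota> p g"
        using x(2)[OF p] gh by (intro centralizer_commute[OF a]) (auto simp: \<iota>_def)
      then have "\<iota> p (g \<otimes> h) = \<iota> p (h \<otimes> g)" using \<iota>_mult[OF p] c by simp
      then have "g \<otimes> h = h \<otimes> g" using unconj[OF p] c by (metis m_closed)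
      then show "g \<otimes>\<^bsub>G\<lparr>carrier := P p\<rparr>\<^esub> h = h \<otimes>\<^bsub>G\<lparr>carrier := P p\<rparr>\<^esub> g" by simp
    qed
    show "finite (carrier (G\<lparr>carrier := P p\<rparr>))"
      using subgroup.subset[OF Psub[OF p]] finite_carrier finite_subset by auto
    show "\<iota> p \<in> hom (G\<lparr>carrier := P p\<rparr>) ?A" by (rule \<iota>_hom[OF p])
    show "\<rho> p \<in> hom ?A (G\<lparr>carrier := P p\<rparr>)"
    proof (rule homI)
      fix y assume "y \<in> carrier ?A"
      then show "\<rho> p y \<in> carrier (G\<lparr>carrier := P p\<rparr>)" using \<rho>P[OF p] by simp
    next
      fix y z assume yz: "y \<in> carrier ?A" "z \<in> carrier ?A"
      then have c: "y \<in> ?C" "z \<in> ?C" "y \<otimes> z \<in> ?C" using A.m_closed by auto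
      have "\<iota> p (\<rho> p (y \<otimes> z)) = \<pi> p (y \<otimes> z)" using \<rho>P[OF p c(3)] by simp
      also have "\<dots> = \<pi> p y \<otimes> \<pi> p z" using hom_mult[OF \<pi>(1)[OF p] yz] by simp
      also have "\<dots> = \<iota> p (\<rho> p y \<otimes> \<rho> p z)"
        using \<rho>P[OF p c(1)] \<rho>P[OF p c(2)] PG[OF p] by (simp add: \<iota>_mult[OF p])
      finally have "\<rho> p (y \<otimes> z) = \<rho> p y \<otimes> \<rho> p z"
        using inj[OF p] \<rho>P[OF p] c subgroup.m_closed[OF Psub[OF p]] by (meson inj_onD)
      then show "\<rho> p (y \<otimes>\<^bsub>?A\<^esub> z) = \<rho> p y \<otimes>\<^bsub>G\<lparr>carrier := P p\<rparr>\<^esub> \<rho> p z" by simp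
    qed
    fix g assume g: "g \<in> carrier (G\<lparr>carrier := P p\<rparr>)"
    then have "\<iota> p g \<in> S p" by (auto simp: S_def)
    then show "\<rho> p (\<iota> p g) = g" using \<pi>(2)[OF p] unconj[OF p] PG[OF p] g by (simp add: \<rho>_def)
  next
    fix p q g assume pq: "p \<in> ?I" "q \<in> ?I" "p \<noteq> q" and g: "g \<in> carrier (G\<lparr>carrier := P p\<rparr>)"
    then have "\<iota> p g \<in> S p" by (auto simp: S_def)
    then have "\<pi> q (\<iota> p g) = \<one>" using \<pi>(3)[OF pq(2,1)] pq(3) by simp
    then show "\<rho> q (\<iota> p g) = \<one>\<^bsub>G\<lparr>carrier := P q\<rparr>\<^esub>" using x(1)[OF pq(2)] by (simp add: \<rho>_def)
  next
    fix y assume y: "y \<in> carrier ?A"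
    have "(\<Otimes>\<^bsub>?A\<^esub>p\<in>?I. \<iota> p (\<rho> p y)) = (\<Otimes>\<^bsub>?A\<^esub>p\<in>?I. \<pi> p y)"
    proof (rule A.finprod_cong')
      show "(\<lambda>p. \<pi> p y) \<in> ?I \<rightarrow> carrier ?A"
      proof
        fix p assume p: "p \<in> ?I"
        then show "\<pi> p y \<in> carrier ?A" using \<pi>S[OF p] subgroup.subset[OF S(1)[OF p]] y by auto
      qed
      show "\<iota> p (\<rho> p y) = \<pi> p y" if "p \<in> ?I" for p using \<rho>P[OF that] y by simp
    qed simp
    then show "(\<Otimes>\<^bsub>?A\<^esub>p\<in>?I. \<iota> p (\<rho> p y)) = y" using \<pi>(4) y by simp
  qed
  then show thesis by (rule that)
qed

text \<open>
  If two of the centralizers had a common element other than \<open>1\<close>, they would both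
  be its centralizer, and one of them could be removed from the cover. For the trivial group and
  the empty family all three properties hold trivially.
\<close>

lemma minimal_cover_properties:
  assumes cover: "minimal_centralizer_cover G k a"
  shows "\<And>i. i \<in> {1..k} \<Longrightarrow> a i \<in> carrier G \<and> a i \<noteq> \<one>"
    and "\<And>i j. i \<in> {1..k} \<Longrightarrow> j \<in> {1..k} \<Longrightarrow> i \<noteq> j \<Longrightarrow> centralizer G (a i) \<inter> centralizer G (a j) = {\<one>}"
    and "\<And>gs. gs \<in> commuting_lists G \<Longrightarrow> set gs \<subseteq> {\<one>} \<or> (\<exists>i\<in>{1..k}. set gs \<subseteq> centralizer G (a i))"
proof -
  consider "carrier G = {\<one>}" "k = 0" | "centralizer_cover G k a" "\<And>m b. centralizer_cover G m b \<Longrightarrow> k \<le> m"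
    using cover by (auto simp: minimal_centralizer_cover_def)
  then have "(\<forall>i \<in> {1..k}. a i \<in> carrier G \<and> a i \<noteq> \<one>) \<and>
    (\<forall>i\<in>{1..k}. \<forall>j\<in>{1..k}. i \<noteq> j \<longrightarrow> centralizer G (a i) \<inter> centralizer G (a j) = {\<one>}) \<and>
    (\<forall>gs \<in> commuting_lists G. set gs \<subseteq> {\<one>} \<or> (\<exists>i\<in>{1..k}. set gs \<subseteq> centralizer G (a i)))"
  proof cases
    case 1
    then show ?thesis by (auto simp: commuting_lists_def)
  next
    case 2
    have a: "a i \<in> carrier G \<and> a i \<noteq> \<one>" if "i \<in> {1..k}" for i
      using 2(1) that centerless by (auto simp: centralizer_cover_def)
    have U: "carrier G = (\<Union>i\<in>{1..k}. centralizer G (a i))" using 2(1) by (simp add: centralizer_cover_def)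
    have one: "\<one> \<in> centralizer G (a i)" if "i \<in> {1..k}" for i using a[OF that] by (simp add: centralizer_def)
    have disj: "centralizer G (a i) \<inter> centralizer G (a j) = {\<one>}" if ij: "i \<in> {1..k}" "j \<in> {1..k}" "i \<noteq> j" for i j
    proof (rule ccontr)
      assume "\<not> ?thesis"
      then obtain x where x: "x \<in> centralizer G (a i)" "x \<in> centralizer G (a j)" "x \<noteq> \<one>"
        using one ij by blast
      then have eq: "centralizer G (a i) = centralizer G (a j)"
        using centralizer_eq[of "a i" x] centralizer_eq[of "a j" x] a ij by simp
      \<comment> \<open>The cover without its member number \<open>j\<close>.\<close>
      define b where "b m = (if m < j then a m else a (Suc m))" for m
      have "centralizer_cover G (k - 1) b"
        unfolding centralizer_cover_def
      proof (intro conjI ballI)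
        fix m assume "m \<in> {1..k - 1}"
        then have "m \<in> {1..k}" "Suc m \<in> {1..k}" by auto
        then show "b m \<in> carrier G - center G" using a[of m] a[of "Suc m"] centerless by (simp add: b_def)
      next
        have "\<exists>m\<in>{1..k - 1}. centralizer G (b m) = centralizer G (a l)" if l: "l \<in> {1..k}" for l
        proof -
          have *: "\<exists>m\<in>{1..k - 1}. centralizer G (b m) = centralizer G (a l)" if "l \<in> {1..k}" "l \<noteq> j" for l
          proof (cases "l < j")
            case True
            then show ?thesis using that ij by (intro bexI[of _ l]) (auto simp: b_def)
          next
            case False
            then show ?thesis using that ij by (intro bexI[of _ "l - 1"]) (auto simp: b_def)
          qed
          show ?thesis
          proof (cases "l = j")
            case True
            then show ?thesis using *[of i] ij eq by simp
          qed (use * l in auto)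
        qed
        then have "(\<Union>i\<in>{1..k}. centralizer G (a i)) \<subseteq> (\<Union>m\<in>{1..k - 1}. centralizer G (b m))" by blast
        moreover have "(\<Union>m\<in>{1..k - 1}. centralizer G (b m)) \<subseteq> carrier G"
          by (rule UN_least) (simp add: centralizer_def)
        ultimately show "carrier G = (\<Union>m\<in>{1..k - 1}. centralizer G (b m))"
          unfolding U[symmetric] by (rule equalityI)
      qed
      then have "k \<le> k - 1" by (rule 2(2))
      then show False using ij by auto
    qed
    have "\<exists>i\<in>{1..k}. set gs \<subseteq> centralizer G (a i)" if gs: "gs \<in> commuting_lists G" and ne: "\<not> set gs \<subseteq> {\<one>}" for gs
    proof -
      obtain x where x: "x \<in> set gs" "x \<noteq> \<one>" using ne by blast
      have sub: "set gs \<subseteq> carrier G" using gs by (auto simp: commuting_lists_def)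
      then obtain i where i: "i \<in> {1..k}" "x \<in> centralizer G (a i)" using x U by blast
      have "set gs \<subseteq> centralizer G x" using gs x sub by (auto simp: commuting_lists_def centralizer_def)
      then show ?thesis using centralizer_eq[of "a i" x] a[OF i(1)] i x by auto
    qed
    then show ?thesis using a disj by blast
  qed
  then show "\<And>i. i \<in> {1..k} \<Longrightarrow> a i \<in> carrier G \<and> a i \<noteq> \<one>"
    and "\<And>i j. i \<in> {1..k} \<Longrightarrow> j \<in> {1..k} \<Longrightarrow> i \<noteq> j \<Longrightarrow> centralizer G (a i) \<inter> centralizer G (a j) = {\<one>}"
    and "\<And>gs. gs \<in> commuting_lists G \<Longrightarrow> set gs \<subseteq> {\<one>} \<or> (\<exists>i\<in>{1..k}. set gs \<subseteq> centralizer G (a i))"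
    by blast+
qed

text \<open>
  Every commuting tuple whose labels are not all \<open>1\<close> is a tuple in one of the
  centralizers, and a tuple of labels \<open>1\<close> has a constant configuration, so the
  simplices of the centralizers already determine the topology of the space of commuting
  configurations.
\<close>

theorem wedge_of_centralizers_homeomorphic_commuting_configs:
  assumes cover: "minimal_centralizer_cover G k a"
    and f: "\<And>i. i \<in> {1..k} \<Longrightarrow>
      homeomorphic_map (Y i) (configs (G\<lparr>carrier := centralizer G (a i)\<rparr>)) (f i)"
    and b: "\<And>i. i \<in> {1..k} \<Longrightarrow> b i \<in> topspace (Y i)" "\<And>i. i \<in> {1..k} \<Longrightarrow> f i (b i) = (\<lambda>u. \<one>)"
  shows "wedge {1..k} Y b homeomorphic_space config_space G (commuting_lists G)"
proof (rule wedge_homeomorphic_space)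
  let ?Z = "config_space G (commuting_lists G)"
  let ?A = "\<lambda>i. G\<lparr>carrier := centralizer G (a i)\<rparr>"
  note cover_facts = minimal_cover_properties[OF cover]
  show "f i (b i) = (\<lambda>u. \<one>)" if "i \<in> {1..k}" for i by (rule b(2)[OF that])
  have "[] \<in> commuting_lists G" by (simp add: commuting_lists_def)
  moreover have "(\<lambda>j. if j = 0 then 1 else 0) \<in> standard_simplex (length ([] :: 'a list))" by simp
  ultimately have "simplex_config G [] (\<lambda>j. if j = 0 then 1 else 0) \<in> topspace ?Z"
    unfolding topspace_config_space by blast
  then show zZ: "(\<lambda>u. \<one>) \<in> topspace ?Z" by (simp add: simplex_config_Nil)
  show "inj_on (f i) (insert (b i) (topspace (Y i)))" if "i \<in> {1..k}" for i
    using f[OF that] b(1)[OF that] by (simp add: insert_absorb homeomorphic_map_def)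
  have topA: "topspace (configs (?A i)) = finite_configs (?A i)" if i: "i \<in> {1..k}" for i
  proof -
    interpret A: comm_group "?A i" using comm_group_centralizer cover_facts(1)[OF i] by blast
    show ?thesis by (rule A.topspace_config_space_lists)
  qed
  have img: "f i ` topspace (Y i) = topspace (configs (?A i))" if i: "i \<in> {1..k}" for i
    using f[OF i] homeomorphic_imp_surjective_map by blast
  show "f i ` topspace (Y i) \<inter> f j ` topspace (Y j) \<subseteq> {\<lambda>u. \<one>}"
    if ij: "i \<in> {1..k}" "j \<in> {1..k}" "i \<noteq> j" for i j
  proof
    fix c assume "c \<in> f i ` topspace (Y i) \<inter> f j ` topspace (Y j)"
    then have "c \<in> finite_configs (?A i)" "c \<in> finite_configs (?A j)"
      by (simp_all only: img[OF ij(1)] img[OF ij(2)] topA[OF ij(1)] topA[OF ij(2)] Int_iff)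
    then have "range c \<subseteq> centralizer G (a i) \<inter> centralizer G (a j)"
      by (simp add: finite_configs_def)
    then have "range c \<subseteq> {\<one>}" using cover_facts(2)[OF ij] by simp
    then show "c \<in> {\<lambda>u. \<one>}" by (auto simp: fun_eq_iff)
  qed
  have lists_sub: "lists (centralizer G (a i)) \<subseteq> commuting_lists G" if i: "i \<in> {1..k}" for i
    using centralizer_commute cover_facts(1)[OF i] by (auto simp: commuting_lists_def centralizer_def)
  have split: "set gs \<subseteq> {\<one>} \<or> (\<exists>i\<in>{1..k}. gs \<in> lists (centralizer G (a i)))" if "gs \<in> commuting_lists G" for gs
    using cover_facts(3)[OF that] by auto
  have topA': "topspace (configs (?A i)) =
      {simplex_config G gs t |gs t. gs \<in> lists (centralizer G (a i)) \<and> t \<in> standard_simplex (length gs)}" for i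
    by (simp add: topspace_config_space)
  show "topspace ?Z = insert (\<lambda>u. \<one>) (\<Union>i\<in>{1..k}. f i ` topspace (Y i))"
  proof (intro equalityI subsetI)
    fix c assume "c \<in> topspace ?Z"
    then obtain gs t where gs: "c = simplex_config G gs t" "gs \<in> commuting_lists G" "t \<in> standard_simplex (length gs)"
      unfolding topspace_config_space by blast
    from split[OF gs(2)] show "c \<in> insert (\<lambda>u. \<one>) (\<Union>i\<in>{1..k}. f i ` topspace (Y i))"
    proof
      assume "set gs \<subseteq> {\<one>}"
      then show ?thesis using simplex_config_trivial gs(1) by simp
    next
      assume "\<exists>i\<in>{1..k}. gs \<in> lists (centralizer G (a i))"
      then obtain i where i: "i \<in> {1..k}" "gs \<in> lists (centralizer G (a i))" by blast
      then have "c \<in> f i ` topspace (Y i)" unfolding img[OF i(1)] topA' using gs by blast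
      then show ?thesis using i by blast
    qed
  next
    fix c assume "c \<in> insert (\<lambda>u. \<one>) (\<Union>i\<in>{1..k}. f i ` topspace (Y i))"
    then consider "c = (\<lambda>u. \<one>)" | i where "i \<in> {1..k}" "c \<in> topspace (configs (?A i))"
      using img by blast
    then show "c \<in> topspace ?Z"
    proof cases
      case 2
      then show ?thesis using lists_sub[OF 2(1)] unfolding topA' topspace_config_space[of G] by blast
    qed (use zZ in simp)
  qed
  fix U assume U: "U \<subseteq> topspace ?Z"
  let ?o = "\<lambda>gs. openin (subtopology (powertop_real UNIV) (standard_simplex (length gs)))
        {t \<in> standard_simplex (length gs). simplex_config G gs t \<in> U}"
  have piece: "openin (Y i) {y \<in> topspace (Y i). f i y \<in> U} \<longleftrightarrow> (\<forall>gs\<in>lists (centralizer G (a i)). ?o gs)"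
    if i: "i \<in> {1..k}" for i
  proof -
    let ?X = "configs (?A i)"
    have "{y \<in> topspace (Y i). f i y \<in> U} = {y \<in> topspace (Y i). f i y \<in> U \<inter> topspace ?X}" using img[OF i] by auto
    also have "openin (Y i) \<dots> \<longleftrightarrow> openin ?X (U \<inter> topspace ?X)"
      using f[OF i] unfolding homeomorphic_map_def quotient_map_def by (meson inf_le2)
    also have "\<dots> \<longleftrightarrow> (\<forall>gs\<in>lists (centralizer G (a i)).
       openin (subtopology (powertop_real UNIV) (standard_simplex (length gs)))
        {t \<in> standard_simplex (length gs). simplex_config G gs t \<in> U \<inter> topspace ?X})"
      unfolding openin_config_space[of "?A i"] by simp
    also have "\<dots> \<longleftrightarrow> (\<forall>gs\<in>lists (centralizer G (a i)). ?o gs)"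
    proof (rule ball_cong[OF refl])
      fix gs assume "gs \<in> lists (centralizer G (a i))"
      then have "{t \<in> standard_simplex (length gs). simplex_config G gs t \<in> U \<inter> topspace ?X}
        = {t \<in> standard_simplex (length gs). simplex_config G gs t \<in> U}" unfolding topA' by blast
      then show "openin (subtopology (powertop_real UNIV) (standard_simplex (length gs)))
        {t \<in> standard_simplex (length gs). simplex_config G gs t \<in> U \<inter> topspace ?X} \<longleftrightarrow> ?o gs" by simp
    qed
    finally show ?thesis .
  qed
  show "openin ?Z U \<longleftrightarrow> (\<forall>i\<in>{1..k}. openin (Y i) {y \<in> topspace (Y i). f i y \<in> U})"
  proof
    assume "openin ?Z U"
    then have "\<forall>gs\<in>commuting_lists G. ?o gs" unfolding openin_config_space by blast
    then show "\<forall>i\<in>{1..k}. openin (Y i) {y \<in> topspace (Y i). f i y \<in> U}"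
      using piece lists_sub by blast
  next
    assume "\<forall>i\<in>{1..k}. openin (Y i) {y \<in> topspace (Y i). f i y \<in> U}"
    then have o: "?o gs" if "i \<in> {1..k}" "gs \<in> lists (centralizer G (a i))" for i gs using piece that by blast
    have "?o gs" if gs: "gs \<in> commuting_lists G" for gs
    proof (cases "set gs \<subseteq> {\<one>}")
      case True
      show ?thesis
      proof (cases "(\<lambda>u. \<one>) \<in> U")
        case True
        then have "{t \<in> standard_simplex (length gs). simplex_config G gs t \<in> U} = standard_simplex (length gs)"
          using simplex_config_trivial[OF \<open>set gs \<subseteq> {\<one>}\<close>] by simp
        then show ?thesis by (metis openin_topspace topspace_standard_simplex)
      next
        case False
        then have "{t \<in> standard_simplex (length gs). simplex_config G gs t \<in> U} = {}"
          using simplex_config_trivial[OF \<open>set gs \<subseteq> {\<one>}\<close>] by simp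
        then show ?thesis by (simp only: openin_empty)
      qed
    next
      case False
      then show ?thesis using split[OF gs] o by blast
    qed
    then show "openin ?Z U" using U unfolding openin_config_space by blast
  qed
qed

end

theorem corollary8p5:
  fixes G :: "('a, 'b) monoid_scheme"
    and k :: nat
    and a :: "nat \<Rightarrow> 'a"
    and P :: "nat \<Rightarrow> nat \<Rightarrow> 'a set"
  assumes "group G"
    and "finite (carrier G)"
    and "transitively_commutative G"
    and "center G = {\<one>\<^bsub>G\<^esub>}"
    and "minimal_centralizer_cover G k a"
    and "\<And>i p. i \<in> {1..k} \<Longrightarrow> p \<in> prime_factors (card (centralizer G (a i))) \<Longrightarrow>
           P i p \<in> sylow_subgroups p G"
  shows "B2 G homotopy_equivalent_space
    wedge {1..k}
      (\<lambda>i. product_topology (\<lambda>p. classifying_space (G\<lparr>carrier := P i p\<rparr>))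
             (prime_factors (card (centralizer G (a i)))))
      (\<lambda>i. \<lambda>p \<in> prime_factors (card (centralizer G (a i))).
             classifying_space_base (G\<lparr>carrier := P i p\<rparr>))"
proof -
  interpret centerless_tc_group G
    using assms(1-4) by (simp add: centerless_tc_group_def centerless_tc_group_axioms_def)
  let ?Y = "\<lambda>i. product_topology (\<lambda>p. classifying_space (G\<lparr>carrier := P i p\<rparr>))
             (prime_factors (card (centralizer G (a i))))"
  let ?b = "\<lambda>i. \<lambda>p \<in> prime_factors (card (centralizer G (a i))). classifying_space_base (G\<lparr>carrier := P i p\<rparr>)"
  have "\<exists>f. homeomorphic_map (?Y i) (configs (G\<lparr>carrier := centralizer G (a i)\<rparr>)) f \<and>
      ?b i \<in> topspace (?Y i) \<and> f (?b i) = (\<lambda>u. \<one>\<^bsub>G\<^esub>)" if i: "i \<in> {1..k}" for i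
  proof -
    have ai: "a i \<in> carrier G" "a i \<noteq> \<one>\<^bsub>G\<^esub>" using minimal_cover_properties(1)[OF assms(5) i] by auto
    obtain \<iota> \<rho> where "abelian_decomposition (G\<lparr>carrier := centralizer G (a i)\<rparr>)
        (prime_factors (card (centralizer G (a i)))) (\<lambda>p. G\<lparr>carrier := P i p\<rparr>) \<iota> \<rho>"
      using abelian_decomposition_centralizer[OF ai, of "P i"] assms(6)[OF i] by metis
    then show ?thesis
      by (rule abelian_decomposition.product_classifying_spaces_homeomorphic_configs) auto
  qed
  then have "\<forall>i\<in>{1..k}. \<exists>f. homeomorphic_map (?Y i) (configs (G\<lparr>carrier := centralizer G (a i)\<rparr>)) f \<and>
      ?b i \<in> topspace (?Y i) \<and> f (?b i) = (\<lambda>u. \<one>\<^bsub>G\<^esub>)" by blast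
  from bchoice[OF this] obtain f where "\<forall>i\<in>{1..k}.
      homeomorphic_map (?Y i) (configs (G\<lparr>carrier := centralizer G (a i)\<rparr>)) (f i) \<and>
      ?b i \<in> topspace (?Y i) \<and> f i (?b i) = (\<lambda>u. \<one>\<^bsub>G\<^esub>)" ..
  then have f: "\<And>i. i \<in> {1..k} \<Longrightarrow>
      homeomorphic_map (?Y i) (configs (G\<lparr>carrier := centralizer G (a i)\<rparr>)) (f i)"
    "\<And>i. i \<in> {1..k} \<Longrightarrow> ?b i \<in> topspace (?Y i)" "\<And>i. i \<in> {1..k} \<Longrightarrow> f i (?b i) = (\<lambda>u. \<one>\<^bsub>G\<^esub>)"
    by blast+
  have "wedge {1..k} ?Y ?b homeomorphic_space config_space G (commuting_lists G)"
    by (rule wedge_of_centralizers_homeomorphic_commuting_configs[where Y = ?Y and b = ?b and f = f, OF assms(5)])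
      (fact f)+
  moreover have "B2 G homeomorphic_space config_space G (commuting_lists G)"
  proof -
    interpret tuple_family G "commuting_lists G" by (rule tuple_family_commuting_lists)
    show ?thesis unfolding B2_def commuting_tuples_eq_tuple_complex
      by (rule realization_homeomorphic_config_space) (rule homeomorphic_map_imp_homeomorphic_space)
  qed
  ultimately have "B2 G homeomorphic_space wedge {1..k} ?Y ?b"
    using homeomorphic_space_sym homeomorphic_space_trans by blast
  then show ?thesis by (rule homeomorphic_imp_homotopy_equivalent_space)
qed

end
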